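(* Let $a:\mathbb{N}\to\mathbb{Z}$ be a completely additive function with $a(p)\in\{-1,0,1\}$ for every prime $p$. Then the following hold: (i) $(X,\mu,T^a)$ is pretentiously ergodic for all ergodic additive systems $(X,\mu,T)$ if and only if $a(p)\neq0$ for many primes. (ii) If $a(p)=1$ for almost every prime, then $(X,\mu,T^a)$ is aperiodic for all ergodic additive systems $(X,\mu,T)$. In particular, for any ergodic additive system $(X,\mu,T)$, the system $(X,\mu,T^\Omega)$ is aperiodic, and for any $\mathcal{P}\subseteq\mathbb{P}$ the system $(X,\mu,T^{\Omega_{\mathcal{P}}})$ is pretentiously ergodic if $\mathcal{P}$ contains many primes, and aperiodic if $\mathcal{P}$ contains almost every prime.
   Context: $\mathbb{N}=\{1,2,\dots\}$ and $\mathbb{P}$ is the set of primes. Every probability space $(X,\mu)$ is assumed regular: $X$ is a compact metric space with its Borel $\sigma$-algebra. An additive system $(X,\mu,T)$ is a probability space with an invertible measure-preserving transformation $T$. A function $a:\mathbb{N}\to\mathbb{Z}$ is completely additive if $a(nm)=a(n)+a(m)$ for all $n,m\in\mathbb{N}$. For such $a$, $(X,\mu,T^a)$ is the system with $S=(S_n)_{n\in\mathbb{N}}$, $S_n=T^{a(n)}$, which satisfies $S_{nm}=S_n\circ S_m$. It is finitely generated when $\{a(p):p\in\mathbb{P}\}$ is finite. For $F\in L^2(X)$, $S_nF=F\circ S_n$. The system $(X,\mu,S)$ is pretentiously ergodic if every measurable $A\subseteq X$ with $\sum_{p\in\mathbb{P}}\frac{\|S_p\mathbf{1}_A-\mathbf{1}_A\|_2^2}{p}<\infty$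 satisfies $\mu(A)\in\{0,1\}$. It is aperiodic if for any $F\in L^2(X)$ and $r,q\in\mathbb{N}$, $\lim_{N\to\infty}\frac1N\sum_{n=1}^N S_{qn+r}F=\int_XF\,d\mu$ in $L^2(X)$. A property holds for many primes if the set $\mathcal{P}$ of primes satisfying it has $\sum_{p\in\mathcal{P}}\frac1p=\infty$, and for almost every prime if $\sum_{p\notin\mathcal{P}}\frac1p<\infty$ (sum over primes not in $\mathcal{P}$); a set $\mathcal{P}$ contains many primes (resp. almost every prime) if membership in $\mathcal{P}$ holds for many (resp. almost every) prime. $\Omega(n)$ is the number of prime factors of $n$ counted with multiplicity, and $\Omega_{\mathcal{P}}(n)$ the number of prime factors of $n$ lying in $\mathcal{P}$, counted with multiplicity. *)

theory Defs
  imports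
    "HOL-Probability.Probability"
    "HOL-Computational_Algebra.Primes"
begin

text \<open>
  The positive integers are rendered as type \<^typ>\<open>nat\<close> with an explicit positivity condition
  where it matters; the value of a function at 0 is never used.
\<close>

definition completely_additive :: "(nat \<Rightarrow> int) \<Rightarrow> bool" where
  "completely_additive a \<longleftrightarrow> (\<forall>n>0. \<forall>m>0. a (n * m) = a n + a m)"

definition many_primes :: "nat set \<Rightarrow> bool" where
  "many_primes P \<longleftrightarrow> \<not> (\<lambda>p. 1 / real p) summable_on {p. prime p \<and> p \<in> P}"

definition almost_every_prime :: "nat set \<Rightarrow> bool" where
  "almost_every_prime P \<longleftrightarrow> (\<lambda>p. 1 / real p) summable_on {p. prime p \<and> p \<notin> P}"

definition Omega_in :: "nat set \<Rightarrow> nat \<Rightarrow> nat" where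
  "Omega_in P n = size (filter_mset (\<lambda>p. p \<in> P) (prime_factorization n))"

definition Omega :: "nat \<Rightarrow> nat" where
  "Omega n = size (prime_factorization n)"

text \<open>
  The compact metric space is the carrier \<^term>\<open>space \<mu>\<close>, a subset of the type \<^typ>\<open>'a\<close>;
  the metric is unrelated to any metric the type may already have, and only its Borel sets matter.
  Since a compact metric space has at most the cardinality of the continuum, every regular
  probability space is isomorphic to one with carrier in \<^typ>\<open>real\<close>. Hence quantifying over
  all \<mu> of type \<^typ>\<open>real measure\<close> inside a formula quantifies over all regular
  probability spaces up to isomorphism.
\<close>

definition regular_prob_space :: "'a measure \<Rightarrow> bool" where
  "regular_prob_space \<mu> \<longleftrightarrow> prob_space \<mu> \<and>
     (\<exists>d. Metric_space (space \<mu>) d \<and>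
          compact_space (Metric_space.mtopology (space \<mu>) d) \<and>
          sets \<mu> = sigma_sets (space \<mu>) {U. openin (Metric_space.mtopology (space \<mu>) d) U})"

definition additive_system :: "'a measure \<Rightarrow> ('a \<Rightarrow> 'a) \<Rightarrow> bool" where
  "additive_system \<mu> T \<longleftrightarrow> regular_prob_space \<mu> \<and>
     bij_betw T (space \<mu>) (space \<mu>) \<and>
     T \<in> measurable \<mu> \<mu> \<and> inv_into (space \<mu>) T \<in> measurable \<mu> \<mu> \<and>
     distr \<mu> \<mu> T = \<mu>"

definition ergodic_additive_system :: "'a measure \<Rightarrow> ('a \<Rightarrow> 'a) \<Rightarrow> bool" where
  "ergodic_additive_system \<mu> T \<longleftrightarrow> additive_system \<mu> T \<and>
     (\<forall>A\<in>sets \<mu>. T -` A \<inter> space \<mu> = A \<longrightarrow> measure \<mu> A = 0 \<or> measure \<mu> A = 1)"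

text \<open>The power \<open>T\<^sup>k\<close> for an integer \<open>k\<close>, with the inverse of \<open>T\<close> taken on the carrier.\<close>

definition int_iterate :: "'a measure \<Rightarrow> ('a \<Rightarrow> 'a) \<Rightarrow> int \<Rightarrow> 'a \<Rightarrow> 'a" where
  "int_iterate \<mu> T k =
     (if k \<ge> 0 then T ^^ nat k else inv_into (space \<mu>) T ^^ nat (- k))"

definition power_action :: "'a measure \<Rightarrow> ('a \<Rightarrow> 'a) \<Rightarrow> (nat \<Rightarrow> int) \<Rightarrow> nat \<Rightarrow> 'a \<Rightarrow> 'a" where
  "power_action \<mu> T a n = int_iterate \<mu> T (a n)"

text \<open>
  Square-integrable functions are complex valued and represented by functions, not by classes
  modulo null sets.
\<close>

definition L2_fun :: "'a measure \<Rightarrow> ('a \<Rightarrow> complex) \<Rightarrow> bool" where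
  "L2_fun \<mu> F \<longleftrightarrow> F \<in> borel_measurable \<mu> \<and> integrable \<mu> (\<lambda>x. (cmod (F x))\<^sup>2)"

definition L2_norm :: "'a measure \<Rightarrow> ('a \<Rightarrow> complex) \<Rightarrow> real" where
  "L2_norm \<mu> F = sqrt (\<integral>x. (cmod (F x))\<^sup>2 \<partial>\<mu>)"

text \<open>
  For a series of nonnegative terms, summability is the same as finiteness of the sum.
\<close>

definition pretentiously_ergodic :: "'a measure \<Rightarrow> (nat \<Rightarrow> 'a \<Rightarrow> 'a) \<Rightarrow> bool" where
  "pretentiously_ergodic \<mu> S \<longleftrightarrow>
     (\<forall>A\<in>sets \<mu>.
        (\<lambda>p. (L2_norm \<mu> (\<lambda>x. indicator A (S p x) - indicator A x))\<^sup>2 / real p)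
          summable_on {p. prime p} \<longrightarrow>
        measure \<mu> A = 0 \<or> measure \<mu> A = 1)"

definition aperiodic :: "'a measure \<Rightarrow> (nat \<Rightarrow> 'a \<Rightarrow> 'a) \<Rightarrow> bool" where
  "aperiodic \<mu> S \<longleftrightarrow>
     (\<forall>F r q. L2_fun \<mu> F \<longrightarrow> r \<ge> 1 \<longrightarrow> q \<ge> 1 \<longrightarrow>
        (\<lambda>N. L2_norm \<mu> (\<lambda>x. (\<Sum>n=1..N. F (S (q * n + r) x)) / of_nat N - (\<integral>y. F y \<partial>\<mu>)))
          \<longlonglongrightarrow> 0)"

end

theory Submission
  imports
    Defs
    "HOL-Number_Theory.Number_Theory"
    "HOL-Computational_Algebra.Squarefree"
    "HOL-Real_Asymp.Real_Asymp"
begin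

text \<open>
  Pretentious ergodicity only needs that \<open>S\<^sub>p = T\<^sup>\<plusminus>\<^sup>1\<close> for many primes, which forces a set of finite
  pretentious distance to be invariant.

  For aperiodicity let \<open>M c x\<close> be the average of \<open>F \<circ> T\<^bsup>a m\<^esup>\<close> over \<open>m \<le> x\<close>, \<open>m \<equiv> c (mod q)\<close>, with
  \<open>F\<close> of mean zero. With \<open>\<Lambda>\<^sub>2 = \<Lambda> ln + \<Lambda> * \<Lambda>\<close> the identity \<open>ln\<^sup>2 = 1 * \<Lambda>\<^sub>2\<close> expresses \<open>M c x\<close> as the
  \<open>\<Lambda>\<^sub>2 n / n\<close>-weighted mean of \<open>T\<^bsup>a n\<^esup> M (c / n) (x / n)\<close>. If \<open>\<parallel>M c x\<parallel>\<close> is close to the largest limiting norm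
  \<open>L\<close>, strict convexity makes nearly all of these vectors close to \<open>M c x\<close>: those at primes are
  \<open>T M\<close>, those at products of two primes are \<open>T\<^sup>2 M\<close>. By Selberg's formula in progressions every short
  interval meets every residue class in primes or in products of two primes. If both occur, some nearly maximal
  average is nearly \<open>T\<close>-invariant, which the mean ergodic theorem only allows for \<open>L = 0\<close>. Otherwise,
  \<open>M\<close> being continuous in \<open>ln x\<close>, each class contains only primes, or only products of two primes, throughout a
  long window; comparing base points shows that the type of a class is a real character up to
  sign, and this contradicts \<open>L(1, \<psi>) \<noteq> 0\<close>.
\<close>

section \<open>Residue classes and Moebius inversion\<close>

text \<open>For the swap of two points and a = Omega, aperiodicity says that the Liouville function
  has mean zero on progressions, which is as deep as the prime number theorem in progressions; so
  nothing about primes in single classes may be presupposed. Selberg's formula is elementary, but it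
  cannot tell primes from products of two primes, and this parity obstacle shapes the argument. If a
  class has one type throughout a window, its primes have logarithmic density 2 / phi q or 0,
  whereas by Mertens the densities of all classes add up to 1; hence both types occur. With s \<psi>
  = 1 on the prime type, the sum of s \<psi>(n) \<Lambda>(n) / n over the window grows with its
  length D, while L(1, \<psi>) \<noteq> 0 keeps it bounded. As \<psi> appears only at the end, D
  must be fixed against all real characters at once. Only unit classes are averaged, because c / n
  must make sense; a common factor of q and r is split off at the very end. The argument on averages
  uses a semi-inner product only: the mean ergodic theorem enters through small dyadic convex
  combinations of the functions F o T^k.\<close>

definition rinv :: "nat \<Rightarrow> nat \<Rightarrow> nat" where
  "rinv q n = n ^ (totient q - 1)"

text \<open>An equation and not only a congruence, since the inverse is Euler's power and is never
  reduced modulo \<open>q\<close>. Iterated quotients c / k / m can therefore be rewritten as c / (k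
  m).\<close>

lemma rinv_mult: "rinv q (m * n) = rinv q m * rinv q n"
  by (simp add: rinv_def power_mult_distrib)

lemma coprime_rinv: "coprime n q \<Longrightarrow> coprime (rinv q n) q"
  by (simp add: rinv_def)

lemma rinv_1 [simp]: "rinv q (Suc 0) = 1"
  by (simp add: rinv_def)

lemma rinv_cong:
  assumes "coprime n q" "q > 0"
  shows "[n * rinv q n = 1] (mod q)"
proof -
  have "n * rinv q n = n ^ totient q"
    using assms by (simp add: rinv_def flip: power_Suc)
  thus ?thesis using euler_theorem[OF assms(1)] by simp
qed

lemma cong_rinv_iff:
  assumes "coprime n q" "q > 0"
  shows "[n * m = c] (mod q) \<longleftrightarrow> [m = c * rinv q n] (mod q)"
proof
  assume "[n * m = c] (mod q)"
  hence "[n * m * rinv q n = c * rinv q n] (mod q)" by (rule cong_mult) simp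
  moreover have "[(n * rinv q n) * m = 1 * m] (mod q)" by (intro cong_mult rinv_cong assms) simp
  ultimately show "[m = c * rinv q n] (mod q)"
    by (simp add: mult_ac) (metis cong_sym cong_trans)
next
  assume "[m = c * rinv q n] (mod q)"
  hence "[n * m = n * (c * rinv q n)] (mod q)" by (intro cong_mult) simp_all
  moreover have "[(n * rinv q n) * c = 1 * c] (mod q)" by (intro cong_mult rinv_cong assms) simp
  ultimately show "[n * m = c] (mod q)"
    by (simp add: mult_ac) (metis cong_trans)
qed

text \<open>The upper limits are real because every divisor sum below passes from x to x /
  d.\<close>

definition upto_real :: "real \<Rightarrow> nat set" where
  "upto_real x = {m. 0 < m \<and> real m \<le> x}"

definition ap :: "nat \<Rightarrow> nat \<Rightarrow> real \<Rightarrow> nat set" where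
  "ap q c x = {m. 0 < m \<and> real m \<le> x \<and> [m = c] (mod q)}"

definition cop :: "nat \<Rightarrow> real \<Rightarrow> nat set" where
  "cop q x = {m. 0 < m \<and> real m \<le> x \<and> coprime m q}"

lemma upto_real_altdef: "upto_real x = {1..nat \<lfloor>x\<rfloor>}"
  by (auto simp: upto_real_def le_nat_floor) linarith

lemma finite_upto_real [simp, intro]: "finite (upto_real x)"
  by (simp add: upto_real_altdef)

lemma ap_subset: "ap q c x \<subseteq> upto_real x" and cop_subset: "cop q x \<subseteq> upto_real x"
  by (auto simp: ap_def cop_def upto_real_def)

lemma finite_ap [simp, intro]: "finite (ap q c x)" and finite_cop [simp, intro]: "finite (cop q x)"
  using ap_subset cop_subset finite_subset finite_upto_real by metis+

lemma ap_1: "ap (Suc 0) c x = upto_real x" and cop_1: "cop (Suc 0) x = upto_real x"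
  by (auto simp: ap_def cop_def upto_real_def)

lemma card_upto_real: "x \<ge> 0 \<Longrightarrow> real (card (upto_real x)) \<le> x"
  by (simp add: upto_real_altdef)

lemma ap_cong: "[c = c'] (mod q) \<Longrightarrow> ap q c x = ap q c' x"
  by (auto simp: ap_def intro: cong_trans cong_sym)

lemma coprime_if_in_ap: "m \<in> ap q c x \<Longrightarrow> coprime c q \<Longrightarrow> coprime m q"
  unfolding ap_def using cong_imp_coprime cong_sym by blast

text \<open>Dirichlet convolution along a progression: writing k = d m, the cofactor m runs through
  the class c / d. As c is a unit modulo \<open>q\<close>, all divisors of k are units too, so d may
  be restricted to \<open>cop\<close>.\<close>

lemma sum_divisors_ap:
  fixes f :: "nat \<Rightarrow> nat \<Rightarrow> 'b :: comm_monoid_add"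
  assumes "q > 0" "coprime c q"
  shows "(\<Sum>k\<in>ap q c x. \<Sum>d | d dvd k. f d (k div d)) =
         (\<Sum>d\<in>cop q x. \<Sum>m\<in>ap q (c * rinv q d) (x / real d). f d m)"
proof -
  have fin: "finite {d. d dvd k}" if "k \<in> ap q c x" for k
    using that by (auto simp: ap_def)
  have "(\<Sum>k\<in>ap q c x. \<Sum>d | d dvd k. f d (k div d)) =
        (\<Sum>(k,d)\<in>(SIGMA k:ap q c x. {d. d dvd k}). f d (k div d))"
    using fin by (subst sum.Sigma) auto
  also have "\<dots> = (\<Sum>(d,m)\<in>(SIGMA d:cop q x. ap q (c * rinv q d) (x / real d)). f d m)"
  proof (rule sum.reindex_bij_witness[of _ "\<lambda>(d,m). (d * m, d)" "\<lambda>(k,d). (d, k div d)"]; clarsimp)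
    fix k d :: nat assume k: "k \<in> ap q c x" and d: "d dvd k"
    have cop: "coprime d q"
      using coprime_if_in_ap[OF k assms(2)] d by (meson coprime_divisors dvd_refl)
    have k': "k > 0" "real k \<le> x" "[k = c] (mod q)" using k by (auto simp: ap_def)
    obtain m where m: "k = d * m" using d by blast
    with k' have pos: "d > 0" "m > 0" by auto
    have "real d \<le> real k" using d k' by (simp add: dvd_imp_le)
    with k' have "real d \<le> x" by linarith
    thus "d \<in> cop q x \<and> k div d \<in> ap q (c * rinv q d) (x / real d)"
      using k' cop pos m cong_rinv_iff[OF cop assms(1), of m c]
      by (auto simp: cop_def ap_def field_simps)
  next
    fix d m :: nat assume d: "d \<in> cop q x" and m: "m \<in> ap q (c * rinv q d) (x / real d)"
    thus "d * m \<in> ap q c x"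
      using cong_rinv_iff[OF _ assms(1), of d m c] by (auto simp: cop_def ap_def field_simps)
  qed (auto simp: cop_def)
  also have "\<dots> = (\<Sum>d\<in>cop q x. \<Sum>m\<in>ap q (c * rinv q d) (x / real d). f d m)"
    by (subst sum.Sigma) auto
  finally show ?thesis .
qed

lemma sum_divisors_cop:
  fixes f :: "nat \<Rightarrow> nat \<Rightarrow> 'b :: comm_monoid_add"
  assumes "q > 0"
  shows "(\<Sum>k\<in>cop q x. \<Sum>d | d dvd k. f d (k div d)) =
         (\<Sum>d\<in>cop q x. \<Sum>m\<in>cop q (x / real d). f d m)"
proof -
  have fin: "finite {d. d dvd k}" if "k \<in> cop q x" for k
    using that by (auto simp: cop_def)
  have "(\<Sum>k\<in>cop q x. \<Sum>d | d dvd k. f d (k div d)) =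
        (\<Sum>(k,d)\<in>(SIGMA k:cop q x. {d. d dvd k}). f d (k div d))"
    using fin by (subst sum.Sigma) auto
  also have "\<dots> = (\<Sum>(d,m)\<in>(SIGMA d:cop q x. cop q (x / real d)). f d m)"
  proof (rule sum.reindex_bij_witness[of _ "\<lambda>(d,m). (d * m, d)" "\<lambda>(k,d). (d, k div d)"]; clarsimp)
    fix k d :: nat assume k: "k \<in> cop q x" and d: "d dvd k"
    obtain m where m: "k = d * m" using d by blast
    have "real d \<le> real k" using d k by (simp add: dvd_imp_le cop_def)
    hence "real d \<le> x" using k by (simp add: cop_def)
    thus "d \<in> cop q x \<and> k div d \<in> cop q (x / real d)"
      using k m by (auto simp: cop_def field_simps)
  qed (auto simp: cop_def field_simps)
  also have "\<dots> = (\<Sum>d\<in>cop q x. \<Sum>m\<in>cop q (x / real d). f d m)"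
    by (subst sum.Sigma) auto
  finally show ?thesis .
qed

lemma sum_divisors_upto:
  fixes f :: "nat \<Rightarrow> nat \<Rightarrow> 'b :: comm_monoid_add"
  shows "(\<Sum>k\<in>upto_real x. \<Sum>d | d dvd k. f d (k div d)) =
         (\<Sum>d\<in>upto_real x. \<Sum>m\<in>upto_real (x / real d). f d m)"
  using sum_divisors_cop[of "Suc 0" f x] by (simp add: cop_1)

section \<open>Moebius inversion over classes and scales\<close>

definition moebius :: "nat \<Rightarrow> real" where
  "moebius n = (if squarefree n then (-1) ^ card (prime_factors n) else 0)"

lemma abs_moebius_le: "\<bar>moebius n\<bar> \<le> 1"
  by (simp add: moebius_def)

lemma moebius_prime_mult:
  assumes p: "prime p" and np: "\<not> p dvd e"
  shows "moebius (p * e) = - moebius e"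
proof -
  have e: "e \<noteq> 0" using np by (intro notI) auto
  have cop: "coprime p e" using p np prime_imp_coprime by blast
  have "squarefree (p * e) \<longleftrightarrow> squarefree e"
    using p cop by (auto dest: squarefree_multD intro: squarefree_mult_coprime squarefree_prime)
  moreover have "prime_factors (p * e) = insert p (prime_factors e)"
    using p e by (simp add: prime_factors_product prime_prime_factors prime_gt_0_nat)
  moreover have "p \<notin> prime_factors e" using np by auto
  ultimately show ?thesis by (simp add: moebius_def)
qed

text \<open>For a prime p dividing n, the divisors d prime to p cancel against p d; every other
  divisor is a multiple of p^2 and contributes 0.\<close>

lemma moebius_sum_divisors:
  assumes "n > 0"
  shows "(\<Sum>d | d dvd n. moebius d) = (if n = 1 then 1 else 0)"
proof (cases "n = 1")
  case True
  thus ?thesis by (simp add: moebius_def)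
next
  case False
  then obtain p where p: "prime p" "p dvd n" using prime_factor_nat by blast
  have fin: "finite {d. d dvd n}" using assms by auto
  have "(\<Sum>d | d dvd n. moebius d) = (\<Sum>d | d dvd n \<and> \<not> p dvd d. moebius d) + (\<Sum>d | d dvd n \<and> p dvd d. moebius d)"
    using fin by (subst sum.union_disjoint [symmetric]) (auto intro!: sum.cong)
  also have "(\<Sum>d | d dvd n \<and> p dvd d. moebius d) = (\<Sum>d\<in>(*) p ` {d. d dvd n \<and> \<not> p dvd d}. moebius d)"
  proof (rule sum.mono_neutral_right)
    show "finite {d. d dvd n \<and> p dvd d}" using fin by simp
    show "(*) p ` {d. d dvd n \<and> \<not> p dvd d} \<subseteq> {d. d dvd n \<and> p dvd d}"
      using p by (auto intro!: divides_mult prime_imp_coprime)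
    show "\<forall>i\<in>{d. d dvd n \<and> p dvd d} - (*) p ` {d. d dvd n \<and> \<not> p dvd d}. moebius i = 0"
    proof
      fix i assume i: "i \<in> {d. d dvd n \<and> p dvd d} - (*) p ` {d. d dvd n \<and> \<not> p dvd d}"
      then obtain e where e: "i = p * e" by blast
      with i have "p dvd e" by (auto dest: dvd_mult_right)
      hence "p\<^sup>2 dvd i" by (auto simp: e power2_eq_square)
      hence "\<not> squarefree i" using p by (auto simp: squarefree_def)
      thus "moebius i = 0" by (simp add: moebius_def)
    qed
  qed
  also have "\<dots> = (\<Sum>d | d dvd n \<and> \<not> p dvd d. moebius (p * d))"
    using p by (subst sum.reindex) (auto simp: inj_on_def)
  also have "\<dots> = - (\<Sum>d | d dvd n \<and> \<not> p dvd d. moebius d)"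
    by (simp add: moebius_prime_mult[OF p(1)] sum_negf)
  finally show ?thesis using False by simp
qed

lemma sum_inverse_sqrt_le:
  "(\<Sum>k=1..N. 1 / sqrt (real k)) \<le> 2 * sqrt (real N)"
proof (induction N)
  case (Suc N)
  have "2 * sqrt (real (Suc N)) - 2 * sqrt (real N) = 2 / (sqrt (real (Suc N)) + sqrt (real N))"
  proof -
    have "sqrt (real (Suc N)) + sqrt (real N) > 0" by (simp add: add_pos_nonneg)
    moreover have "(sqrt (real (Suc N)) - sqrt (real N)) * (sqrt (real (Suc N)) + sqrt (real N)) = 1"
      by (simp add: algebra_simps flip: power2_eq_square)
    ultimately show ?thesis by (simp add: field_simps)
  qed
  also have "\<dots> \<ge> 2 / (sqrt (real (Suc N)) + sqrt (real (Suc N)))"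
    by (intro divide_left_mono mult_pos_pos add_pos_nonneg add_left_mono) auto
  finally show ?case using Suc by simp
qed simp

lemma sum_inverse_sqrt_upto_le:
  assumes "x \<ge> 0"
  shows "(\<Sum>k\<in>upto_real x. 1 / sqrt (real k)) \<le> 2 * sqrt x"
proof -
  have "(\<Sum>k\<in>upto_real x. 1 / sqrt (real k)) \<le> 2 * sqrt (real (nat \<lfloor>x\<rfloor>))"
    unfolding upto_real_altdef by (rule sum_inverse_sqrt_le)
  also have "\<dots> \<le> 2 * sqrt x" using assms by simp
  finally show ?thesis .
qed

text \<open>The values h c x are recovered from the sums over m of h (c / m) (x / m) by weighting
  the sums at (c / k, x / k) with moebius k. Summing the bounds K sqrt (x / k) over k \<le> x costs
  2 K x: an error sqrt x leads to x without a logarithm, which Selberg's formula cannot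
  afford.\<close>

lemma moebius_inversion_bound:
  fixes h :: "nat \<Rightarrow> real \<Rightarrow> real"
  assumes q: "q > 0" and K: "K \<ge> 0"
    and bd: "\<And>c x. coprime c q \<Longrightarrow> x \<ge> 1 \<Longrightarrow> \<bar>\<Sum>m\<in>cop q x. h (c * rinv q m) (x / real m)\<bar> \<le> K * sqrt x"
    and c: "coprime c q" and x: "x \<ge> 1"
  shows "\<bar>h c x\<bar> \<le> 2 * K * x"
proof -
  define R where "R = (\<lambda>c x. \<Sum>m\<in>cop q x. h (c * rinv q m) (x / real m))"
  have one_cop: "Suc 0 \<in> cop q x" using x by (simp add: cop_def)
  have "(\<Sum>k\<in>cop q x. moebius k * R (c * rinv q k) (x / real k)) =
        (\<Sum>k\<in>cop q x. \<Sum>m\<in>cop q (x / real k). moebius k * h (c * rinv q (k * m)) (x / real (k * m)))"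
    by (simp add: R_def sum_distrib_left rinv_mult mult_ac)
  also have "\<dots> = (\<Sum>n\<in>cop q x. \<Sum>d | d dvd n. moebius d * h (c * rinv q (d * (n div d))) (x / real (d * (n div d))))"
    by (rule sum_divisors_cop[OF q, symmetric])
  also have "\<dots> = (\<Sum>n\<in>cop q x. (\<Sum>d | d dvd n. moebius d) * h (c * rinv q n) (x / real n))"
    unfolding sum_distrib_right by (intro sum.cong refl) auto
  also have "\<dots> = (\<Sum>n\<in>cop q x. if n = 1 then h (c * rinv q n) (x / real n) else 0)"
    by (intro sum.cong refl) (auto simp: moebius_sum_divisors cop_def)
  also have "\<dots> = h c x"
    using x by (subst sum.delta) (simp_all add: one_cop)
  finally have eq: "h c x = (\<Sum>k\<in>cop q x. moebius k * R (c * rinv q k) (x / real k))" ..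
  have "\<bar>h c x\<bar> \<le> (\<Sum>k\<in>cop q x. \<bar>moebius k * R (c * rinv q k) (x / real k)\<bar>)"
    unfolding eq by (rule sum_abs)
  also have "\<dots> \<le> (\<Sum>k\<in>cop q x. K * sqrt x * (1 / sqrt (real k)))"
  proof (rule sum_mono)
    fix k assume k: "k \<in> cop q x"
    have "\<bar>moebius k * R (c * rinv q k) (x / real k)\<bar> \<le> 1 * (K * sqrt (x / real k))"
      unfolding abs_mult R_def using k c
      by (intro mult_mono abs_moebius_le bd) (auto simp: cop_def coprime_rinv)
    thus "\<bar>moebius k * R (c * rinv q k) (x / real k)\<bar> \<le> K * sqrt x * (1 / sqrt (real k))"
      by (simp add: real_sqrt_divide)
  qed
  also have "\<dots> \<le> (\<Sum>k\<in>upto_real x. K * sqrt x * (1 / sqrt (real k)))"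
    using x K by (intro sum_mono2 cop_subset) auto
  also have "\<dots> = K * sqrt x * (\<Sum>k\<in>upto_real x. 1 / sqrt (real k))"
    by (simp add: sum_distrib_left)
  also have "\<dots> \<le> K * sqrt x * (2 * sqrt x)"
    using x K by (intro mult_left_mono sum_inverse_sqrt_upto_le) auto
  also have "\<dots> = 2 * K * x" using x by simp
  finally show ?thesis .
qed

section \<open>Partial summation\<close>

lemma abel_bound:
  fixes e f :: "nat \<Rightarrow> real"
  assumes B: "\<And>k. \<bar>\<Sum>i=1..k. e i\<bar> \<le> B" and K: "K \<ge> 1"
  shows "\<bar>\<Sum>i=1..K. e i * f i\<bar> \<le> B * (\<bar>f K\<bar> + (\<Sum>i=1..<K. \<bar>f i - f (Suc i)\<bar>))"
proof -
  have B0: "B \<ge> 0" using B[of 0] by simp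
  have "\<bar>(\<Sum>i=1..K. e i * f i) - (\<Sum>i=1..K. e i) * f K\<bar> \<le> B * (\<Sum>i=1..<K. \<bar>f i - f (Suc i)\<bar>)"
    using K
  proof (induction K rule: dec_induct)
    case (step K)
    have "(\<Sum>i=1..Suc K. e i * f i) - (\<Sum>i=1..Suc K. e i) * f (Suc K) =
      ((\<Sum>i=1..K. e i * f i) - (\<Sum>i=1..K. e i) * f K) + (\<Sum>i=1..K. e i) * (f K - f (Suc K))"
      by (simp add: algebra_simps)
    also have "\<bar>\<dots>\<bar> \<le> B * (\<Sum>i=1..<K. \<bar>f i - f (Suc i)\<bar>) + B * \<bar>f K - f (Suc K)\<bar>"
      by (intro order_trans[OF abs_triangle_ineq] add_mono step.IH)
         (simp only: abs_mult mult_right_mono[OF B] abs_ge_zero)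
    also have "\<dots> = B * (\<Sum>i=1..<Suc K. \<bar>f i - f (Suc i)\<bar>)"
      using step.hyps by (simp add: algebra_simps)
    finally show ?case .
  qed simp
  moreover have "\<bar>(\<Sum>i=1..K. e i) * f K\<bar> \<le> B * \<bar>f K\<bar>"
    by (simp only: abs_mult mult_right_mono[OF B] abs_ge_zero)
  ultimately show ?thesis unfolding distrib_left by linarith
qed

lemma sum_greaterThanAtMost_shift:
  fixes g :: "nat \<Rightarrow> 'b :: comm_monoid_add"
  shows "(\<Sum>i\<in>{M<..M+k}. g i) = (\<Sum>i=1..k. g (M + i))"
  by (rule sum.reindex_bij_witness[of _ "\<lambda>i. M + i" "\<lambda>i. i - M"]) auto

lemma abel_bound_antimono:
  fixes e f :: "nat \<Rightarrow> real"
  assumes B: "\<And>N. \<bar>\<Sum>i\<in>{M<..N}. e i\<bar> \<le> B"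
    and f: "\<And>i. i > M \<Longrightarrow> f (Suc i) \<le> f i" "\<And>i. i > M \<Longrightarrow> f i \<ge> 0"
  shows "\<bar>\<Sum>i\<in>{M<..N}. e i * f i\<bar> \<le> B * f (Suc M)"
proof (cases "N > M")
  case True
  define K where "K = N - M"
  have K: "K \<ge> 1" "N = M + K" using True by (auto simp: K_def)
  have B': "\<bar>\<Sum>i=1..k. e (M + i)\<bar> \<le> B" for k
    using B[of "M + k"] by (simp add: sum_greaterThanAtMost_shift)
  have "\<bar>\<Sum>i\<in>{M<..N}. e i * f i\<bar> = \<bar>\<Sum>i=1..K. e (M + i) * f (M + i)\<bar>"
    unfolding K sum_greaterThanAtMost_shift ..
  also have "\<dots> \<le> B * (\<bar>f (M + K)\<bar> + (\<Sum>i=1..<K. \<bar>f (M + i) - f (M + Suc i)\<bar>))"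
    by (rule abel_bound[OF B' K(1)])
  also have "(\<Sum>i=1..<K. \<bar>f (M + i) - f (M + Suc i)\<bar>) = (\<Sum>i=1..<K. - (f (M + Suc i) - f (M + i)))"
    using f by (intro sum.cong) auto
  also have "\<dots> = f (Suc M) - f (M + K)"
    using sum_Suc_diff'[OF K(1), of "\<lambda>i. - f (M + i)"] by simp
  also have "\<bar>f (M + K)\<bar> = f (M + K)" using f(2)[of "M + K"] K by simp
  finally show ?thesis by simp
next
  case False
  have "B \<ge> 0" using B[of 0] by simp
  thus ?thesis using False f(2)[of "Suc M"] by simp
qed

lemma abel_bound_mono:
  fixes e f :: "nat \<Rightarrow> real"
  assumes B: "\<And>k. \<bar>\<Sum>i=1..k. e i\<bar> \<le> B" and K: "K \<ge> 1"
    and f: "\<And>i. i \<ge> 1 \<Longrightarrow> f i \<le> f (Suc i)" "\<And>i. i \<ge> 1 \<Longrightarrow> f i \<ge> 0"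
  shows "\<bar>\<Sum>i=1..K. e i * f i\<bar> \<le> 2 * B * f K"
proof -
  have B0: "B \<ge> 0" using B[of 0] by simp
  have "(\<Sum>i=1..<K. \<bar>f i - f (Suc i)\<bar>) = (\<Sum>i=1..<K. f (Suc i) - f i)"
    using f by (intro sum.cong) auto
  also have "\<dots> = f K - f 1" using sum_Suc_diff'[OF K, of f] by simp
  also have "\<dots> \<le> f K" using f(2)[of 1] by simp
  finally have "\<bar>f K\<bar> + (\<Sum>i=1..<K. \<bar>f i - f (Suc i)\<bar>) \<le> 2 * f K"
    using f(2)[OF K] by simp
  hence "B * (\<bar>f K\<bar> + (\<Sum>i=1..<K. \<bar>f i - f (Suc i)\<bar>)) \<le> B * (2 * f K)"
    using B0 by (rule mult_left_mono)
  thus ?thesis using abel_bound[OF B K, of f] by simp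
qed

lemma limit_with_rate:
  fixes S g :: "nat \<Rightarrow> real"
  assumes g: "g \<longlonglongrightarrow> 0"
    and bd: "\<And>M N. n0 \<le> M \<Longrightarrow> M \<le> N \<Longrightarrow> \<bar>S N - S M\<bar> \<le> g M"
  shows "\<exists>l. S \<longlonglongrightarrow> l \<and> (\<forall>N\<ge>n0. \<bar>S N - l\<bar> \<le> g N)"
proof -
  have "Cauchy S"
  proof (rule metric_CauchyI)
    fix \<epsilon> :: real assume "\<epsilon> > 0"
    then obtain M where M: "M \<ge> n0" "g M < \<epsilon> / 2"
      using order_tendstoD(2)[OF g, of "\<epsilon> / 2"] unfolding eventually_at_top_linorder
      by (metis half_gt_zero nle_le)
    have "dist (S m) (S n) < \<epsilon>" if "m \<ge> M" "n \<ge> M" for m n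
      using bd[of M m] bd[of M n] M that by (simp add: dist_real_def)
    thus "\<exists>M. \<forall>m\<ge>M. \<forall>n\<ge>M. dist (S m) (S n) < \<epsilon>" by blast
  qed
  then obtain l where l: "S \<longlonglongrightarrow> l" using Cauchy_convergent convergent_def by blast
  have "\<bar>S M - l\<bar> \<le> g M" if "M \<ge> n0" for M
  proof (rule tendsto_upperbound)
    show "(\<lambda>N. \<bar>S M - S N\<bar>) \<longlonglongrightarrow> \<bar>S M - l\<bar>" by (intro tendsto_intros l)
    show "\<forall>\<^sub>F N in sequentially. \<bar>S M - S N\<bar> \<le> g M"
      using eventually_ge_at_top[of M]
      by eventually_elim (use bd[of M] that in \<open>simp add: abs_minus_commute\<close>)
  qed simp
  with l show ?thesis by blast
qed

lemma sum_atLeast1_split: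
  fixes g :: "nat \<Rightarrow> real"
  assumes "M \<le> N"
  shows "(\<Sum>i=1..N. g i) = (\<Sum>i=1..M. g i) + (\<Sum>i\<in>{M<..N}. g i)"
proof -
  have eq: "{1..N} = {1..M} \<union> {M<..N}" using assms by auto
  show ?thesis unfolding eq by (rule sum.union_disjoint) auto
qed

lemma dirichlet_test_tail:
  fixes e f :: "nat \<Rightarrow> real"
  assumes B: "\<And>M N. \<bar>\<Sum>i\<in>{M<..N}. e i\<bar> \<le> B"
    and f: "\<And>i. i \<ge> n0 \<Longrightarrow> f (Suc i) \<le> f i" "\<And>i. i \<ge> n0 \<Longrightarrow> f i \<ge> 0" "f \<longlonglongrightarrow> 0"
  shows "\<exists>l. (\<lambda>N. \<Sum>i=1..N. e i * f i) \<longlonglongrightarrow> l \<and> (\<forall>N\<ge>n0. \<bar>(\<Sum>i=1..N. e i * f i) - l\<bar> \<le> B * f N)"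
proof (rule limit_with_rate)
  show "(\<lambda>N. B * f N) \<longlonglongrightarrow> 0" using tendsto_mult_left[OF f(3), of B] by simp
  have B0: "B \<ge> 0" using B[of 0 0] by simp
  fix M N assume MN: "n0 \<le> M" "M \<le> N"
  have "\<bar>(\<Sum>i=1..N. e i * f i) - (\<Sum>i=1..M. e i * f i)\<bar> = \<bar>\<Sum>i\<in>{M<..N}. e i * f i\<bar>"
    unfolding sum_atLeast1_split[OF MN(2)] by simp
  also have "\<dots> \<le> B * f (Suc M)"
    using MN by (intro abel_bound_antimono B f) auto
  also have "\<dots> \<le> B * f M" using MN B0 f by (intro mult_left_mono) auto
  finally show "\<bar>(\<Sum>i=1..N. e i * f i) - (\<Sum>i=1..M. e i * f i)\<bar> \<le> B * f M" .
qed

lemma mvt_bounds_antimono: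
  fixes F f :: "real \<Rightarrow> real"
  assumes F: "\<And>t. t \<ge> 1 \<Longrightarrow> (F has_real_derivative f t) (at t)"
    and f: "\<And>s t. 1 \<le> s \<Longrightarrow> s \<le> t \<Longrightarrow> f t \<le> f s"
    and ab: "1 \<le> a" "a \<le> b"
  shows "F b - F a \<le> (b - a) * f a" "(b - a) * f b \<le> F b - F a"
proof -
  have "(b - a) * f b \<le> F b - F a \<and> F b - F a \<le> (b - a) * f a"
  proof (cases "a = b")
    case False
    with ab have "a < b" by simp
    then obtain z where z: "z > a" "z < b" "F b - F a = (b - a) * f z"
      using MVT2[of a b F f] F ab by force
    have "f b \<le> f z" "f z \<le> f a" using f z ab by auto
    thus ?thesis using z ab by (simp add: mult_left_mono)
  qed simp
  thus "F b - F a \<le> (b - a) * f a" "(b - a) * f b \<le> F b - F a" by auto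
qed

lemma mvt_bounds_mono:
  fixes F f :: "real \<Rightarrow> real"
  assumes F: "\<And>t. t \<ge> 1 \<Longrightarrow> (F has_real_derivative f t) (at t)"
    and f: "\<And>s t. 1 \<le> s \<Longrightarrow> s \<le> t \<Longrightarrow> f s \<le> f t"
    and ab: "1 \<le> a" "a \<le> b"
  shows "F b - F a \<le> (b - a) * f b" "(b - a) * f a \<le> F b - F a"
proof -
  have *: "((\<lambda>t. - F t) has_real_derivative - f t) (at t)" if "t \<ge> 1" for t
    using F[OF that] by (rule DERIV_minus)
  show "F b - F a \<le> (b - a) * f b" "(b - a) * f a \<le> F b - F a"
    using mvt_bounds_antimono[of "\<lambda>t. - F t" "\<lambda>t. - f t" a b, OF *] f ab by auto
qed

text \<open>The difference of sum and integral decreases in N, while the same difference minus f N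
  increases. The two sequences enclose the limit \<gamma>, which is Euler's constant for f t = 1 / t
  and F = ln.\<close>

lemma sum_integral_antimono:
  fixes F f :: "real \<Rightarrow> real"
  assumes F: "\<And>t. t \<ge> 1 \<Longrightarrow> (F has_real_derivative f t) (at t)"
    and f: "\<And>s t. 1 \<le> s \<Longrightarrow> s \<le> t \<Longrightarrow> f t \<le> f s" "\<And>t. t \<ge> 1 \<Longrightarrow> f t \<ge> 0"
    and lim: "(\<lambda>n. f (real n)) \<longlonglongrightarrow> 0"
  shows "\<exists>\<gamma>. \<forall>N\<ge>1. \<bar>(\<Sum>i=1..N. f (real i)) - F (real N) - \<gamma>\<bar> \<le> f (real N)"
proof -
  have "\<exists>l. (\<lambda>N. (\<Sum>i=1..N. f (real i)) - F (real N)) \<longlonglongrightarrow> l \<and>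
    (\<forall>N\<ge>1. \<bar>(\<Sum>i=1..N. f (real i)) - F (real N) - l\<bar> \<le> f (real N))"
  proof (rule limit_with_rate[OF lim])
    fix M N :: nat assume MN: "1 \<le> M" "M \<le> N"
    have "(\<Sum>i=1..N. f (real i)) - F (real N) \<le> (\<Sum>i=1..M. f (real i)) - F (real M) \<and>
      (\<Sum>i=1..N. f (real i)) - F (real N) \<ge> (\<Sum>i=1..M. f (real i)) - F (real M) - f (real M) + f (real N)"
      using MN(2)
    proof (induction N rule: dec_induct)
      case (step n)
      show ?case
        using step.IH mvt_bounds_antimono[OF F f(1), of "real n" "real (Suc n)"] step.hyps MN by simp
    qed simp
    thus "\<bar>(\<Sum>i=1..N. f (real i)) - F (real N) - ((\<Sum>i=1..M. f (real i)) - F (real M))\<bar> \<le> f (real M)"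
      using f(2)[of "real N"] f(2)[of "real M"] MN by (auto simp: abs_le_iff)
  qed
  thus ?thesis by blast
qed

lemma sum_integral_mono:
  fixes F f :: "real \<Rightarrow> real"
  assumes F: "\<And>t. t \<ge> 1 \<Longrightarrow> (F has_real_derivative f t) (at t)"
    and f: "\<And>s t. 1 \<le> s \<Longrightarrow> s \<le> t \<Longrightarrow> f s \<le> f t" "\<And>t. t \<ge> 1 \<Longrightarrow> f t \<ge> 0"
    and N: "N \<ge> 1"
  shows "\<bar>(\<Sum>i=1..N. f (real i)) - (F (real N) - F 1)\<bar> \<le> f (real N)"
proof -
  note mvt = mvt_bounds_mono[OF F f(1)]
  have "(\<Sum>i=1..N. f (real i)) - F (real N) \<ge> f 1 - F 1 \<and>
      (\<Sum>i=1..N. f (real i)) - F (real N) \<le> f (real N) - F 1"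
    using N
  proof (induction N rule: dec_induct)
    case (step n)
    show ?case using step.IH mvt[of "real n" "real (Suc n)"] step.hyps by simp
  qed simp
  thus ?thesis using f(2)[of 1] f(2)[of "real N"] N by (auto simp: abs_le_iff)
qed

text \<open>Full periods drop out, so every initial sum is a sum of fewer than q terms; a sum over
  an interval is a difference of two initial sums.\<close>

lemma periodic_sum_bound:
  fixes e :: "nat \<Rightarrow> real"
  assumes q: "q > 0" and per: "\<And>n. e (n + q) = e n" and zero: "(\<Sum>i<q. e i) = 0"
    and bd: "\<And>n. \<bar>e n\<bar> \<le> 1"
  shows "\<bar>\<Sum>i\<in>{M<..N}. e i\<bar> \<le> 2 * real q"
proof -
  have le: "\<bar>\<Sum>i<n. e i\<bar> \<le> real q" for n
  proof (induction n rule: less_induct)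
    case (less n)
    show ?case
    proof (cases "n < q")
      case True
      have "\<bar>\<Sum>i<n. e i\<bar> \<le> (\<Sum>i<n. 1)" by (rule order_trans[OF sum_abs]) (intro sum_mono bd)
      thus ?thesis using True by simp
    next
      case False
      hence eq: "{..<n} = {..<q} \<union> {q..<n}" by auto
      have "(\<Sum>i<n. e i) = (\<Sum>i<q. e i) + (\<Sum>i\<in>{q..<n}. e i)"
        unfolding eq by (rule sum.union_disjoint) auto
      also have "(\<Sum>i\<in>{q..<n}. e i) = (\<Sum>i<n-q. e (i + q))"
        by (rule sum.reindex_bij_witness[of _ "\<lambda>i. i + q" "\<lambda>i. i - q"]) (use False in auto)
      finally show ?thesis using less[of "n - q"] False q by (simp add: per zero)
    qed
  qed
  show ?thesis
  proof (cases "M \<le> N")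
    case True
    hence eq: "{..<Suc N} = {..<Suc M} \<union> {M<..N}" by auto
    have "(\<Sum>i<Suc N. e i) = (\<Sum>i<Suc M. e i) + (\<Sum>i\<in>{M<..N}. e i)"
      unfolding eq by (rule sum.union_disjoint) auto
    thus ?thesis using le[of "Suc N"] le[of "Suc M"] by linarith
  qed simp
qed

section \<open>Sums against weights of bounded discrepancy\<close>

lemma floor_bounds:
  assumes "x \<ge> 1"
  shows "nat \<lfloor>x\<rfloor> \<ge> 1" "real (nat \<lfloor>x\<rfloor>) \<le> x" "x \<le> real (nat \<lfloor>x\<rfloor>) + 1" "x \<le> 2 * real (nat \<lfloor>x\<rfloor>)"
proof -
  have "\<lfloor>x\<rfloor> \<ge> 1" using assms by simp
  thus 1: "nat \<lfloor>x\<rfloor> \<ge> 1" "real (nat \<lfloor>x\<rfloor>) \<le> x" by linarith+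
  show 2: "x \<le> real (nat \<lfloor>x\<rfloor>) + 1" using assms by linarith
  show "x \<le> 2 * real (nat \<lfloor>x\<rfloor>)" using 1 2 by linarith
qed

text \<open>Covers the indicator of a residue class (mean 1 / q), that of the units (mean phi q / q)
  and the constant 1, so that partial summation is done once for all of them.\<close>

locale mean_weight =
  fixes w :: "nat \<Rightarrow> real" and \<rho> B :: real
  assumes rho: "\<rho> \<ge> 0" and dev: "\<And>M N. \<bar>\<Sum>i\<in>{M<..N}. (w i - \<rho>)\<bar> \<le> B"
begin

lemma B_nonneg: "B \<ge> 0"
  using dev[of 0 0] by simp

text \<open>Split w = \<rho> + (w - \<rho>): the first part is the comparison with the integral, the
  second converges by Dirichlet's test. In the error, B is the Dirichlet tail, one \<rho> comes from
  the integral comparison and the other from moving F from floor x to x.\<close>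

lemma sum_antimono:
  fixes F f :: "real \<Rightarrow> real"
  assumes F: "\<And>t. t \<ge> 1 \<Longrightarrow> (F has_real_derivative f t) (at t)"
    and f: "\<And>s t. 1 \<le> s \<Longrightarrow> s \<le> t \<Longrightarrow> f t \<le> f s" "\<And>t. t \<ge> 1 \<Longrightarrow> f t \<ge> 0"
    and lim: "(\<lambda>n. f (real n)) \<longlonglongrightarrow> 0"
  shows "\<exists>\<gamma>. \<forall>x\<ge>1. \<bar>(\<Sum>i\<in>upto_real x. w i * f (real i)) - \<rho> * F x - \<gamma>\<bar> \<le> (B + 2 * \<rho>) * f (real (nat \<lfloor>x\<rfloor>))"
proof -
  from sum_integral_antimono[OF assms] obtain \<gamma>1 where
    1: "\<And>N. N \<ge> 1 \<Longrightarrow> \<bar>(\<Sum>i=1..N. f (real i)) - F (real N) - \<gamma>1\<bar> \<le> f (real N)" by blast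
  have "\<exists>l. (\<lambda>N. \<Sum>i=1..N. (w i - \<rho>) * f (real i)) \<longlonglongrightarrow> l \<and>
     (\<forall>N\<ge>1. \<bar>(\<Sum>i=1..N. (w i - \<rho>) * f (real i)) - l\<bar> \<le> B * f (real N))"
    by (rule dirichlet_test_tail[OF dev _ _ lim]) (use f in auto)
  then obtain \<gamma>2 where
    2: "\<And>N. N \<ge> 1 \<Longrightarrow> \<bar>(\<Sum>i=1..N. (w i - \<rho>) * f (real i)) - \<gamma>2\<bar> \<le> B * f (real N)" by blast
  have "\<bar>(\<Sum>i\<in>upto_real x. w i * f (real i)) - \<rho> * F x - (\<rho> * \<gamma>1 + \<gamma>2)\<bar> \<le> (B + 2 * \<rho>) * f (real (nat \<lfloor>x\<rfloor>))"
    if x: "x \<ge> 1" for x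
  proof -
    define N where "N = nat \<lfloor>x\<rfloor>"
    note N = floor_bounds[OF x, folded N_def]
    have "(\<Sum>i\<in>upto_real x. w i * f (real i)) = \<rho> * (\<Sum>i=1..N. f (real i)) + (\<Sum>i=1..N. (w i - \<rho>) * f (real i))"
      by (simp add: upto_real_altdef N_def sum_distrib_left algebra_simps flip: sum.distrib)
    hence eq: "(\<Sum>i\<in>upto_real x. w i * f (real i)) - \<rho> * F x - (\<rho> * \<gamma>1 + \<gamma>2) =
       \<rho> * ((\<Sum>i=1..N. f (real i)) - F (real N) - \<gamma>1) + ((\<Sum>i=1..N. (w i - \<rho>) * f (real i)) - \<gamma>2)
       - \<rho> * (F x - F (real N))" by (simp add: algebra_simps)
    have "F x - F (real N) \<le> (x - real N) * f (real N)" "F x - F (real N) \<ge> (x - real N) * f x"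
      using mvt_bounds_antimono[OF F f(1), of "real N" x] N by auto
    moreover have "(x - real N) * f (real N) \<le> 1 * f (real N)"
      using N f(2)[of "real N"] by (intro mult_right_mono) auto
    moreover have "(x - real N) * f x \<ge> 0" using N f(2)[OF x] by simp
    ultimately have 3: "\<bar>F x - F (real N)\<bar> \<le> f (real N)" by linarith
    have "\<bar>\<rho> * ((\<Sum>i=1..N. f (real i)) - F (real N) - \<gamma>1)\<bar> \<le> \<rho> * f (real N)"
      unfolding abs_mult using rho 1[OF N(1)] by (simp add: mult_left_mono)
    moreover have "\<bar>\<rho> * (F x - F (real N))\<bar> \<le> \<rho> * f (real N)"
      unfolding abs_mult using rho 3 by (simp add: mult_left_mono)
    ultimately show ?thesis unfolding eq N_def[symmetric] using 2[OF N(1)]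
      by (simp add: algebra_simps abs_le_iff)
  qed
  thus ?thesis by blast
qed

lemma sum_mono_fun:
  fixes F f :: "real \<Rightarrow> real"
  assumes F: "\<And>t. t \<ge> 1 \<Longrightarrow> (F has_real_derivative f t) (at t)"
    and f: "\<And>s t. 1 \<le> s \<Longrightarrow> s \<le> t \<Longrightarrow> f s \<le> f t" "\<And>t. t \<ge> 1 \<Longrightarrow> f t \<ge> 0"
    and x: "x \<ge> 1"
  shows "\<bar>(\<Sum>i\<in>upto_real x. w i * f (real i)) - \<rho> * (F x - F 1)\<bar> \<le> (2 * B + 2 * \<rho>) * f x"
proof -
  define N where "N = nat \<lfloor>x\<rfloor>"
  note N = floor_bounds[OF x, folded N_def]
  have 1: "\<bar>(\<Sum>i=1..N. f (real i)) - (F (real N) - F 1)\<bar> \<le> f (real N)"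
    by (rule sum_integral_mono[OF F f N(1)])
  have dev': "\<bar>\<Sum>i=1..k. (w i - \<rho>)\<bar> \<le> B" for k
    using dev[of 0 k] by (simp add: atLeastSucAtMost_greaterThanAtMost)
  have 2: "\<bar>\<Sum>i=1..N. (w i - \<rho>) * f (real i)\<bar> \<le> 2 * B * f (real N)"
    by (rule abel_bound_mono[OF dev' N(1)]) (use f in auto)
  have "(\<Sum>i\<in>upto_real x. w i * f (real i)) = \<rho> * (\<Sum>i=1..N. f (real i)) + (\<Sum>i=1..N. (w i - \<rho>) * f (real i))"
    by (simp add: upto_real_altdef N_def sum_distrib_left algebra_simps flip: sum.distrib)
  hence eq: "(\<Sum>i\<in>upto_real x. w i * f (real i)) - \<rho> * (F x - F 1) =
     \<rho> * ((\<Sum>i=1..N. f (real i)) - (F (real N) - F 1)) + (\<Sum>i=1..N. (w i - \<rho>) * f (real i))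
     - \<rho> * (F x - F (real N))" by (simp add: algebra_simps)
  have mvt: "F x - F (real N) \<le> (x - real N) * f x" "(x - real N) * f (real N) \<le> F x - F (real N)"
    using mvt_bounds_mono[OF F f(1), of "real N" x] N by auto
  moreover have "(x - real N) * f x \<le> 1 * f x"
    using N f(2)[of x] x by (intro mult_right_mono) auto
  moreover have "(x - real N) * f (real N) \<ge> 0" using N f(2)[of "real N"] by simp
  ultimately have 3: "\<bar>F x - F (real N)\<bar> \<le> f x" by linarith
  have fN: "f (real N) \<le> f x" using N by (intro f) auto
  have "\<bar>\<rho> * ((\<Sum>i=1..N. f (real i)) - (F (real N) - F 1))\<bar> \<le> \<rho> * f x"
    unfolding abs_mult using rho 1 fN by (simp add: mult_left_mono)
  moreover have "\<bar>\<rho> * (F x - F (real N))\<bar> \<le> \<rho> * f x"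
    unfolding abs_mult using rho 3 by (simp add: mult_left_mono)
  moreover have "2 * B * f (real N) \<le> 2 * B * f x" using fN B_nonneg by (simp add: mult_left_mono)
  ultimately show ?thesis unfolding eq using 2
    by (simp add: algebra_simps abs_le_iff)
qed

end

section \<open>Elementary sums over the units and over a residue class\<close>

definition res :: "nat \<Rightarrow> nat set" where
  "res q = {c. c < q \<and> coprime c q}"

definition phi :: "nat \<Rightarrow> real" where
  "phi q = real (card (res q))"

lemma finite_res [simp, intro]: "finite (res q)"
  by (rule finite_subset[of _ "{..<q}"]) (auto simp: res_def)

lemma phi_ge_1:
  assumes "q > 0"
  shows "phi q \<ge> 1"
proof -
  have "1 mod q \<in> res q" using assms by (auto simp: res_def)
  hence "card (res q) > 0" by (auto simp: card_gt_0_iff)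
  thus ?thesis by (simp add: phi_def)
qed

lemma phi_1 [simp]: "phi (Suc 0) = 1"
proof -
  have "res (Suc 0) = {0}" by (auto simp: res_def)
  thus ?thesis by (simp add: phi_def)
qed

lemma mean_weight_ap:
  assumes q: "q > 0"
  shows "mean_weight (\<lambda>m. of_bool [m = c] (mod q)) (1 / real q) (2 * real q)"
proof
  fix M N
  have "(\<Sum>i<q. of_bool [i = c] (mod q) :: real) = real (card {i. i < q \<and> [i = c] (mod q)})"
    by (simp add: of_bool_def sum.If_cases Int_def lessThan_def)
  also have "{i. i < q \<and> [i = c] (mod q)} = {c mod q}" using q by (auto simp: cong_def)
  finally have 1: "(\<Sum>i<q. of_bool [i = c] (mod q) :: real) = 1" by simp
  show "\<bar>\<Sum>i\<in>{M<..N}. of_bool [i = c] (mod q) - 1 / real q\<bar> \<le> 2 * real q"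
  proof (rule periodic_sum_bound[OF q])
    show "(\<Sum>i<q. of_bool [i = c] (mod q) - 1 / real q) = 0"
      using q by (simp add: sum_subtractf 1)
    show "\<bar>of_bool [n = c] (mod q) - 1 / real q\<bar> \<le> 1" for n
      using q by (cases "[n = c] (mod q)") (auto simp: abs_le_iff divide_le_eq_1)
  qed (simp add: cong_def)
qed simp

lemma mean_weight_cop:
  assumes q: "q > 0"
  shows "mean_weight (\<lambda>m. of_bool (coprime m q)) (phi q / real q) (2 * real q)"
proof
  fix M N
  have "(\<Sum>i<q. of_bool (coprime i q) :: real) = real (card {i. i < q \<and> coprime i q})"
    by (simp add: of_bool_def sum.If_cases Int_def lessThan_def)
  hence 1: "(\<Sum>i<q. of_bool (coprime i q) :: real) = phi q" by (simp add: phi_def res_def)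
  have "card (res q) \<le> card {..<q}" by (rule card_mono) (auto simp: res_def)
  hence le: "phi q \<le> real q" by (simp add: phi_def)
  show "\<bar>\<Sum>i\<in>{M<..N}. of_bool (coprime i q) - phi q / real q\<bar> \<le> 2 * real q"
  proof (rule periodic_sum_bound[OF q])
    show "(\<Sum>i<q. of_bool (coprime i q) - phi q / real q) = 0"
      using q by (simp add: sum_subtractf 1)
    show "\<bar>of_bool (coprime n q) - phi q / real q\<bar> \<le> 1" for n
    proof -
      have "0 \<le> phi q / real q" "phi q / real q \<le> 1" using q le phi_ge_1[OF q] by auto
      thus ?thesis by (cases "coprime n q") auto
    qed
    show "of_bool (coprime (n + q) q) - phi q / real q = of_bool (coprime n q) - phi q / real q" for n
      by (simp only: coprime_iff_gcd_eq_1 gcd_add1)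
  qed
qed (simp add: phi_def)

lemma sum_ap_weight: "(\<Sum>m\<in>ap q c x. f m :: real) = (\<Sum>m\<in>upto_real x. of_bool [m = c] (mod q) * f m)"
  by (rule sum.mono_neutral_cong_left[OF finite_upto_real]) (auto simp: ap_def upto_real_def)

lemma sum_cop_weight: "(\<Sum>m\<in>cop q x. f m :: real) = (\<Sum>m\<in>upto_real x. of_bool (coprime m q) * f m)"
  by (rule sum.mono_neutral_cong_left[OF finite_upto_real]) (auto simp: cop_def upto_real_def)

lemma ln_le_2_sqrt: "x \<ge> 1 \<Longrightarrow> ln x \<le> 2 * sqrt x" for x :: real
  using ln_le_minus_one[of "sqrt x"] by (simp add: ln_sqrt)

lemma ln_sq_le_sqrt:
  fixes x :: real
  assumes "x \<ge> 1"
  shows "(ln x)\<^sup>2 \<le> 16 * sqrt x"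
proof -
  have "ln x = 2 * ln (sqrt x)" using assms by (simp add: ln_sqrt)
  also have "\<dots> \<le> 4 * sqrt (sqrt x)" using ln_le_2_sqrt[of "sqrt x"] assms by simp
  finally have "(ln x)\<^sup>2 \<le> (4 * sqrt (sqrt x))\<^sup>2" using assms by (intro power_mono) auto
  thus ?thesis using assms by (simp add: power_mult_distrib)
qed

lemma sum_inverse_cop:
  assumes q: "q > 0"
  shows "\<exists>\<gamma> C. C \<ge> 0 \<and> (\<forall>x\<ge>1. \<bar>(\<Sum>m\<in>cop q x. 1 / real m) - (phi q / real q * ln x + \<gamma>)\<bar> \<le> C / x)"
proof -
  interpret mean_weight "\<lambda>m. of_bool (coprime m q)" "phi q / real q" "2 * real q"
    by (rule mean_weight_cop[OF q])
  have "\<exists>\<gamma>. \<forall>x\<ge>1. \<bar>(\<Sum>i\<in>upto_real x. of_bool (coprime i q) * (1 / real i)) - phi q / real q * ln x - \<gamma>\<bar>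
       \<le> (2 * real q + 2 * (phi q / real q)) * (1 / real (nat \<lfloor>x\<rfloor>))"
    by (rule sum_antimono) (auto intro!: derivative_eq_intros frac_le lim_inverse_n' simp: field_simps)
  then obtain \<gamma> where \<gamma>: "\<And>x. x \<ge> 1 \<Longrightarrow> \<bar>(\<Sum>i\<in>cop q x. 1 / real i) - phi q / real q * ln x - \<gamma>\<bar>
       \<le> (2 * real q + 2 * (phi q / real q)) * (1 / real (nat \<lfloor>x\<rfloor>))"
    unfolding sum_cop_weight by blast
  have "\<bar>(\<Sum>m\<in>cop q x. 1 / real m) - (phi q / real q * ln x + \<gamma>)\<bar> \<le> (2 * real q + 2 * (phi q / real q)) * 2 / x"
    if x: "x \<ge> 1" for x
  proof -
    have "1 / real (nat \<lfloor>x\<rfloor>) \<le> 2 / x"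
      using floor_bounds[OF x] x by (simp add: divide_simps)
    hence "(2 * real q + 2 * (phi q / real q)) * (1 / real (nat \<lfloor>x\<rfloor>)) \<le> (2 * real q + 2 * (phi q / real q)) * (2 / x)"
      using B_nonneg rho by (intro mult_left_mono) auto
    from order_trans[OF \<gamma>[OF x] this] show ?thesis
      by (simp only: diff_diff_eq times_divide_eq_right)
  qed
  moreover have "(2 * real q + 2 * (phi q / real q)) * 2 \<ge> 0" using rho by simp
  ultimately show ?thesis by blast
qed

text \<open>ln t / t decreases only from e onwards; with the added 1 the derivative is - ln t / t^2,
  which is nonpositive for all t \<ge> 1. Sums of ln n / n are then obtained by subtracting the
  harmonic sum.\<close>

lemma ln_plus_1_div_antimono:
  fixes s t :: real
  assumes "1 \<le> s" "s \<le> t"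
  shows "(ln t + 1) / t \<le> (ln s + 1) / s"
proof (rule DERIV_nonpos_imp_nonincreasing[of s t "\<lambda>t. (ln t + 1) / t"])
  fix u assume "s \<le> u" "u \<le> t"
  hence "((\<lambda>t. (ln t + 1) / t) has_real_derivative - ln u / u\<^sup>2) (at u)"
    using assms by (auto intro!: derivative_eq_intros simp: field_simps power2_eq_square)
  moreover have "- ln u / u\<^sup>2 \<le> 0" using \<open>s \<le> u\<close> assms by simp
  ultimately show "\<exists>y. ((\<lambda>t. (ln t + 1) / t) has_real_derivative y) (at u) \<and> y \<le> 0" by blast
qed (use assms in auto)

text \<open>The error of order ln x / x is relaxed to C / sqrt x, which after multiplication by x is
  what the Moebius inversion admits.\<close>

lemma sum_ln_div_cop:
  assumes q: "q > 0"
  shows "\<exists>\<gamma> C. C \<ge> 0 \<and> (\<forall>x\<ge>1. \<bar>(\<Sum>m\<in>cop q x. ln (real m) / real m) - (phi q / real q / 2 * (ln x)\<^sup>2 + \<gamma>)\<bar> \<le> C / sqrt x)"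
proof -
  interpret mean_weight "\<lambda>m. of_bool (coprime m q)" "phi q / real q" "2 * real q"
    by (rule mean_weight_cop[OF q])
  have "\<exists>\<gamma>. \<forall>x\<ge>1. \<bar>(\<Sum>i\<in>upto_real x. of_bool (coprime i q) * ((ln (real i) + 1) / real i))
         - phi q / real q * ((ln x)\<^sup>2 / 2 + ln x) - \<gamma>\<bar>
       \<le> (2 * real q + 2 * (phi q / real q)) * ((ln (real (nat \<lfloor>x\<rfloor>)) + 1) / real (nat \<lfloor>x\<rfloor>))"
  proof (rule sum_antimono)
    show "((\<lambda>t. (ln t)\<^sup>2 / 2 + ln t) has_real_derivative (ln t + 1) / t) (at t)" if "t \<ge> 1" for t :: real
      using that by (auto intro!: derivative_eq_intros simp: field_simps)
    show "(ln t + 1) / t \<le> (ln s + 1) / s" if "1 \<le> s" "s \<le> t" for s t :: real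
      using that by (rule ln_plus_1_div_antimono)
    show "(\<lambda>n. (ln (real n) + 1) / real n) \<longlonglongrightarrow> 0" by real_asymp
  qed simp
  then obtain \<gamma> where \<gamma>: "\<And>x. x \<ge> 1 \<Longrightarrow> \<bar>(\<Sum>i\<in>cop q x. (ln (real i) + 1) / real i)
         - phi q / real q * ((ln x)\<^sup>2 / 2 + ln x) - \<gamma>\<bar>
       \<le> (2 * real q + 2 * (phi q / real q)) * ((ln (real (nat \<lfloor>x\<rfloor>)) + 1) / real (nat \<lfloor>x\<rfloor>))"
    unfolding sum_cop_weight by blast
  from sum_inverse_cop[OF q] obtain \<gamma>1 C1 where C1: "C1 \<ge> 0"
    "\<And>x. x \<ge> 1 \<Longrightarrow> \<bar>(\<Sum>m\<in>cop q x. 1 / real m) - (phi q / real q * ln x + \<gamma>1)\<bar> \<le> C1 / x" by blast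
  define D where "D = 2 * real q + 2 * (phi q / real q)"
  have D: "D \<ge> 0" using rho by (simp add: D_def)
  have "\<bar>(\<Sum>m\<in>cop q x. ln (real m) / real m) - (phi q / real q / 2 * (ln x)\<^sup>2 + (\<gamma> - \<gamma>1))\<bar> \<le> (D * 4 + C1) / sqrt x"
    if x: "x \<ge> 1" for x
  proof -
    define N where "N = nat \<lfloor>x\<rfloor>"
    note N = floor_bounds[OF x, folded N_def]
    have "sqrt x \<le> sqrt (4 * real N)" using N by simp
    hence "sqrt x \<le> 2 * sqrt (real N)" by (simp add: real_sqrt_mult)
    have "ln (real N) + 1 \<le> 2 * sqrt (real N)"
      using ln_le_minus_one[of "sqrt (real N)"] N by (simp add: ln_sqrt)
    hence lnN: "(ln (real N) + 1) / real N \<le> 2 * sqrt (real N) / (sqrt (real N) * sqrt (real N))"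
      using N by (simp only: real_sqrt_mult_self abs_of_nat divide_right_mono of_nat_0_le_iff)
    have half: "2 * s / (s * s) = 4 / (2 * s)" if "s > 0" for s :: real using that by (simp add: field_simps)
    note lnN
    also have "2 * sqrt (real N) / (sqrt (real N) * sqrt (real N)) = 4 / (2 * sqrt (real N))"
      using N by (intro half) simp
    also have "\<dots> \<le> 4 / sqrt x" using \<open>sqrt x \<le> 2 * sqrt (real N)\<close> x by (intro frac_le) auto
    finally have 1: "D * ((ln (real N) + 1) / real N) \<le> D * (4 / sqrt x)" using D by (rule mult_left_mono)
    have "sqrt x * 1 \<le> sqrt x * sqrt x" using x by (intro mult_left_mono) auto
    hence "sqrt x \<le> x" using x by simp
    hence 2: "C1 / x \<le> C1 / sqrt x" using C1(1) x by (intro divide_left_mono) auto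
    have "(\<Sum>m\<in>cop q x. ln (real m) / real m) = (\<Sum>i\<in>cop q x. (ln (real i) + 1) / real i) - (\<Sum>m\<in>cop q x. 1 / real m)"
      by (simp add: add_divide_distrib sum.distrib)
    hence "(\<Sum>m\<in>cop q x. ln (real m) / real m) - (phi q / real q / 2 * (ln x)\<^sup>2 + (\<gamma> - \<gamma>1)) =
      ((\<Sum>i\<in>cop q x. (ln (real i) + 1) / real i) - phi q / real q * ((ln x)\<^sup>2 / 2 + ln x) - \<gamma>) -
      ((\<Sum>m\<in>cop q x. 1 / real m) - (phi q / real q * ln x + \<gamma>1))"
      by (simp add: algebra_simps)
    also have "\<bar>\<dots>\<bar> \<le> D * (4 / sqrt x) + C1 / sqrt x"
      using \<gamma>[OF x] C1(2)[OF x] 1 2 unfolding D_def[symmetric] N_def[symmetric] by linarith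
    finally show ?thesis by (simp add: add_divide_distrib)
  qed
  moreover have "D * 4 + C1 \<ge> 0" using D C1 by simp
  ultimately show ?thesis by blast
qed

lemma card_cop_bound:
  assumes q: "q > 0"
  shows "\<exists>C\<ge>0. \<forall>x\<ge>0. \<bar>real (card (cop q x)) - phi q / real q * x\<bar> \<le> C"
proof -
  interpret mean_weight "\<lambda>m. of_bool (coprime m q)" "phi q / real q" "2 * real q"
    by (rule mean_weight_cop[OF q])
  define \<rho> where "\<rho> = phi q / real q"
  have \<rho>: "\<rho> \<ge> 0" using rho by (simp add: \<rho>_def)
  define C where "C = 2 * (2 * real q) + 4 * \<rho>"
  have "\<bar>real (card (cop q x)) - \<rho> * x\<bar> \<le> C" if x: "x \<ge> 0" for x
  proof (cases "x \<ge> 1")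
    case True
    have "\<bar>(\<Sum>i\<in>upto_real x. of_bool (coprime i q) * 1) - \<rho> * (x - 1)\<bar> \<le> (2 * (2 * real q) + 2 * \<rho>) * 1"
      unfolding \<rho>_def by (rule sum_mono_fun) (use True in auto)
    moreover have "(\<Sum>i\<in>upto_real x. of_bool (coprime i q) * 1) = real (card (cop q x))"
      unfolding sum_cop_weight[symmetric] by simp
    ultimately have *: "\<bar>real (card (cop q x)) - \<rho> * (x - 1)\<bar> \<le> 2 * (2 * real q) + 2 * \<rho>" by simp
    have "\<rho> * (x - 1) = \<rho> * x - \<rho>" by (simp add: algebra_simps)
    with * \<rho> show ?thesis unfolding C_def by linarith
  next
    case False
    hence "cop q x = {}" by (auto simp: cop_def)
    moreover have "\<rho> * x \<le> \<rho> * 1" using False \<rho> by (intro mult_left_mono) auto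
    ultimately show ?thesis using \<rho> x by (simp add: C_def)
  qed
  moreover have "C \<ge> 0" using \<rho> by (simp add: C_def)
  ultimately show ?thesis unfolding \<rho>_def by blast
qed

lemma sum_ln_cop:
  assumes q: "q > 0"
  shows "\<exists>C\<ge>0. \<forall>x\<ge>1. \<bar>(\<Sum>m\<in>cop q x. ln (real m)) - phi q / real q * (x * ln x - x)\<bar> \<le> C * sqrt x"
proof -
  interpret mean_weight "\<lambda>m. of_bool (coprime m q)" "phi q / real q" "2 * real q"
    by (rule mean_weight_cop[OF q])
  define \<rho> where "\<rho> = phi q / real q"
  have \<rho>: "\<rho> \<ge> 0" using rho by (simp add: \<rho>_def)
  define C where "C = 2 * (2 * real q) + 2 * \<rho>"
  have C: "C \<ge> 0" using \<rho> by (simp add: C_def)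
  have "\<bar>(\<Sum>m\<in>cop q x. ln (real m)) - \<rho> * (x * ln x - x)\<bar> \<le> (2 * C + \<rho>) * sqrt x" if x: "x \<ge> 1" for x
  proof -
    have "\<bar>(\<Sum>m\<in>cop q x. ln (real m)) - \<rho> * ((x * ln x - x) - (1 * ln 1 - 1))\<bar> \<le> C * ln x"
      unfolding sum_cop_weight \<rho>_def C_def
      by (rule sum_mono_fun) (use x in \<open>auto intro!: derivative_eq_intros\<close>)
    moreover have "\<rho> * ((x * ln x - x) - (1 * ln 1 - 1)) = \<rho> * (x * ln x - x) + \<rho>"
      by (simp add: algebra_simps)
    moreover have "C * ln x \<le> C * (2 * sqrt x)" using ln_le_2_sqrt[OF x] C by (rule mult_left_mono)
    moreover have "\<rho> * 1 \<le> \<rho> * sqrt x" using \<rho> x by (intro mult_left_mono) auto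
    moreover have "(2 * C + \<rho>) * sqrt x = C * (2 * sqrt x) + \<rho> * sqrt x" by (simp add: algebra_simps)
    ultimately show ?thesis using \<rho> by linarith
  qed
  moreover have "2 * C + \<rho> \<ge> 0" using C \<rho> by simp
  ultimately show ?thesis unfolding \<rho>_def by blast
qed

lemma sum_ln_sq_ap:
  assumes q: "q > 0"
  shows "\<exists>C\<ge>0. \<forall>c. \<forall>x\<ge>1. \<bar>(\<Sum>m\<in>ap q c x. (ln (real m))\<^sup>2) - 1 / real q * (x * (ln x)\<^sup>2 - 2 * x * ln x + 2 * x)\<bar> \<le> C * sqrt x"
proof -
  define \<rho> where "\<rho> = 1 / real q"
  have \<rho>: "\<rho> \<ge> 0" by (simp add: \<rho>_def)
  define C where "C = 2 * (2 * real q) + 2 * \<rho>"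
  have C: "C \<ge> 0" using \<rho> by (simp add: C_def)
  have "\<bar>(\<Sum>m\<in>ap q c x. (ln (real m))\<^sup>2) - \<rho> * (x * (ln x)\<^sup>2 - 2 * x * ln x + 2 * x)\<bar> \<le> (16 * C + 2 * \<rho>) * sqrt x"
    if x: "x \<ge> 1" for x c
  proof -
    interpret mean_weight "\<lambda>m. of_bool [m = c] (mod q)" "1 / real q" "2 * real q"
      by (rule mean_weight_ap[OF q])
    have "\<bar>(\<Sum>m\<in>ap q c x. (ln (real m))\<^sup>2) - \<rho> * ((x * (ln x)\<^sup>2 - 2 * x * ln x + 2 * x)
           - (1 * (ln 1)\<^sup>2 - 2 * 1 * ln 1 + 2 * 1))\<bar> \<le> C * (ln x)\<^sup>2"
      unfolding sum_ap_weight \<rho>_def C_def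
    proof (rule sum_mono_fun)
      show "((\<lambda>x. x * (ln x)\<^sup>2 - 2 * x * ln x + 2 * x) has_real_derivative (ln t)\<^sup>2) (at t)" if "t \<ge> 1" for t :: real
      proof -
        have "((\<lambda>x. x * (ln x)\<^sup>2 - 2 * x * ln x + 2 * x) has_real_derivative
          ((ln t)\<^sup>2 + t * (2 * ln t * (1 / t))) - (2 * ln t + 2 * t * (1 / t)) + 2) (at t)"
          using that by (auto intro!: derivative_eq_intros)
        thus ?thesis using that by simp
      qed
      show "(ln s)\<^sup>2 \<le> (ln t)\<^sup>2" if "1 \<le> s" "s \<le> t" for s t :: real
        using that by (intro power_mono) auto
    qed (use x in auto)
    moreover have "\<rho> * ((x * (ln x)\<^sup>2 - 2 * x * ln x + 2 * x) - (1 * (ln 1)\<^sup>2 - 2 * 1 * ln 1 + 2 * 1)) =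
        \<rho> * (x * (ln x)\<^sup>2 - 2 * x * ln x + 2 * x) - \<rho> * 2"
      by (subst right_diff_distrib) simp
    moreover have "C * (ln x)\<^sup>2 \<le> C * (16 * sqrt x)" using ln_sq_le_sqrt[OF x] C by (rule mult_left_mono)
    moreover have "\<rho> * 2 \<le> \<rho> * (2 * sqrt x)" using \<rho> x by (intro mult_left_mono) auto
    moreover have "(16 * C + 2 * \<rho>) * sqrt x = C * (16 * sqrt x) + \<rho> * (2 * sqrt x)" by (simp add: algebra_simps)
    ultimately show ?thesis using \<rho> by linarith
  qed
  moreover have "16 * C + 2 * \<rho> \<ge> 0" using C \<rho> by simp
  ultimately show ?thesis unfolding \<rho>_def by blast
qed

section \<open>Selberg's formula in progressions\<close>

definition lam_conv :: "nat \<Rightarrow> real" where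
  "lam_conv n = (\<Sum>d | d dvd n. mangoldt d * mangoldt (n div d))"

definition lam2 :: "nat \<Rightarrow> real" where
  "lam2 n = mangoldt n * ln (real n) + lam_conv n"

lemma lam_conv_nonneg: "lam_conv n \<ge> 0"
  unfolding lam_conv_def by (intro sum_nonneg mult_nonneg_nonneg mangoldt_nonneg)

lemma lam2_nonneg: "n > 0 \<Longrightarrow> lam2 n \<ge> 0"
  unfolding lam2_def by (intro add_nonneg_nonneg mult_nonneg_nonneg mangoldt_nonneg lam_conv_nonneg) simp

lemma mangoldt_sum_real: "n > 0 \<Longrightarrow> (\<Sum>d | d dvd n. mangoldt d) = ln (real n)"
  using mangoldt_sum[of n, where ?'a = real] by simp

lemma sum_divisors_flip:
  fixes g :: "nat \<Rightarrow> 'b :: comm_monoid_add"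
  assumes "n > 0"
  shows "(\<Sum>d | d dvd n. g (n div d)) = (\<Sum>d | d dvd n. g d)"
  by (rule sum.reindex_bij_witness[of _ "\<lambda>d. n div d" "\<lambda>d. n div d"])
     (use assms in \<open>auto simp: div_dvd_iff_mult\<close>)

text \<open>Summing \<Lambda> * \<Lambda> over the divisors of n and using 1 * \<Lambda> = ln on the
  inner factor leaves the sum of \<Lambda>(e) (ln n - ln e). Its first half is (ln n)^2, and its
  second half is cancelled by the part \<Lambda> ln of \<open>lam2\<close>.\<close>

lemma lam2_sum:
  assumes n: "n > 0"
  shows "(\<Sum>d | d dvd n. lam2 d) = (ln (real n))\<^sup>2"
proof -
  have fin: "finite {d. d dvd n}" using n by auto
  have fin2: "finite {k. k dvd n div e}" if "e dvd n" for e
    using that n by (intro finite_divisors_nat) (auto elim!: dvdE)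
  have "(\<Sum>d | d dvd n. lam_conv d) = (\<Sum>d | d dvd n. \<Sum>e | e dvd d. mangoldt e * mangoldt (d div e))"
    by (simp add: lam_conv_def)
  also have "\<dots> = (\<Sum>(d,e)\<in>(SIGMA d:{d. d dvd n}. {e. e dvd d}). mangoldt e * mangoldt (d div e))"
    using n fin by (subst sum.Sigma) (auto dest: dvd_pos_nat)
  also have "\<dots> = (\<Sum>(e,k)\<in>(SIGMA e:{e. e dvd n}. {k. k dvd n div e}). mangoldt e * mangoldt k)"
  proof (rule sum.reindex_bij_witness[of _ "\<lambda>(e,k). (e * k, e)" "\<lambda>(d,e). (e, d div e)"])
    fix a assume "a \<in> (SIGMA d:{d. d dvd n}. {e. e dvd d})"
    then obtain d e where a: "a = (d, e)" "d dvd n" "e dvd d" by auto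
    then obtain k l where "d = e * k" "n = d * l" by (auto elim!: dvdE)
    with a n show "(case (case a of (d, e) \<Rightarrow> (e, d div e)) of (e, k) \<Rightarrow> (e * k, e)) = a"
      "(case a of (d, e) \<Rightarrow> (e, d div e)) \<in> (SIGMA e:{e. e dvd n}. {k. k dvd n div e})"
      "(case (case a of (d, e) \<Rightarrow> (e, d div e)) of (e, k) \<Rightarrow> mangoldt e * mangoldt k) =
       (case a of (d, e) \<Rightarrow> (mangoldt e * mangoldt (d div e) :: real))"
      by (auto simp: mult.assoc)
  next
    fix b assume "b \<in> (SIGMA e:{e. e dvd n}. {k. k dvd n div e})"
    then obtain e k where b: "b = (e, k)" "e dvd n" "k dvd n div e" by auto
    then obtain m where m: "n = e * m" by blast
    with b n have "e > 0" "k dvd m" by auto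
    then obtain l where "m = k * l" by blast
    with b m n show "(case (case b of (e, k) \<Rightarrow> (e * k, e)) of (d, e) \<Rightarrow> (e, d div e)) = b"
      "(case b of (e, k) \<Rightarrow> (e * k, e)) \<in> (SIGMA d:{d. d dvd n}. {e. e dvd d})"
      by auto
  qed
  also have "\<dots> = (\<Sum>e | e dvd n. mangoldt e * (\<Sum>k | k dvd n div e. mangoldt k))"
    using fin fin2 by (subst sum.Sigma [symmetric]) (auto simp: sum_distrib_left)
  also have "\<dots> = (\<Sum>e | e dvd n. mangoldt e * ln (real n) - mangoldt e * ln (real e))"
  proof (intro sum.cong refl)
    fix e assume "e \<in> {e. e dvd n}"
    then obtain m where m: "n = e * m" by blast
    hence pos: "e > 0" "m > 0" using n by auto
    hence "(\<Sum>k | k dvd n div e. mangoldt k) = ln (real m)" using m by (simp add: mangoldt_sum_real)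
    thus "mangoldt e * (\<Sum>k | k dvd n div e. mangoldt k) = mangoldt e * ln (real n) - mangoldt e * ln (real e)"
      using m pos by (simp add: ln_mult algebra_simps)
  qed
  also have "\<dots> = (ln (real n))\<^sup>2 - (\<Sum>e | e dvd n. mangoldt e * ln (real e))"
    using n by (simp add: sum_subtractf mangoldt_sum_real power2_eq_square flip: sum_distrib_right)
  finally show ?thesis by (simp add: lam2_def sum.distrib)
qed

lemma sum_lam2_ap:
  assumes "q > 0" "coprime c q"
  shows "(\<Sum>m\<in>cop q x. \<Sum>n\<in>ap q (c * rinv q m) (x / real m). lam2 n) = (\<Sum>k\<in>ap q c x. (ln (real k))\<^sup>2)"
proof -
  have "(\<Sum>m\<in>cop q x. \<Sum>n\<in>ap q (c * rinv q m) (x / real m). lam2 n) =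
        (\<Sum>k\<in>ap q c x. \<Sum>d | d dvd k. lam2 (k div d))"
    by (rule sum_divisors_ap[OF assms, symmetric])
  also have "\<dots> = (\<Sum>k\<in>ap q c x. (ln (real k))\<^sup>2)"
    by (intro sum.cong refl) (auto simp: ap_def sum_divisors_flip lam2_sum)
  finally show ?thesis .
qed

text \<open>The sum of ln^2 over a class depends on the class only up to O(sqrt x), and
  \<open>sum_lam2_ap\<close> resolves it into sums of \<open>lam2\<close> over the classes c / m up
  to x / m. Moebius inversion treats all unit classes simultaneously, so no characters are needed
  and the main term is the same for every c.\<close>

theorem selberg_ap:
  assumes q: "q > 0"
  shows "\<exists>K\<ge>0. \<forall>c x. coprime c q \<longrightarrow> x \<ge> 1 \<longrightarrow>
    \<bar>(\<Sum>n\<in>ap q c x. lam2 n) - 2 / phi q * (x * ln x)\<bar> \<le> K * x"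
proof -
  define \<rho> where "\<rho> = phi q / real q"
  have \<rho>: "\<rho> > 0" using q phi_ge_1[OF q] by (simp add: \<rho>_def)
  have phi: "phi q > 0" using phi_ge_1[OF q] by simp
  obtain \<gamma> C1 where C1: "C1 \<ge> 0" "\<And>x. x \<ge> 1 \<Longrightarrow>
      \<bar>(\<Sum>m\<in>cop q x. 1 / real m) - (\<rho> * ln x + \<gamma>)\<bar> \<le> C1 / x"
    unfolding \<rho>_def using sum_inverse_cop[OF q] by blast
  obtain \<gamma>' C2 where C2: "C2 \<ge> 0" "\<And>x. x \<ge> 1 \<Longrightarrow>
      \<bar>(\<Sum>m\<in>cop q x. ln (real m) / real m) - (\<rho> / 2 * (ln x)\<^sup>2 + \<gamma>')\<bar> \<le> C2 / sqrt x"
    unfolding \<rho>_def using sum_ln_div_cop[OF q] by blast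
  obtain C3 where C3: "C3 \<ge> 0" "\<And>x. x \<ge> 0 \<Longrightarrow> \<bar>real (card (cop q x)) - \<rho> * x\<bar> \<le> C3"
    unfolding \<rho>_def using card_cop_bound[OF q] by blast
  obtain C4 where C4: "C4 \<ge> 0" "\<And>c x. x \<ge> 1 \<Longrightarrow>
      \<bar>(\<Sum>m\<in>ap q c x. (ln (real m))\<^sup>2) - 1 / real q * (x * (ln x)\<^sup>2 - 2 * x * ln x + 2 * x)\<bar> \<le> C4 * sqrt x"
    using sum_ln_sq_ap[OF q] by blast
  \<comment> \<open>the constants make the sum of \<open>g (x / m)\<close> over \<open>m\<close> coprime to \<open>q\<close> agree with the sum of \<open>ln\<^sup>2\<close>
      up to \<open>O(sqrt x)\<close>, which Moebius inversion turns into \<open>O(x)\<close>\<close>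
  define \<alpha> where "\<alpha> = 2 / phi q"
  define \<beta> where "\<beta> = (- 2 / real q - \<alpha> * \<gamma>) / \<rho>"
  define \<epsilon> where "\<epsilon> = (2 / real q + \<alpha> * \<gamma>' - \<beta> * \<gamma>) / \<rho>"
  have c1: "\<alpha> * \<rho> / 2 = 1 / real q" using phi q by (simp add: \<alpha>_def \<rho>_def)
  have c2: "\<alpha> * \<gamma> + \<beta> * \<rho> = - 2 / real q" using \<rho> by (simp add: \<beta>_def)
  have c3: "- (\<alpha> * \<gamma>') + \<beta> * \<gamma> + \<epsilon> * \<rho> = 2 / real q" using \<rho> by (simp add: \<epsilon>_def)
  define g where "g = (\<lambda>y. \<alpha> * (y * ln y) + \<beta> * y + \<epsilon>)"
  define h where "h = (\<lambda>c x. (\<Sum>n\<in>ap q c x. lam2 n) - g x)"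
  define K where "K = C4 + \<bar>\<alpha>\<bar> * C1 * 2 + \<bar>\<alpha>\<bar> * C2 + \<bar>\<beta>\<bar> * C1 + \<bar>\<epsilon>\<bar> * C3"
  have K: "K \<ge> 0" using C1 C2 C3 C4 by (simp add: K_def)
  have bd: "\<bar>\<Sum>m\<in>cop q x. h (c * rinv q m) (x / real m)\<bar> \<le> K * sqrt x" if c: "coprime c q" and x: "x \<ge> 1" for c x
  proof -
    define H where "H = (\<Sum>m\<in>cop q x. 1 / real m)"
    define H1 where "H1 = (\<Sum>m\<in>cop q x. ln (real m) / real m)"
    define A where "A = real (card (cop q x))"
    define S where "S = (\<Sum>k\<in>ap q c x. (ln (real k))\<^sup>2)"
    define l where "l = ln x"
    have "(\<Sum>m\<in>cop q x. g (x / real m)) =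
       (\<Sum>m\<in>cop q x. \<alpha> * x * l * (1 / real m) - \<alpha> * x * (ln (real m) / real m) + \<beta> * x * (1 / real m) + \<epsilon>)"
      using x by (intro sum.cong refl) (auto simp: g_def l_def cop_def ln_div field_simps)
    also have "\<dots> = \<alpha> * x * l * H - \<alpha> * x * H1 + \<beta> * x * H + \<epsilon> * A"
      by (simp add: sum.distrib sum_subtractf H_def H1_def A_def sum_distrib_left)
    finally have eq: "(\<Sum>m\<in>cop q x. h (c * rinv q m) (x / real m)) =
        S - (\<alpha> * x * l * H - \<alpha> * x * H1 + \<beta> * x * H + \<epsilon> * A)"
      unfolding h_def S_def sum_subtractf sum_lam2_ap[OF q c] by simp
    define r1 r2 r3 r4 where "r1 = H - (\<rho> * l + \<gamma>)" and "r2 = H1 - (\<rho> / 2 * l\<^sup>2 + \<gamma>')"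
      and "r3 = A - \<rho> * x" and "r4 = S - 1 / real q * (x * l\<^sup>2 - 2 * x * l + 2 * x)"
    have r: "\<bar>r1\<bar> \<le> C1 / x" "\<bar>r2\<bar> \<le> C2 / sqrt x" "\<bar>r3\<bar> \<le> C3" "\<bar>r4\<bar> \<le> C4 * sqrt x"
      using C1(2) C2(2) C3(2) C4(2) x by (auto simp: r1_def r2_def r3_def r4_def H_def H1_def A_def S_def l_def)
    \<comment> \<open>By \<open>c1\<close>, \<open>c2\<close> and \<open>c3\<close> the terms of
      order x l^2, x l and x cancel; only the four remainders are left to be bounded.\<close>
    have "1 / real q * (x * l\<^sup>2 - 2 * x * l + 2 * x) =
       (\<alpha> * \<rho> / 2) * (x * l\<^sup>2) + (\<alpha> * \<gamma> + \<beta> * \<rho>) * (x * l) + (- (\<alpha> * \<gamma>') + \<beta> * \<gamma> + \<epsilon> * \<rho>) * x"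
      unfolding c1 c2 c3 by (simp add: algebra_simps)
    hence "S - (\<alpha> * x * l * H - \<alpha> * x * H1 + \<beta> * x * H + \<epsilon> * A) =
      r4 - \<alpha> * x * l * r1 + \<alpha> * x * r2 - \<beta> * x * r1 - \<epsilon> * r3"
      unfolding r1_def r2_def r3_def r4_def by (simp add: algebra_simps power2_eq_square)
    also have "\<bar>\<dots>\<bar> \<le> \<bar>r4\<bar> + \<bar>\<alpha> * x * l * r1\<bar> + \<bar>\<alpha> * x * r2\<bar> + \<bar>\<beta> * x * r1\<bar> + \<bar>\<epsilon> * r3\<bar>" by linarith
    also have "\<dots> \<le> C4 * sqrt x + (\<bar>\<alpha>\<bar> * C1 * 2) * sqrt x + (\<bar>\<alpha>\<bar> * C2) * sqrt x + (\<bar>\<beta>\<bar> * C1) * sqrt x + (\<bar>\<epsilon>\<bar> * C3) * sqrt x"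
    proof (intro add_mono r(4))
      have xr1: "x * \<bar>r1\<bar> \<le> C1" using r(1) x by (simp add: field_simps)
      have l: "0 \<le> l" "l \<le> 2 * sqrt x" using x ln_le_2_sqrt by (auto simp: l_def)
      have "\<bar>\<alpha> * x * l * r1\<bar> = \<bar>\<alpha>\<bar> * (x * \<bar>r1\<bar>) * l" using x l by (simp add: abs_mult)
      also have "\<dots> \<le> \<bar>\<alpha>\<bar> * C1 * (2 * sqrt x)" using xr1 l x C1 by (intro mult_mono mult_nonneg_nonneg mult_left_mono) auto
      finally show "\<bar>\<alpha> * x * l * r1\<bar> \<le> (\<bar>\<alpha>\<bar> * C1 * 2) * sqrt x" by simp
      have sx: "sqrt x \<ge> 1" using x by simp
      have "sqrt x * \<bar>r2\<bar> \<le> C2" using r(2) sx by (simp add: field_simps)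
      hence "sqrt x * (sqrt x * \<bar>r2\<bar>) \<le> sqrt x * C2" using sx by (intro mult_left_mono) auto
      hence "\<bar>\<alpha>\<bar> * (x * \<bar>r2\<bar>) \<le> \<bar>\<alpha>\<bar> * (sqrt x * C2)"
        using x by (intro mult_left_mono) (auto simp: mult.assoc[symmetric])
      thus "\<bar>\<alpha> * x * r2\<bar> \<le> (\<bar>\<alpha>\<bar> * C2) * sqrt x" using x by (simp add: abs_mult mult_ac)
      have "\<bar>\<beta> * x * r1\<bar> = \<bar>\<beta>\<bar> * (x * \<bar>r1\<bar>) * 1" using x by (simp add: abs_mult)
      also have "\<dots> \<le> \<bar>\<beta>\<bar> * C1 * sqrt x" using xr1 sx C1 by (intro mult_mono mult_nonneg_nonneg mult_left_mono) auto
      finally show "\<bar>\<beta> * x * r1\<bar> \<le> (\<bar>\<beta>\<bar> * C1) * sqrt x" .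
      have "\<bar>\<epsilon> * r3\<bar> = \<bar>\<epsilon>\<bar> * \<bar>r3\<bar> * 1" by (simp add: abs_mult)
      also have "\<dots> \<le> \<bar>\<epsilon>\<bar> * C3 * sqrt x" using r(3) sx C3 by (intro mult_mono mult_nonneg_nonneg mult_left_mono) auto
      finally show "\<bar>\<epsilon> * r3\<bar> \<le> (\<bar>\<epsilon>\<bar> * C3) * sqrt x" .
    qed
    also have "\<dots> = K * sqrt x" by (simp add: K_def algebra_simps)
    finally show ?thesis unfolding eq .
  qed
  have "\<bar>(\<Sum>n\<in>ap q c x. lam2 n) - 2 / phi q * (x * ln x)\<bar> \<le> (2 * K + \<bar>\<beta>\<bar> + \<bar>\<epsilon>\<bar>) * x" if c: "coprime c q" and x: "x \<ge> 1" for c x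
  proof -
    have "\<bar>h c x\<bar> \<le> 2 * K * x" by (rule moebius_inversion_bound[OF q K bd c x])
    moreover have "(\<Sum>n\<in>ap q c x. lam2 n) - 2 / phi q * (x * ln x) = h c x + \<beta> * x + \<epsilon>"
      by (simp add: h_def g_def \<alpha>_def)
    moreover have "\<bar>\<beta> * x\<bar> \<le> \<bar>\<beta>\<bar> * x" using x by (simp add: abs_mult)
    moreover have "\<bar>\<epsilon>\<bar> * 1 \<le> \<bar>\<epsilon>\<bar> * x" using x by (intro mult_left_mono) auto
    ultimately show ?thesis unfolding distrib_right by linarith
  qed
  moreover have "2 * K + \<bar>\<beta>\<bar> + \<bar>\<epsilon>\<bar> \<ge> 0" using K by simp
  ultimately show ?thesis by blast
qed

text \<open>For n > sqrt x the term \<Lambda>(n) ln n of \<open>lam2\<close> is at least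
  \<Lambda>(n) ln x / 2, so Selberg's formula gives O(x) after division by ln x. The n up to sqrt x
  contribute at most sqrt x ln x \<le> 2 x.\<close>

lemma chebyshev_psi: "\<exists>K\<ge>0. \<forall>x\<ge>0. (\<Sum>n\<in>upto_real x. mangoldt n) \<le> K * x"
proof -
  obtain K where K: "K \<ge> 0" "\<And>x. x \<ge> 1 \<Longrightarrow> \<bar>(\<Sum>n\<in>upto_real x. lam2 n) - 2 * (x * ln x)\<bar> \<le> K * x"
    using selberg_ap[of "Suc 0"] by (auto simp: ap_1)
  have "(\<Sum>n\<in>upto_real x. mangoldt n) \<le> (2 * K + 6) * x" if "x \<ge> 0" for x
  proof (cases "x \<ge> exp 1")
    case True
    have x: "x > 1" using True exp_gt_one[of 1] by linarith
    have lx: "ln x \<ge> 1" using True x by (simp add: ln_ge_iff)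
    have "mangoldt n \<le> of_bool (real n \<le> sqrt x) * ln x + 2 / ln x * lam2 n" if n: "n \<in> upto_real x" for n
    proof (cases "real n \<le> sqrt x")
      case True
      have n0: "n > 0" "real n \<le> x" using n by (auto simp: upto_real_def)
      have "mangoldt n \<le> ln (real n)" using n0 by (intro mangoldt_le) auto
      also have "\<dots> \<le> ln x" using n0 x by simp
      finally have "mangoldt n \<le> ln x" .
      moreover have "2 / ln x * lam2 n \<ge> 0" using lx lam2_nonneg[OF n0(1)] by (intro mult_nonneg_nonneg) auto
      ultimately show ?thesis using True by simp
    next
      case False
      have n0: "n > 0" using n by (auto simp: upto_real_def)
      have "ln (sqrt x) \<le> ln (real n)" using False x n0 by (subst ln_le_cancel_iff) auto
      hence ln: "ln x / 2 \<le> ln (real n)" using x by (simp add: ln_sqrt)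
      have "mangoldt n * (ln x / 2) \<le> mangoldt n * ln (real n)" by (intro mult_left_mono ln mangoldt_nonneg)
      also have "\<dots> \<le> lam2 n" by (simp add: lam2_def lam_conv_nonneg)
      finally have "mangoldt n \<le> 2 / ln x * lam2 n" using lx by (simp add: field_simps)
      thus ?thesis using False by simp
    qed
    hence "(\<Sum>n\<in>upto_real x. mangoldt n) \<le> (\<Sum>n\<in>upto_real x. of_bool (real n \<le> sqrt x) * ln x + 2 / ln x * lam2 n)"
      by (rule sum_mono)
    also have "\<dots> = (\<Sum>n\<in>upto_real x. of_bool (real n \<le> sqrt x)) * ln x + 2 / ln x * (\<Sum>n\<in>upto_real x. lam2 n)"
      by (simp only: sum.distrib sum_distrib_left sum_distrib_right)
    also have "(\<Sum>n\<in>upto_real x. of_bool (real n \<le> sqrt x) :: real) = real (card (upto_real (sqrt x)))"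
    proof -
      have "sqrt x * 1 \<le> sqrt x * sqrt x" using x by (intro mult_left_mono) auto
      hence "sqrt x \<le> x" using x by simp
      hence "upto_real x \<inter> {n. real n \<le> sqrt x} = upto_real (sqrt x)" by (auto simp: upto_real_def)
      thus ?thesis by (simp add: of_bool_def sum.If_cases)
    qed
    also have "\<dots> * ln x \<le> sqrt x * (2 * sqrt x)"
      using x lx ln_le_2_sqrt[of x] by (intro mult_mono card_upto_real) auto
    also have "sqrt x * (2 * sqrt x) = 2 * x" using x by simp
    also have "2 / ln x * (\<Sum>n\<in>upto_real x. lam2 n) \<le> 2 / ln x * (2 * (x * ln x) + K * x)"
      using K(2)[of x] x lx by (intro mult_left_mono) auto
    also have "\<dots> = 4 * x + 2 * K * x / ln x" using lx by (simp add: field_simps)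
    also have "2 * K * x / ln x \<le> 2 * K * x / 1" using K(1) x lx by (intro divide_left_mono) auto
    finally show ?thesis by (simp add: algebra_simps)
  next
    case False
    have "(\<Sum>n\<in>upto_real x. mangoldt n) \<le> (\<Sum>n\<in>upto_real x. 1 :: real)"
    proof (rule sum_mono)
      fix n assume "n \<in> upto_real x"
      hence n: "n > 0" "real n < exp 1" using False by (auto simp: upto_real_def)
      have "mangoldt n \<le> ln (real n)" using n by (intro mangoldt_le) auto
      also have "\<dots> \<le> 1" using n ln_le_cancel_iff[of "real n" "exp 1"] by simp
      finally show "mangoldt n \<le> (1 :: real)" .
    qed
    also have "\<dots> \<le> x" using card_upto_real[OF that] by simp
    also have "\<dots> \<le> (2 * K + 6) * x" using that K by (simp add: algebra_simps)
    finally show ?thesis .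
  qed
  thus ?thesis using K(1) by (intro exI[of _ "2 * K + 6"]) auto
qed

text \<open>Mertens' argument: by ln = 1 * \<Lambda> the sum of ln m over the units m \<le> x is
  \<rho> x times the wanted sum, plus an error which the Chebyshev bound makes O(x). Division by
  \<rho> x leaves O(1).\<close>

lemma sum_mangoldt_cop:
  assumes q: "q > 0"
  shows "\<exists>C\<ge>0. \<forall>x\<ge>1. \<bar>(\<Sum>n\<in>cop q x. mangoldt n / real n) - ln x\<bar> \<le> C"
proof -
  define \<rho> where "\<rho> = phi q / real q"
  have \<rho>: "\<rho> > 0" using q phi_ge_1[OF q] by (simp add: \<rho>_def)
  obtain K where K: "K \<ge> 0" "\<And>x. x \<ge> 0 \<Longrightarrow> (\<Sum>n\<in>upto_real x. mangoldt n) \<le> K * x"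
    using chebyshev_psi by blast
  obtain C3 where C3: "C3 \<ge> 0" "\<And>x. x \<ge> 0 \<Longrightarrow> \<bar>real (card (cop q x)) - \<rho> * x\<bar> \<le> C3"
    unfolding \<rho>_def using card_cop_bound[OF q] by blast
  obtain C4 where C4: "C4 \<ge> 0" "\<And>x. x \<ge> 1 \<Longrightarrow> \<bar>(\<Sum>m\<in>cop q x. ln (real m)) - \<rho> * (x * ln x - x)\<bar> \<le> C4 * sqrt x"
    unfolding \<rho>_def using sum_ln_cop[OF q] by blast
  have "\<bar>(\<Sum>n\<in>cop q x. mangoldt n / real n) - ln x\<bar> \<le> (C4 + \<rho> + C3 * K) / \<rho>" if x: "x \<ge> 1" for x
  proof -
    define S where "S = (\<Sum>n\<in>cop q x. mangoldt n / real n)"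
    define E where "E = (\<Sum>n\<in>cop q x. mangoldt n * (real (card (cop q (x / real n))) - \<rho> * (x / real n)))"
    have "(\<Sum>m\<in>cop q x. ln (real m)) = (\<Sum>m\<in>cop q x. \<Sum>d | d dvd m. mangoldt d)"
      by (intro sum.cong refl) (auto simp: cop_def mangoldt_sum_real)
    also have "\<dots> = (\<Sum>d\<in>cop q x. \<Sum>m\<in>cop q (x / real d). mangoldt d)"
      by (rule sum_divisors_cop[OF q])
    also have "\<dots> = (\<Sum>d\<in>cop q x. mangoldt d * real (card (cop q (x / real d))))"
      by (simp add: mult.commute)
    also have "\<dots> = \<rho> * x * S + E"
      by (simp add: E_def S_def algebra_simps sum_distrib_left sum_subtractf)
    finally have eq: "(\<Sum>m\<in>cop q x. ln (real m)) = \<rho> * x * S + E" .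
    have "\<bar>E\<bar> \<le> (\<Sum>n\<in>cop q x. mangoldt n * C3)"
      unfolding E_def
    proof (rule order_trans[OF sum_abs], rule sum_mono)
      fix n assume "n \<in> cop q x"
      have "\<bar>real (card (cop q (x / real n))) - \<rho> * (x / real n)\<bar> \<le> C3" using x by (intro C3) auto
      thus "\<bar>mangoldt n * (real (card (cop q (x / real n))) - \<rho> * (x / real n))\<bar> \<le> mangoldt n * C3"
        unfolding abs_mult abs_mangoldt by (intro mult_left_mono mangoldt_nonneg)
    qed
    also have "\<dots> = (\<Sum>n\<in>cop q x. mangoldt n) * C3" by (simp add: sum_distrib_right)
    also have "\<dots> \<le> (\<Sum>n\<in>upto_real x. mangoldt n) * C3"
      using C3(1) by (intro mult_right_mono sum_mono2 cop_subset mangoldt_nonneg) auto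
    also have "\<dots> \<le> K * x * C3" using K(2)[of x] x C3(1) by (intro mult_right_mono) auto
    finally have E: "\<bar>E\<bar> \<le> C3 * K * x" by (simp add: mult_ac)
    have "sqrt x * 1 \<le> sqrt x * sqrt x" using x by (intro mult_left_mono) auto
    hence "sqrt x \<le> x" using x by simp
    hence "C4 * sqrt x \<le> C4 * x" using C4(1) by (rule mult_left_mono)
    with C4(2)[OF x] have "\<bar>\<rho> * x * S + E - \<rho> * (x * ln x - x)\<bar> \<le> C4 * x" unfolding eq by linarith
    hence "\<bar>\<rho> * x * (S - ln x) + (E + \<rho> * x)\<bar> \<le> C4 * x" by (simp add: algebra_simps)
    moreover have "\<rho> * x \<ge> 0" using \<rho> x by simp
    ultimately have "\<bar>\<rho> * x * (S - ln x)\<bar> \<le> C4 * x + C3 * K * x + \<rho> * x" using E by linarith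
    also have "\<dots> = x * (C4 + \<rho> + C3 * K)" by (simp add: algebra_simps)
    finally have "x * (\<rho> * \<bar>S - ln x\<bar>) \<le> x * (C4 + \<rho> + C3 * K)" using \<rho> x by (simp add: abs_mult mult_ac)
    hence "\<rho> * \<bar>S - ln x\<bar> \<le> C4 + \<rho> + C3 * K" using x by simp
    thus ?thesis using \<rho> by (simp add: S_def field_simps)
  qed
  moreover have "(C4 + \<rho> + C3 * K) / \<rho> \<ge> 0" using C4 C3 K \<rho> by simp
  ultimately show ?thesis by blast
qed

lemma sum_mangoldt_div: "\<exists>C\<ge>0. \<forall>x\<ge>1. \<bar>(\<Sum>n\<in>upto_real x. mangoldt n / real n) - ln x\<bar> \<le> C"
  using sum_mangoldt_cop[of "Suc 0"] by (simp add: cop_1)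

text \<open>The sum of lam2 n floor (x / n) equals the sum of ln^2 k and is at most x (ln x)^2;
  dropping the floor costs the sum of \<open>lam2\<close>, which is O(x ln x). The leading
  coefficient 1 is essential: the weights of the mean representing \<open>M\<close> must not exceed
  (ln x)^2 to first order.\<close>

lemma sum_lam2_div_le:
  "\<exists>C\<ge>0. \<forall>x\<ge>1. (\<Sum>n\<in>upto_real x. lam2 n / real n) \<le> (ln x)\<^sup>2 + C * (ln x + 1)"
proof -
  obtain K where K: "K \<ge> 0" "\<And>x. x \<ge> 1 \<Longrightarrow> \<bar>(\<Sum>n\<in>upto_real x. lam2 n) - 2 * (x * ln x)\<bar> \<le> K * x"
    using selberg_ap[of "Suc 0"] by (auto simp: ap_1)
  have "(\<Sum>n\<in>upto_real x. lam2 n / real n) \<le> (ln x)\<^sup>2 + (2 + K) * (ln x + 1)" if x: "x \<ge> 1" for x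
  proof -
    have "x * (\<Sum>n\<in>upto_real x. lam2 n / real n) - (\<Sum>n\<in>upto_real x. lam2 n) = (\<Sum>n\<in>upto_real x. lam2 n * (x / real n - 1))"
      by (simp add: sum_distrib_left sum_subtractf algebra_simps)
    also have "\<dots> \<le> (\<Sum>n\<in>upto_real x. lam2 n * real (card (upto_real (x / real n))))"
    proof (intro sum_mono mult_left_mono)
      fix n assume n: "n \<in> upto_real x"
      show "lam2 n \<ge> 0" using n by (intro lam2_nonneg) (auto simp: upto_real_def)
      show "x / real n - 1 \<le> real (card (upto_real (x / real n)))"
      proof -
        have "x / real n \<ge> 1" using n by (auto simp: upto_real_def)
        from floor_bounds(3)[OF this] show ?thesis by (simp add: upto_real_altdef)
      qed
    qed
    also have "\<dots> = (\<Sum>d\<in>upto_real x. \<Sum>m\<in>upto_real (x / real d). lam2 d)"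
      by (simp add: mult.commute)
    also have "\<dots> = (\<Sum>k\<in>upto_real x. \<Sum>d | d dvd k. lam2 d)"
      by (rule sum_divisors_upto[symmetric])
    also have "\<dots> = (\<Sum>k\<in>upto_real x. (ln (real k))\<^sup>2)"
      by (intro sum.cong refl) (auto simp: upto_real_def lam2_sum)
    also have "\<dots> \<le> (\<Sum>k\<in>upto_real x. (ln x)\<^sup>2)"
      by (intro sum_mono power_mono) (auto simp: upto_real_def)
    also have "\<dots> \<le> x * (ln x)\<^sup>2" using card_upto_real[of x] x by (simp add: mult_right_mono)
    finally have "x * (\<Sum>n\<in>upto_real x. lam2 n / real n) \<le> x * (ln x)\<^sup>2 + (2 * (x * ln x) + K * x)"
      using K(2)[OF x] by linarith
    also have "\<dots> = x * ((ln x)\<^sup>2 + 2 * ln x + K)" by (simp add: algebra_simps)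
    finally have "(\<Sum>n\<in>upto_real x. lam2 n / real n) \<le> (ln x)\<^sup>2 + 2 * ln x + K" using x by simp
    also have "\<dots> \<le> (ln x)\<^sup>2 + (2 + K) * (ln x + 1)" using x K by (simp add: algebra_simps)
    finally show ?thesis .
  qed
  thus ?thesis using K(1) by (intro exI[of _ "2 + K"]) auto
qed

section \<open>Selberg's formula in short multiplicative intervals\<close>

definition apI :: "nat \<Rightarrow> nat \<Rightarrow> real \<Rightarrow> real \<Rightarrow> nat set" where
  "apI q c y z = {n. y < real n \<and> real n \<le> z \<and> [n = c] (mod q)}"

lemma apI_eq: "0 \<le> y \<Longrightarrow> apI q c y z = ap q c z - ap q c y"
  by (auto simp: apI_def ap_def not_le)

lemma finite_apI [simp, intro]: "finite (apI q c y z)"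
proof (rule finite_subset)
  show "apI q c y z \<subseteq> insert 0 (ap q c z)" by (auto simp: apI_def ap_def)
qed simp

text \<open>Differences of Selberg's formula at y and exp \<delta> y. After division by n its error
  O(y) is bounded, hence small against \<delta> ln y once y is large for fixed \<delta>. That 1 / n
  varies by the factor exp \<delta> costs \<delta>^2 ln y, which is why \<delta> must be small
  first.\<close>

lemma selberg_ap_local:
  assumes q: "q > 0" and \<tau>: "\<tau> > 0"
  shows "\<exists>\<delta>0>0. \<forall>\<delta>. 0 < \<delta> \<longrightarrow> \<delta> \<le> \<delta>0 \<longrightarrow> (\<exists>Y\<ge>1. \<forall>y\<ge>Y. \<forall>c. coprime c q \<longrightarrow>
     \<bar>(\<Sum>n\<in>apI q c y (exp \<delta> * y). lam2 n / real n) - 2 / phi q * \<delta> * ln y\<bar> \<le> \<tau> * \<delta> * ln y)"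
proof -
  define \<alpha> where "\<alpha> = 2 / phi q"
  have \<alpha>: "0 < \<alpha>" "\<alpha> \<le> 2" using phi_ge_1[OF q] by (auto simp: \<alpha>_def divide_simps)
  obtain K where K: "K \<ge> 0" "\<And>c x. coprime c q \<Longrightarrow> x \<ge> 1 \<Longrightarrow> \<bar>(\<Sum>n\<in>ap q c x. lam2 n) - \<alpha> * (x * ln x)\<bar> \<le> K * x"
    unfolding \<alpha>_def using selberg_ap[OF q] by blast
  have "\<exists>Y\<ge>1. \<forall>y\<ge>Y. \<forall>c. coprime c q \<longrightarrow>
     \<bar>(\<Sum>n\<in>apI q c y (exp \<delta> * y). lam2 n / real n) - \<alpha> * \<delta> * ln y\<bar> \<le> \<tau> * \<delta> * ln y"
    if \<delta>: "0 < \<delta>" "\<delta> \<le> min 1 (\<tau> / 4)" for \<delta>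
  proof -
    \<comment> \<open>From here on \<tau> \<delta> ln y is at least twice the bounded error 6 + 4 K;
      the other half of \<tau> \<delta> ln y pays for the quadratic term.\<close>
    define Y where "Y = exp ((12 + 8 * K) / (\<tau> * \<delta>))"
    have Y: "Y \<ge> 1" using K \<tau> \<delta> by (simp add: Y_def)
    have "\<bar>(\<Sum>n\<in>apI q c y (exp \<delta> * y). lam2 n / real n) - \<alpha> * \<delta> * ln y\<bar> \<le> \<tau> * \<delta> * ln y"
      if y: "y \<ge> Y" and c: "coprime c q" for y c
    proof -
      define E where "E = exp \<delta>"
      have E: "E \<ge> 1" "E \<le> 1 + \<delta> + \<delta>\<^sup>2" "E \<le> 3" "1 / E \<le> 1 - \<delta> + \<delta>\<^sup>2"
      proof -
        show "E \<ge> 1" using \<delta> by (simp add: E_def)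
        show E2: "E \<le> 1 + \<delta> + \<delta>\<^sup>2" unfolding E_def using \<delta> by (intro exp_bound) auto
        have "\<delta>\<^sup>2 \<le> 1" using \<delta> by (simp add: power_le_one)
        thus "E \<le> 3" using E2 \<delta> by simp
        have "1 + \<delta> \<le> E" unfolding E_def by (rule exp_ge_add_one_self)
        hence "1 / E \<le> 1 / (1 + \<delta>)" using \<delta> by (intro divide_left_mono) auto
        also have "\<dots> \<le> 1 - \<delta> + \<delta>\<^sup>2"
        proof -
          have "(1 - \<delta> + \<delta>\<^sup>2) * (1 + \<delta>) = 1 + \<delta> ^ 3" by (simp add: algebra_simps power2_eq_square power3_eq_cube)
          thus ?thesis using \<delta> by (simp add: pos_divide_le_eq)
        qed
        finally show "1 / E \<le> 1 - \<delta> + \<delta>\<^sup>2" .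
      qed
      have y1: "y \<ge> 1" using y Y by simp
      define l where "l = ln y"
      have l: "(12 + 8 * K) / (\<tau> * \<delta>) \<le> l" "l \<ge> 0"
        using y Y y1 ln_le_cancel_iff[of Y y] by (auto simp: l_def Y_def)
      hence big: "12 + 8 * K \<le> \<tau> * \<delta> * l" using \<tau> \<delta> by (simp add: pos_divide_le_eq mult_ac)
      define X where "X = (\<Sum>n\<in>apI q c y (E * y). lam2 n)"
      have Ey: "E * y \<ge> 1 * y" "E * y \<ge> 1" using E y1 by (auto intro: mult_right_mono order_trans[OF _ mult_mono[of 1 E 1 y]])
      have "X = (\<Sum>n\<in>ap q c (E * y). lam2 n) - (\<Sum>n\<in>ap q c y. lam2 n)"
        unfolding X_def apI_eq[OF order_trans[OF zero_le_one y1]]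
      proof (rule sum_diff)
        show "ap q c y \<subseteq> ap q c (E * y)" using Ey(1) unfolding mult_1 ap_def by (auto intro: order_trans)
      qed simp
      moreover have "\<bar>(\<Sum>n\<in>ap q c (E * y). lam2 n) - \<alpha> * (E * y * (\<delta> + l))\<bar> \<le> K * (E * y)"
        using K(2)[OF c Ey(2)] y1 E by (simp add: ln_mult l_def) (simp add: E_def)
      moreover have "\<bar>(\<Sum>n\<in>ap q c y. lam2 n) - \<alpha> * (y * l)\<bar> \<le> K * y" using K(2)[OF c y1] by (simp add: l_def)
      ultimately have X: "\<bar>X - (\<alpha> * (E * y * (\<delta> + l)) - \<alpha> * (y * l))\<bar> \<le> K * (E * y) + K * y" by linarith
      have nn: "lam2 n \<ge> 0" "real n > 0" "y \<le> real n" "real n \<le> E * y" if "n \<in> apI q c y (E * y)" for n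
      proof -
        show 1: "real n > 0" "y \<le> real n" "real n \<le> E * y" using that y1 by (auto simp: apI_def)
        thus "lam2 n \<ge> 0" by (intro lam2_nonneg) auto
      qed
      define S where "S = (\<Sum>n\<in>apI q c y (E * y). lam2 n / real n)"
      have "S \<le> (\<Sum>n\<in>apI q c y (E * y). lam2 n / y)"
        unfolding S_def using nn y1 by (intro sum_mono divide_left_mono) auto
      hence up: "S \<le> X / y" by (simp add: X_def sum_divide_distrib)
      have "(\<Sum>n\<in>apI q c y (E * y). lam2 n / (E * y)) \<le> S"
        unfolding S_def using nn y1 E by (intro sum_mono divide_left_mono) auto
      hence lo: "X / (E * y) \<le> S" by (simp add: X_def sum_divide_distrib)
      have "X / y \<le> (\<alpha> * (E * y * (\<delta> + l)) - \<alpha> * (y * l) + (K * (E * y) + K * y)) / y"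
        using X y1 by (intro divide_right_mono) auto
      also have "\<dots> = \<alpha> * (E - 1) * l + \<alpha> * E * \<delta> + K * E + K" using y1 by (simp add: field_simps)
      also have "\<dots> \<le> \<alpha> * (\<delta> + \<delta>\<^sup>2) * l + 2 * 3 * 1 + K * 3 + K"
        using \<alpha> E l K \<delta> by (intro add_mono mult_mono mult_nonneg_nonneg) auto
      finally have 1: "S \<le> \<alpha> * \<delta> * l + \<alpha> * \<delta>\<^sup>2 * l + 6 + 4 * K" using up by (simp add: algebra_simps)
      have "X / (E * y) \<ge> (\<alpha> * (E * y * (\<delta> + l)) - \<alpha> * (y * l) - (K * (E * y) + K * y)) / (E * y)"
        using X y1 E by (intro divide_right_mono) auto
      also have "(\<alpha> * (E * y * (\<delta> + l)) - \<alpha> * (y * l) - (K * (E * y) + K * y)) / (E * y) =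
          \<alpha> * (\<delta> + l) - \<alpha> * l * (1 / E) - K - K * (1 / E)" using y1 E by (simp add: field_simps)
      also have "\<dots> \<ge> \<alpha> * (\<delta> + l) - \<alpha> * l * (1 - \<delta> + \<delta>\<^sup>2) - K - K * 1"
        using \<alpha> E l K by (intro diff_mono mult_left_mono order_refl) auto
      finally have "\<alpha> * (\<delta> + l) - \<alpha> * l * (1 - \<delta> + \<delta>\<^sup>2) - K - K \<le> S" using lo by simp
      moreover have "\<alpha> * (\<delta> + l) - \<alpha> * l * (1 - \<delta> + \<delta>\<^sup>2) = \<alpha> * \<delta> + \<alpha> * \<delta> * l - \<alpha> * \<delta>\<^sup>2 * l" by (simp add: algebra_simps)
      ultimately have 2: "\<alpha> * \<delta> * l - \<alpha> * \<delta>\<^sup>2 * l - 2 * K \<le> S" using \<alpha> \<delta> by (smt (verit) mult_nonneg_nonneg)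
      have "\<alpha> * \<delta>\<^sup>2 * l = \<alpha> * \<delta> * (\<delta> * l)" by (simp add: power2_eq_square)
      also have "\<dots> \<le> 2 * (\<tau> / 4) * (\<delta> * l)" using \<alpha> \<delta> l \<tau> by (intro mult_right_mono mult_mono) auto
      finally have 3: "\<alpha> * \<delta>\<^sup>2 * l \<le> \<tau> * \<delta> * l / 2" by simp
      have "\<bar>S - \<alpha> * \<delta> * l\<bar> \<le> \<tau> * \<delta> * l" using 1 2 3 big K(1) by linarith
      thus ?thesis by (simp add: S_def l_def E_def)
    qed
    thus ?thesis using Y by blast
  qed
  moreover have "min 1 (\<tau> / 4) > 0" using \<tau> by simp
  ultimately show ?thesis unfolding \<alpha>_def by blast
qed

section \<open>Real characters\<close>

text \<open>\<open>sum_zero\<close> says that the character is not principal; it bounds the partial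
  sums. Real characters suffice because the type of a class is a sign.\<close>

locale real_char =
  fixes q :: nat and \<psi> :: "nat \<Rightarrow> real"
  assumes q: "q > 0"
    and mult: "\<psi> (m * n) = \<psi> m * \<psi> n"
    and cong: "[m = n] (mod q) \<Longrightarrow> \<psi> m = \<psi> n"
    and unimod: "coprime n q \<Longrightarrow> \<psi> n = 1 \<or> \<psi> n = -1"
    and zero: "\<not> coprime n q \<Longrightarrow> \<psi> n = 0"
    and sum_zero: "(\<Sum>i<q. \<psi> i) = 0"
begin

lemma abs_le_1: "\<bar>\<psi> n\<bar> \<le> 1"
  using unimod[of n] zero[of n] by (cases "coprime n q") auto

lemma one: "\<psi> (Suc 0) = 1"
  using mult[of 1 1] unimod[of 1] by auto

lemma power: "\<psi> (n ^ k) = \<psi> n ^ k"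
  by (induction k) (auto simp: one mult)

lemma partial_sum_bound: "\<bar>\<Sum>i\<in>{M<..N}. \<psi> i\<bar> \<le> 2 * real q"
  by (rule periodic_sum_bound[OF q _ sum_zero abs_le_1]) (auto intro!: cong simp: cong_def)

section \<open>The divisor sums of \<psi> and the nonvanishing of L(1, \<psi>)\<close>

definition r :: "nat \<Rightarrow> real" where
  "r n = (\<Sum>d | d dvd n. \<psi> d)"

lemma r_mult_coprime:
  assumes cop: "coprime a b" and pos: "a > 0" "b > 0"
  shows "r (a * b) = r a * r b"
proof -
  have "r a * r b = (\<Sum>(d,e)\<in>{d. d dvd a} \<times> {e. e dvd b}. \<psi> d * \<psi> e)"
    by (simp add: r_def sum_product sum.cartesian_product)
  also have "\<dots> = (\<Sum>d | d dvd a * b. \<psi> d)"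
  proof -
    have inj: "inj_on (\<lambda>p. fst p * snd p) ({d. d dvd a} \<times> {e. e dvd b})"
    proof (rule inj_onI, clarsimp)
      fix d e d' e' assume dvd: "d dvd a" "e dvd b" "d' dvd a" "e' dvd b" and eq: "d * e = d' * e'"
      have "coprime d e'" "coprime d' e" using cop dvd by (meson coprime_divisors)+
      moreover have "d dvd d' * e'" "d' dvd d * e" using eq by (metis dvd_triv_left)+
      ultimately have "d dvd d'" "d' dvd d" by (simp_all add: coprime_dvd_mult_left_iff)
      hence "d = d'" by (simp add: dvd_antisym)
      moreover have "d > 0" using dvd pos by (auto intro: Nat.gr0I)
      ultimately show "d = d' \<and> e = e'" using eq by auto
    qed
    moreover have "(\<lambda>p. fst p * snd p) ` ({d. d dvd a} \<times> {e. e dvd b}) = {d. d dvd a * b}"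
    proof (intro equalityI subsetI)
      fix x assume "x \<in> {d. d dvd a * b}"
      then obtain d e where "x = d * e" "d dvd a" "e dvd b" using division_decomp[of x a b] by blast
      thus "x \<in> (\<lambda>p. fst p * snd p) ` ({d. d dvd a} \<times> {e. e dvd b})" by force
    qed (auto intro: mult_dvd_mono)
    ultimately have "bij_betw (\<lambda>p. fst p * snd p) ({d. d dvd a} \<times> {e. e dvd b}) {d. d dvd a * b}"
      by (simp add: bij_betw_def)
    from sum.reindex_bij_betw[OF this, of \<psi>] show ?thesis by (simp add: mult case_prod_beta)
  qed
  finally show ?thesis by (simp add: r_def)
qed

lemma r_prime_power:
  assumes p: "prime p"
  shows "r (p ^ k) \<ge> 0" "even k \<Longrightarrow> r (p ^ k) \<ge> 1"
proof -
  have "{d. d dvd p ^ k} = (\<lambda>i. p ^ i) ` {..k}"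
    using divides_primepow_nat[OF p] by (auto simp: image_iff)
  moreover have "inj_on (\<lambda>i. p ^ i) {..k}" using p by (auto simp: inj_on_def prime_power_inj)
  ultimately have r: "r (p ^ k) = (\<Sum>i\<le>k. \<psi> p ^ i)" by (simp add: r_def sum.reindex power)
  have "(\<Sum>i\<le>k. \<psi> p ^ i) \<ge> 0 \<and> (even k \<longrightarrow> (\<Sum>i\<le>k. \<psi> p ^ i) \<ge> 1)"
  proof -
    consider "\<psi> p = 0" | "\<psi> p = 1" | "\<psi> p = -1" using unimod[of p] zero[of p] by blast
    thus ?thesis
    proof cases
      case 1
      have "(\<Sum>i\<le>k. (0::real) ^ i) = 1" by (induction k) auto
      thus ?thesis using 1 by simp
    next
      case 3
      have "(\<Sum>i\<le>k. (-1::real) ^ i) = of_bool (even k)" by (induction k) auto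
      thus ?thesis using 3 by simp
    qed simp
  qed
  thus "r (p ^ k) \<ge> 0" "even k \<Longrightarrow> r (p ^ k) \<ge> 1" by (auto simp: r)
qed

lemma r_1: "r (Suc 0) = 1"
  by (simp add: r_def one)

lemma obtain_prime_power_part:
  assumes "n > (1::nat)"
  obtains p k m where "prime p" "n = p ^ k * m" "coprime p m" "m > 0" "m < n"
proof -
  obtain p where p: "prime p" "p dvd n" using prime_factor_nat[of n] assms by auto
  obtain m where m: "n = p ^ multiplicity p n * m" "\<not> p dvd m"
    using multiplicity_decompose'[of n p] p assms by (metis not_prime_unit not_gr_zero not_less_zero)
  have "multiplicity p n > 0" using p assms by (simp add: prime_multiplicity_gt_zero_iff)
  hence "p ^ multiplicity p n > 1" using p by (intro one_less_power) (auto simp: prime_gt_Suc_0_nat)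
  moreover have "m > 0" using m assms by (intro Nat.gr0I) auto
  ultimately have "m < n" using m(1) by (metis mult.commute mult_less_cancel1 nat_mult_1_right)
  thus ?thesis using that[of p "multiplicity p n" m] p m \<open>m > 0\<close> prime_imp_coprime by blast
qed

lemma r_nonneg: "n > 0 \<Longrightarrow> r n \<ge> 0"
proof (induction n rule: less_induct)
  case (less n)
  show ?case
  proof (cases "n = 1")
    case False
    with less.prems have "n > 1" by simp
    then obtain p k m where "prime p" "n = p ^ k * m" "coprime p m" "m > 0" "m < n"
      using obtain_prime_power_part by blast
    thus ?thesis using less.IH[of m] r_prime_power(1)[of p k]
      by (simp add: r_mult_coprime prime_gt_0_nat)
  qed (simp add: r_1)
qed

lemma r_square_ge_1: "n > 0 \<Longrightarrow> r (n\<^sup>2) \<ge> 1"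
proof (induction n rule: less_induct)
  case (less n)
  show ?case
  proof (cases "n = 1")
    case False
    with less.prems have "n > 1" by simp
    then obtain p k m where *: "prime p" "n = p ^ k * m" "coprime p m" "m > 0" "m < n"
      using obtain_prime_power_part by blast
    have "n\<^sup>2 = p ^ (2 * k) * m\<^sup>2" using * by (simp add: power_mult_distrib power_mult mult.commute)
    hence "r (n\<^sup>2) = r (p ^ (2 * k)) * r (m\<^sup>2)"
      using * by (simp add: r_mult_coprime prime_gt_0_nat)
    moreover have "1 * 1 \<le> r (p ^ (2 * k)) * r (m\<^sup>2)"
      using r_prime_power[of p "2 * k"] * less.IH[of m] by (intro mult_mono) auto
    ultimately show ?thesis by simp
  qed (simp add: r_1)
qed

text \<open>The value L(1, \<psi>). Existence of the limit comes with \<open>L_tail\<close>.\<close>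

definition L where "L = lim (\<lambda>N. \<Sum>i=1..N. \<psi> i * (1 / real i))"

lemma L_tail:
  assumes "N \<ge> 1"
  shows "\<bar>(\<Sum>i=1..N. \<psi> i * (1 / real i)) - L\<bar> \<le> 2 * real q * (1 / real N)"
proof -
  have "\<exists>l. (\<lambda>N. \<Sum>i=1..N. \<psi> i * (1 / real i)) \<longlonglongrightarrow> l \<and>
     (\<forall>N\<ge>1. \<bar>(\<Sum>i=1..N. \<psi> i * (1 / real i)) - l\<bar> \<le> 2 * real q * (1 / real N))"
    by (rule dirichlet_test_tail[OF partial_sum_bound _ _ lim_inverse_n']) (auto simp: frac_le)
  thus ?thesis using assms limI unfolding L_def by blast
qed

lemma sum_sqrt_bound: "\<bar>\<Sum>i=1..N. \<psi> i * (1 / sqrt (real i))\<bar> \<le> 2 * real q"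
  using abel_bound_antimono[of \<psi> 0 "2 * real q" "\<lambda>i. 1 / sqrt (real i)" N, OF partial_sum_bound]
  by (simp add: frac_le atLeastSucAtMost_greaterThanAtMost)

lemma inverse_sqrt_sum_asymp:
  "\<exists>\<gamma>. \<forall>x\<ge>1. \<bar>(\<Sum>i\<in>upto_real x. 1 / sqrt (real i)) - 2 * sqrt x - \<gamma>\<bar> \<le> 4 / sqrt x"
proof -
  interpret mean_weight "\<lambda>_. 1" 1 0 by unfold_locales auto
  have "\<exists>\<gamma>. \<forall>x\<ge>1. \<bar>(\<Sum>i\<in>upto_real x. 1 * (1 / sqrt (real i))) - 1 * (2 * sqrt x) - \<gamma>\<bar> \<le>
     (0 + 2 * 1) * (1 / sqrt (real (nat \<lfloor>x\<rfloor>)))"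
  proof (rule sum_antimono)
    show "((\<lambda>x. 2 * sqrt x) has_real_derivative 1 / sqrt t) (at t)" if "t \<ge> 1" for t
      using that by (auto intro!: derivative_eq_intros simp: field_simps)
    show "(\<lambda>n. 1 / sqrt (real n)) \<longlonglongrightarrow> 0" by real_asymp
  qed (auto simp: frac_le)
  then obtain \<gamma> where \<gamma>: "\<And>x. x \<ge> 1 \<Longrightarrow> \<bar>(\<Sum>i\<in>upto_real x. 1 / sqrt (real i)) - 2 * sqrt x - \<gamma>\<bar> \<le>
     2 / sqrt (real (nat \<lfloor>x\<rfloor>))" by auto
  have "2 / sqrt (real (nat \<lfloor>x\<rfloor>)) \<le> 4 / sqrt x" if x: "x \<ge> 1" for x
  proof -
    note N = floor_bounds[OF x]
    have "sqrt x \<le> sqrt (2\<^sup>2 * real (nat \<lfloor>x\<rfloor>))" using N by (intro real_sqrt_le_mono) simp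
    hence "sqrt x \<le> 2 * sqrt (real (nat \<lfloor>x\<rfloor>))" by (simp add: real_sqrt_mult)
    hence "4 / (2 * sqrt (real (nat \<lfloor>x\<rfloor>))) \<le> 4 / sqrt x" using x by (intro frac_le) auto
    thus ?thesis by simp
  qed
  with \<gamma> show ?thesis by (meson order_trans)
qed

text \<open>If \<open>L = 0\<close>, the sums of \<open>r n / sqrt n\<close> stay bounded, but they dominate the harmonic series over squares.\<close>

lemma L_nonzero: "L \<noteq> 0"
proof
  assume L0: "L = 0"
  define u where "u = (\<lambda>x. \<Sum>i\<in>upto_real x. 1 / sqrt (real i))"
  obtain \<gamma> where \<gamma>: "\<And>x. x \<ge> 1 \<Longrightarrow> \<bar>u x - 2 * sqrt x - \<gamma>\<bar> \<le> 4 / sqrt x"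
    unfolding u_def using inverse_sqrt_sum_asymp by blast
  have bound: "ln (real N) \<le> 8 * real q + 2 * \<bar>\<gamma>\<bar> * real q + 4" if N: "N \<ge> 1" for N
  proof -
    \<comment> \<open>The square makes N = sqrt x the splitting point of the hyperbola method: for d
      \<le> N the asymptotics of u apply, and for d > N the weights are decreasing in d, so
      cancellation in \<psi> alone gives O(1).\<close>
    define x where "x = (real N)\<^sup>2"
    have x: "x \<ge> 1" "sqrt x = real N" using N by (auto simp: x_def)
    have ux: "upto_real x = {1..N\<^sup>2}" by (simp add: upto_real_altdef x_def flip: of_nat_power)
    have NN: "N \<le> N\<^sup>2" using N by (simp add: power2_eq_square)
    define t where "t = (\<lambda>d. \<psi> d * (1 / sqrt (real d) * u (x / real d)))"
    have "(\<Sum>k\<in>upto_real x. r k / sqrt (real k)) =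
        (\<Sum>k\<in>upto_real x. \<Sum>d | d dvd k. \<psi> d / sqrt (real d) * (1 / sqrt (real (k div d))))"
      unfolding r_def sum_divide_distrib
      by (intro sum.cong refl) (auto simp: real_of_nat_div real_sqrt_divide upto_real_def)
    also have "\<dots> = (\<Sum>d\<in>upto_real x. \<Sum>m\<in>upto_real (x / real d). \<psi> d / sqrt (real d) * (1 / sqrt (real m)))"
      by (rule sum_divisors_upto)
    also have "\<dots> = (\<Sum>d=1..N\<^sup>2. t d)" by (simp add: t_def u_def ux sum_distrib_left mult_ac)
    also have "\<dots> = (\<Sum>d=1..N. t d) + (\<Sum>d\<in>{N<..N\<^sup>2}. t d)" by (rule sum_atLeast1_split[OF NN])
    finally have eq: "(\<Sum>k\<in>upto_real x. r k / sqrt (real k)) = (\<Sum>d=1..N. t d) + (\<Sum>d\<in>{N<..N\<^sup>2}. t d)" .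
    have u_nonneg: "u y \<ge> 0" for y by (simp add: u_def sum_nonneg)
    have u_mono: "u y \<le> u z" if "y \<le> z" for y z
      unfolding u_def
    proof (rule sum_mono2)
      show "upto_real y \<subseteq> upto_real z" using that by (auto simp: upto_real_def)
    qed auto
    have "\<bar>\<Sum>d\<in>{N<..N\<^sup>2}. t d\<bar> \<le> 2 * real q * (1 / sqrt (real (Suc N)) * u (x / real (Suc N)))"
      unfolding t_def
    proof (rule abel_bound_antimono[OF partial_sum_bound])
      fix i assume i: "i > N"
      show "1 / sqrt (real (Suc i)) * u (x / real (Suc i)) \<le> 1 / sqrt (real i) * u (x / real i)"
        using i x by (intro mult_mono u_mono u_nonneg frac_le) auto
    qed (use u_nonneg in auto)
    also have "\<dots> \<le> 2 * real q * (1 / sqrt (real N) * (2 * sqrt (real N)))"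
    proof (intro mult_left_mono mult_mono)
      have "u (x / real (Suc N)) \<le> u (real N)" using N by (intro u_mono) (simp add: x_def field_simps power2_eq_square)
      also have "\<dots> \<le> 2 * sqrt (real N)" unfolding u_def by (rule sum_inverse_sqrt_upto_le) simp
      finally show "u (x / real (Suc N)) \<le> 2 * sqrt (real N)" .
    qed (use N u_nonneg in \<open>auto simp: frac_le\<close>)
    also have "\<dots> = 4 * real q" using N by simp
    finally have A: "\<bar>\<Sum>d\<in>{N<..N\<^sup>2}. t d\<bar> \<le> 4 * real q" .
    define \<epsilon> where "\<epsilon> = (\<lambda>d. u (x / real d) - 2 * sqrt (x / real d) - \<gamma>)"
    have "(\<Sum>d=1..N. t d) = (\<Sum>d=1..N. 2 * real N * (\<psi> d * (1 / real d)) + \<gamma> * (\<psi> d * (1 / sqrt (real d))) + \<psi> d / sqrt (real d) * \<epsilon> d)"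
    proof (intro sum.cong refl)
      fix d assume d: "d \<in> {1..N}"
      have "u (x / real d) = 2 * real N / sqrt (real d) + \<gamma> + \<epsilon> d" by (simp add: \<epsilon>_def real_sqrt_divide x(2))
      moreover have "1 / sqrt (real d) * (1 / sqrt (real d)) = 1 / real d" by simp
      ultimately show "t d = 2 * real N * (\<psi> d * (1 / real d)) + \<gamma> * (\<psi> d * (1 / sqrt (real d))) + \<psi> d / sqrt (real d) * \<epsilon> d"
        unfolding t_def by (simp add: algebra_simps)
    qed
    also have "\<dots> = 2 * real N * (\<Sum>d=1..N. \<psi> d * (1 / real d)) + \<gamma> * (\<Sum>d=1..N. \<psi> d * (1 / sqrt (real d)))
        + (\<Sum>d=1..N. \<psi> d / sqrt (real d) * \<epsilon> d)"
      by (simp only: sum.distrib sum_distrib_left)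
    finally have eq2: "(\<Sum>d=1..N. t d) = 2 * real N * (\<Sum>d=1..N. \<psi> d * (1 / real d)) + \<gamma> * (\<Sum>d=1..N. \<psi> d * (1 / sqrt (real d)))
        + (\<Sum>d=1..N. \<psi> d / sqrt (real d) * \<epsilon> d)" .
    \<comment> \<open>The assumption L = 0 enters here: the partial sum is then only its own tail 2
      q / N, which absorbs the factor 2 N in front of it.\<close>
    have "\<bar>\<Sum>d=1..N. \<psi> d * (1 / real d)\<bar> \<le> 2 * real q * (1 / real N)" using L_tail[OF N] L0 by simp
    hence "2 * real N * \<bar>\<Sum>d=1..N. \<psi> d * (1 / real d)\<bar> \<le> 2 * real N * (2 * real q * (1 / real N))"
      by (rule mult_left_mono) simp
    hence B: "\<bar>2 * real N * (\<Sum>d=1..N. \<psi> d * (1 / real d))\<bar> \<le> 4 * real q" using N by (simp add: abs_mult)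
    have "\<bar>\<gamma>\<bar> * \<bar>\<Sum>d=1..N. \<psi> d * (1 / sqrt (real d))\<bar> \<le> \<bar>\<gamma>\<bar> * (2 * real q)"
      by (intro mult_left_mono sum_sqrt_bound) simp
    hence C: "\<bar>\<gamma> * (\<Sum>d=1..N. \<psi> d * (1 / sqrt (real d)))\<bar> \<le> 2 * \<bar>\<gamma>\<bar> * real q" by (simp add: abs_mult)
    have "\<bar>\<Sum>d=1..N. \<psi> d / sqrt (real d) * \<epsilon> d\<bar> \<le> (\<Sum>d=1..N. 4 / real N)"
    proof (rule order_trans[OF sum_abs], rule sum_mono)
      fix d assume d: "d \<in> {1..N}"
      have "real d \<le> x" using d NN by (simp add: x_def flip: of_nat_power)
      hence "\<bar>\<epsilon> d\<bar> \<le> 4 / sqrt (x / real d)" unfolding \<epsilon>_def using d by (intro \<gamma>) simp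
      also have "\<dots> = 4 * sqrt (real d) / real N" by (simp add: real_sqrt_divide x(2))
      finally have "\<bar>\<psi> d / sqrt (real d)\<bar> * \<bar>\<epsilon> d\<bar> \<le> (1 / sqrt (real d)) * (4 * sqrt (real d) / real N)"
        using abs_le_1[of d] by (intro mult_mono) (auto simp: divide_right_mono)
      also have "\<dots> = 4 / real N" using d by simp
      finally show "\<bar>\<psi> d / sqrt (real d) * \<epsilon> d\<bar> \<le> 4 / real N" by (simp add: abs_mult)
    qed
    hence D: "\<bar>\<Sum>d=1..N. \<psi> d / sqrt (real d) * \<epsilon> d\<bar> \<le> 4" using N by simp
    have "ln (real N) \<le> ln (real N + 1)" using N by simp
    also have "\<dots> \<le> (\<Sum>m=1..N. 1 / real m)"
      using ln_le_harm[of N] by (simp add: harm_def inverse_eq_divide)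
    also have "\<dots> \<le> (\<Sum>m=1..N. r (m\<^sup>2) / sqrt (real (m\<^sup>2)))"
      using r_square_ge_1 by (intro sum_mono) (auto simp: divide_right_mono)
    also have "\<dots> = (\<Sum>k\<in>(\<lambda>m. m\<^sup>2) ` {1..N}. r k / sqrt (real k))"
      by (subst sum.reindex) (auto simp: inj_on_def power2_eq_iff_nonneg)
    also have "\<dots> \<le> (\<Sum>k\<in>upto_real x. r k / sqrt (real k))"
      by (rule sum_mono2) (auto simp: upto_real_def x_def r_nonneg power_mono)
    finally show ?thesis unfolding eq eq2 using A B C D by linarith
  qed
  have "filterlim (\<lambda>N. ln (real N)) at_top sequentially" by real_asymp
  hence "eventually (\<lambda>N. ln (real N) > 8 * real q + 2 * \<bar>\<gamma>\<bar> * real q + 4) sequentially"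
    by (simp add: filterlim_at_top_dense)
  from eventually_conj[OF this eventually_ge_at_top[of 1]] obtain N where "N \<ge> 1"
    "ln (real N) > 8 * real q + 2 * \<bar>\<gamma>\<bar> * real q + 4" by (auto dest: eventually_happens)
  with bound[of N] show False by simp
qed

text \<open>Mertens' argument twisted by \<psi>: \<psi> ln is the convolution of \<psi> \<Lambda>
  with \<psi>. The sum of \<psi>(k) ln k / k is bounded, the inner sums are L + O(d / x), and
  Chebyshev bounds the total of these errors. So L times the wanted sum is bounded, and L is not
  0.\<close>

lemma sum_mangoldt_bound: "\<exists>C\<ge>0. \<forall>x\<ge>1. \<bar>\<Sum>n\<in>upto_real x. \<psi> n * (mangoldt n / real n)\<bar> \<le> C"
proof -
  obtain K where K: "K \<ge> 0" "\<And>x. x \<ge> 0 \<Longrightarrow> (\<Sum>n\<in>upto_real x. mangoldt n) \<le> K * x"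
    using chebyshev_psi by blast
  have lnb: "\<bar>\<Sum>i=1..N. \<psi> i * ((ln (real i) + 1) / real i)\<bar> \<le> 2 * real q" for N
  proof -
    have "\<bar>\<Sum>i\<in>{0<..N}. \<psi> i * ((ln (real i) + 1) / real i)\<bar> \<le> 2 * real q * ((ln (real (Suc 0)) + 1) / real (Suc 0))"
      by (rule abel_bound_antimono[OF partial_sum_bound]) (auto intro!: ln_plus_1_div_antimono)
    thus ?thesis by (simp add: atLeastSucAtMost_greaterThanAtMost)
  qed
  have oneb: "\<bar>\<Sum>i=1..N. \<psi> i * (1 / real i)\<bar> \<le> 2 * real q" for N
    using abel_bound_antimono[of \<psi> 0 "2 * real q" "\<lambda>i. 1 / real i" N, OF partial_sum_bound]
    by (simp add: frac_le atLeastSucAtMost_greaterThanAtMost)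
  have "\<bar>\<Sum>n\<in>upto_real x. \<psi> n * (mangoldt n / real n)\<bar> \<le> (4 * real q + 4 * real q * K) / \<bar>L\<bar>" if x: "x \<ge> 1" for x
  proof -
    have aux: "b * v = L * b + b * (v - L)" for b v by (simp add: algebra_simps)
    define S where "S = (\<Sum>n\<in>upto_real x. \<psi> n * (mangoldt n / real n))"
    define V where "V = (\<lambda>y. \<Sum>m\<in>upto_real y. \<psi> m * (1 / real m))"
    have V: "\<bar>V y - L\<bar> \<le> 4 * real q / y" if y: "y \<ge> 1" for y
    proof -
      note N = floor_bounds[OF y]
      have "\<bar>V y - L\<bar> \<le> 2 * real q * (1 / real (nat \<lfloor>y\<rfloor>))"
        unfolding V_def upto_real_altdef by (rule L_tail[OF N(1)])
      also have "\<dots> \<le> 2 * real q * (2 / y)" using N y by (intro mult_left_mono) (auto simp: divide_simps)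
      finally show ?thesis by simp
    qed
    have "(\<Sum>k\<in>upto_real x. \<psi> k * (ln (real k) / real k)) =
       (\<Sum>k\<in>upto_real x. \<Sum>d | d dvd k. (\<psi> d * (mangoldt d / real d)) * (\<psi> (k div d) * (1 / real (k div d))))"
    proof (intro sum.cong refl)
      fix k assume "k \<in> upto_real x"
      hence k: "k > 0" by (simp add: upto_real_def)
      have "(\<Sum>d | d dvd k. (\<psi> d * (mangoldt d / real d)) * (\<psi> (k div d) * (1 / real (k div d)))) =
        (\<Sum>d | d dvd k. \<psi> k / real k * mangoldt d)"
      proof (intro sum.cong refl)
        fix d assume "d \<in> {d. d dvd k}"
        then obtain e where e: "k = d * e" by blast
        with k show "(\<psi> d * (mangoldt d / real d)) * (\<psi> (k div d) * (1 / real (k div d))) = \<psi> k / real k * mangoldt d"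
          by (simp add: mult)
      qed
      also have "\<dots> = \<psi> k * (ln (real k) / real k)"
        unfolding sum_distrib_left[symmetric] using k by (simp add: mangoldt_sum_real)
      finally show "\<psi> k * (ln (real k) / real k) = (\<Sum>d | d dvd k. (\<psi> d * (mangoldt d / real d)) * (\<psi> (k div d) * (1 / real (k div d))))" ..
    qed
    also have "\<dots> = (\<Sum>d\<in>upto_real x. \<Sum>m\<in>upto_real (x / real d). (\<psi> d * (mangoldt d / real d)) * (\<psi> m * (1 / real m)))"
      by (rule sum_divisors_upto)
    also have "\<dots> = (\<Sum>d\<in>upto_real x. (\<psi> d * (mangoldt d / real d)) * V (x / real d))"
      by (simp add: V_def sum_distrib_left)
    also have "\<dots> = L * S + (\<Sum>d\<in>upto_real x. (\<psi> d * (mangoldt d / real d)) * (V (x / real d) - L))"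
      unfolding S_def sum_distrib_left sum.distrib[symmetric] by (intro sum.cong refl aux)
    finally have eq: "L * S = (\<Sum>k\<in>upto_real x. \<psi> k * (ln (real k) / real k)) -
        (\<Sum>d\<in>upto_real x. (\<psi> d * (mangoldt d / real d)) * (V (x / real d) - L))" by simp
    have "\<bar>\<Sum>d\<in>upto_real x. (\<psi> d * (mangoldt d / real d)) * (V (x / real d) - L)\<bar> \<le> (\<Sum>d\<in>upto_real x. mangoldt d * (4 * real q / x))"
    proof (rule order_trans[OF sum_abs], rule sum_mono)
      fix d assume d: "d \<in> upto_real x"
      have "\<bar>V (x / real d) - L\<bar> \<le> 4 * real q / (x / real d)" using d by (intro V) (auto simp: upto_real_def)
      hence "\<bar>\<psi> d\<bar> * (mangoldt d / real d * \<bar>V (x / real d) - L\<bar>) \<le> 1 * (mangoldt d / real d * (4 * real q / (x / real d)))"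
        by (intro mult_mono abs_le_1 mult_left_mono) (auto simp: mangoldt_nonneg)
      also have "\<dots> = mangoldt d * (4 * real q / x)" using d by (simp add: upto_real_def)
      finally show "\<bar>(\<psi> d * (mangoldt d / real d)) * (V (x / real d) - L)\<bar> \<le> mangoldt d * (4 * real q / x)"
        by (simp add: abs_mult mult_ac)
    qed
    also have "\<dots> = (\<Sum>d\<in>upto_real x. mangoldt d) * (4 * real q / x)" by (simp only: sum_distrib_right)
    also have "\<dots> \<le> K * x * (4 * real q / x)" using K(2)[of x] x by (intro mult_right_mono) auto
    also have "\<dots> = 4 * real q * K" using x by simp
    finally have 1: "\<bar>\<Sum>d\<in>upto_real x. (\<psi> d * (mangoldt d / real d)) * (V (x / real d) - L)\<bar> \<le> 4 * real q * K" .
    have "(\<Sum>k\<in>upto_real x. \<psi> k * (ln (real k) / real k)) =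
      (\<Sum>i=1..nat \<lfloor>x\<rfloor>. \<psi> i * ((ln (real i) + 1) / real i)) - (\<Sum>i=1..nat \<lfloor>x\<rfloor>. \<psi> i * (1 / real i))"
      by (simp add: upto_real_altdef algebra_simps add_divide_distrib flip: sum_subtractf)
    hence "\<bar>\<Sum>k\<in>upto_real x. \<psi> k * (ln (real k) / real k)\<bar> \<le> 4 * real q"
      using lnb[of "nat \<lfloor>x\<rfloor>"] oneb[of "nat \<lfloor>x\<rfloor>"] by linarith
    with 1 have "\<bar>L * S\<bar> \<le> 4 * real q + 4 * real q * K" unfolding eq by linarith
    thus ?thesis using L_nonzero by (simp add: S_def abs_mult field_simps)
  qed
  moreover have "(4 * real q + 4 * real q * K) / \<bar>L\<bar> \<ge> 0" using K by simp
  ultimately show ?thesis by blast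
qed

end

lemma finite_real_chars: "finite {\<psi>. real_char q \<psi>}"
proof (rule inj_on_finite)
  show "inj_on (\<lambda>\<psi>. restrict \<psi> {..<q}) {\<psi>. real_char q \<psi>}"
  proof (rule inj_onI)
    fix \<psi> \<omega> assume "\<psi> \<in> {\<psi>. real_char q \<psi>}" "\<omega> \<in> {\<psi>. real_char q \<psi>}"
      and eq: "restrict \<psi> {..<q} = restrict \<omega> {..<q}"
    then interpret a: real_char q \<psi> + b: real_char q \<omega> by auto
    show "\<psi> = \<omega>"
    proof
      fix n
      have "\<psi> n = \<psi> (n mod q)" "\<omega> n = \<omega> (n mod q)" by (auto intro!: a.cong b.cong simp: cong_def)
      thus "\<psi> n = \<omega> n" using fun_cong[OF eq, of "n mod q"] a.q by (simp add: restrict_def)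
    qed
  qed
  show "(\<lambda>\<psi>. restrict \<psi> {..<q}) ` {\<psi>. real_char q \<psi>} \<subseteq> (\<Pi>\<^sub>E i\<in>{..<q}. {0, 1, -1})"
  proof clarify
    fix \<psi> assume "real_char q \<psi>"
    then interpret real_char q \<psi> .
    have "\<psi> n \<in> {0, 1, -1}" for n using unimod[of n] zero[of n] by blast
    thus "restrict \<psi> {..<q} \<in> (\<Pi>\<^sub>E i\<in>{..<q}. {0, 1, -1})" by auto
  qed
  show "finite (\<Pi>\<^sub>E i\<in>{..<q}. {0, 1, -1::real})" by (intro finite_PiE) auto
qed

text \<open>The character of the final contradiction is found only inside a window whose length has
  been fixed before. The bound must therefore hold for all characters at once, which is possible as
  there are finitely many of them modulo \<open>q\<close>.\<close>

lemma real_chars_mangoldt_bound: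
  "\<exists>C\<ge>0. \<forall>\<psi>. real_char q \<psi> \<longrightarrow> (\<forall>x\<ge>1. \<bar>\<Sum>n\<in>upto_real x. \<psi> n * (mangoldt n / real n)\<bar> \<le> C)"
proof -
  have "\<forall>\<psi>\<in>{\<psi>. real_char q \<psi>}. \<exists>C\<ge>0. \<forall>x\<ge>1. \<bar>\<Sum>n\<in>upto_real x. \<psi> n * (mangoldt n / real n)\<bar> \<le> C"
    using real_char.sum_mangoldt_bound by blast
  then obtain C where C: "\<And>\<psi>. real_char q \<psi> \<Longrightarrow> C \<psi> \<ge> 0"
    "\<And>\<psi> x. real_char q \<psi> \<Longrightarrow> x \<ge> 1 \<Longrightarrow> \<bar>\<Sum>n\<in>upto_real x. \<psi> n * (mangoldt n / real n)\<bar> \<le> C \<psi>"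
    by (auto simp: bchoice_iff)
  have "C \<psi> \<le> (\<Sum>\<psi> | real_char q \<psi>. C \<psi>)" if "real_char q \<psi>" for \<psi>
    using that C(1) finite_real_chars by (intro member_le_sum) auto
  moreover have "(\<Sum>\<psi> | real_char q \<psi>. C \<psi>) \<ge> 0" using C(1) by (intro sum_nonneg) auto
  ultimately show ?thesis using C(2) by (meson order_trans)
qed

section \<open>Exceptional primes and isometric actions\<close>

lemma geometric_tail_le:
  fixes y :: real
  assumes "0 \<le> y" "y \<le> 1 / 2"
  shows "(\<Sum>k=2..K. y ^ k) \<le> 2 * y\<^sup>2"
proof (cases "K \<ge> 2")
  case True
  hence "(\<Sum>k=2..K. y ^ k) \<le> 2 * y\<^sup>2 - y ^ K"
  proof (induction K rule: dec_induct)
    case (step K)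
    have "y ^ K * y \<le> y ^ K * (1 / 2)" using assms by (intro mult_left_mono) auto
    hence "2 * y ^ Suc K \<le> y ^ K" by (simp add: mult.commute)
    moreover have "(\<Sum>k=2..Suc K. y ^ k) = (\<Sum>k=2..K. y ^ k) + y ^ Suc K"
      using step.hyps by simp
    ultimately show ?case using step.IH by linarith
  qed simp
  moreover have "y ^ K \<ge> 0" using assms by simp
  ultimately show ?thesis by linarith
qed (use assms in simp)

text \<open>For each prime p the powers from the square on contribute at most ln p times the
  geometric tail 2 / p^2, and ln p \<le> 2 sqrt p turns this into the summable 4 p^(-3/2).\<close>

lemma sum_prime_powers_bound:
  "\<exists>C\<ge>0. \<forall>x. (\<Sum>n | n \<in> upto_real x \<and> \<not> prime n. mangoldt n / real n) \<le> C"
proof -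
  define g where "g = (\<lambda>n. 4 * real n powr (-3/2))"
  have sg: "summable g" unfolding g_def by (intro summable_mult) (simp add: summable_real_powr_iff)
  have "(\<Sum>n | n \<in> upto_real x \<and> \<not> prime n. mangoldt n / real n) \<le> suminf g" for x
  proof -
    define N where "N = nat \<lfloor>x\<rfloor>"
    define P where "P = {p. prime p \<and> p \<le> N}"
    have finP: "finite P" by (simp add: P_def)
    define h where "h = (\<lambda>n. mangoldt n / real n :: real)"
    have h0: "h n \<ge> 0" for n by (simp add: h_def mangoldt_nonneg)
    have "(\<Sum>n | n \<in> upto_real x \<and> \<not> prime n. h n) = (\<Sum>n | n \<in> upto_real x \<and> \<not> prime n \<and> primepow n. h n)"
    proof (rule sum.mono_neutral_right)
      show "finite {n. n \<in> upto_real x \<and> \<not> prime n}" by (rule finite_subset[OF _ finite_upto_real[of x]]) auto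
    qed (auto simp: h_def mangoldt_def)
    also have "\<dots> \<le> (\<Sum>n\<in>(\<lambda>(p,k). p ^ k) ` (P \<times> {2..N}). h n)"
    proof (rule sum_mono2)
      show "{n. n \<in> upto_real x \<and> \<not> prime n \<and> primepow n} \<subseteq> (\<lambda>(p,k). p ^ k) ` (P \<times> {2..N})"
      proof safe
        fix n assume n: "n \<in> upto_real x" "\<not> prime n" "primepow n"
        then obtain p k where pk: "prime p" "k > 0" "n = p ^ k" by (auto simp: primepow_def)
        have k: "k \<ge> 2" using pk n by (cases "k = 1") auto
        have nN: "n \<le> N" using n by (auto simp: upto_real_altdef N_def)
        have "p ^ 1 \<le> p ^ k" using pk by (intro power_increasing) (auto simp: prime_gt_0_nat Suc_le_eq)
        hence "p \<le> N" using pk nN by simp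
        moreover have "(2::nat) ^ k \<le> p ^ k" using pk by (intro power_mono) (auto simp: prime_ge_2_nat)
        hence "k \<le> N" using less_exp[of k] nN unfolding pk(3) by linarith
        ultimately have "(p, k) \<in> P \<times> {2..N}" using pk nN k by (auto simp: P_def)
        thus "n \<in> (\<lambda>(p,k). p ^ k) ` (P \<times> {2..N})" using pk by force
      qed
    qed (use finP h0 in auto)
    also have "\<dots> \<le> (\<Sum>z\<in>P \<times> {2..N}. h ((\<lambda>(p,k). p ^ k) z))"
      using sum_image_le[of "P \<times> {2..N}" h "\<lambda>(p,k). p ^ k"] finP h0 by (simp add: o_def)
    also have "\<dots> = (\<Sum>p\<in>P. \<Sum>k=2..N. h (p ^ k))"
      by (simp add: sum.cartesian_product case_prod_beta)
    also have "\<dots> \<le> (\<Sum>p\<in>P. g p)"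
    proof (rule sum_mono)
      fix p assume "p \<in> P"
      hence p: "prime p" "p \<ge> 2" by (auto simp: P_def prime_ge_2_nat)
      have "(\<Sum>k=2..N. h (p ^ k)) = ln (real p) * (\<Sum>k=2..N. (1 / real p) ^ k)"
        unfolding sum_distrib_left
        by (intro sum.cong refl) (use p in \<open>auto simp: h_def power_one_over field_simps\<close>)
      also have "\<dots> \<le> (2 * sqrt (real p)) * (2 * (1 / real p)\<^sup>2)"
        using p by (intro mult_mono geometric_tail_le ln_le_2_sqrt) (auto simp: field_simps intro!: sum_nonneg)
      also have "\<dots> = 4 * (real p powr (1/2) * real p powr (-2))"
        using p by (simp add: powr_half_sqrt power_one_over powr_minus divide_simps)
      also have "\<dots> = g p" unfolding g_def by (subst powr_add [symmetric]) simp
      finally show "(\<Sum>k=2..N. h (p ^ k)) \<le> g p" .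
    qed
    also have "\<dots> \<le> suminf g" by (rule sum_le_suminf[OF sg finP]) (simp add: g_def)
    finally show ?thesis by (simp add: h_def)
  qed
  moreover have "suminf g \<ge> 0" by (intro suminf_nonneg sg) (simp add: g_def)
  ultimately show ?thesis by blast
qed

lemma summable_on_small_tail:
  fixes f :: "'b \<Rightarrow> real"
  assumes "f summable_on E" "\<epsilon> > 0"
  obtains F where "finite F" "F \<subseteq> E" "\<And>G. finite G \<Longrightarrow> G \<subseteq> E - F \<Longrightarrow> sum f G < \<epsilon>"
proof -
  have "((\<lambda>F. sum f F) \<longlongrightarrow> infsum f E) (finite_subsets_at_top E)"
    using assms(1) by (meson has_sum_def has_sum_infsum)
  hence "\<forall>\<^sub>F F in finite_subsets_at_top E. dist (sum f F) (infsum f E) < \<epsilon> / 2"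
    by (rule tendstoD) (use assms(2) in simp)
  hence "\<exists>F. finite F \<and> F \<subseteq> E \<and>
      (\<forall>H. finite H \<and> F \<subseteq> H \<and> H \<subseteq> E \<longrightarrow> dist (sum f H) (infsum f E) < \<epsilon> / 2)"
    unfolding eventually_finite_subsets_at_top .
  then obtain F where F: "finite F" "F \<subseteq> E"
    and near: "\<forall>H. finite H \<and> F \<subseteq> H \<and> H \<subseteq> E \<longrightarrow> dist (sum f H) (infsum f E) < \<epsilon> / 2"
    by (elim exE conjE)
  have "sum f G < \<epsilon>" if G: "finite G" "G \<subseteq> E - F" for G
  proof -
    have "sum f (F \<union> G) = sum f F + sum f G" using F G by (intro sum.union_disjoint) auto
    moreover have "dist (sum f (F \<union> G)) (infsum f E) < \<epsilon> / 2" "dist (sum f F) (infsum f E) < \<epsilon> / 2"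
      by (rule near[rule_format]; use F G in blast)+
    ultimately show ?thesis unfolding dist_real_def by linarith
  qed
  thus ?thesis using F that by blast
qed

text \<open>All non-primes are counted as exceptional, at bounded cost. Of the exceptional primes,
  finitely many are put aside so that the others have reciprocal sum below \<epsilon> / 2; on these
  \<Lambda> is at most ln x. The bounded part B is at most \<epsilon> / 2 ln x once x \<ge> exp (2 B
  / \<epsilon>).\<close>

lemma sum_mangoldt_exceptional:
  fixes a :: "nat \<Rightarrow> int"
  assumes "almost_every_prime {p. a p = 1}" "\<epsilon> > 0"
  shows "\<exists>X\<ge>1. \<forall>x\<ge>X. (\<Sum>n | n \<in> upto_real x \<and> a n \<noteq> 1. mangoldt n / real n) \<le> \<epsilon> * ln x"
proof -
  define E where "E = {p. prime p \<and> a p \<noteq> 1}"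
  have "(\<lambda>p. 1 / real p) summable_on E" using assms(1) by (simp add: almost_every_prime_def E_def)
  then obtain F where F: "finite F" "F \<subseteq> E" "\<And>G. finite G \<Longrightarrow> G \<subseteq> E - F \<Longrightarrow> (\<Sum>p\<in>G. 1 / real p) < \<epsilon> / 2"
    using summable_on_small_tail[of _ E "\<epsilon> / 2"] assms(2) by (metis half_gt_zero)
  obtain C where C: "C \<ge> 0" "\<And>x. (\<Sum>n | n \<in> upto_real x \<and> \<not> prime n. mangoldt n / real n) \<le> C"
    using sum_prime_powers_bound by blast
  define B where "B = C + (\<Sum>p\<in>F. mangoldt p / real p)"
  have B: "B \<ge> 0" using C by (auto simp: B_def mangoldt_nonneg intro!: add_nonneg_nonneg sum_nonneg)
  have "(\<Sum>n | n \<in> upto_real x \<and> a n \<noteq> 1. mangoldt n / real n) \<le> \<epsilon> * ln x" if x: "x \<ge> exp (2 * B / \<epsilon>)" for x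
  proof -
    have "exp (2 * B / \<epsilon>) \<ge> 1" using B assms(2) by simp
    hence x1: "x \<ge> 1" using x by linarith
    have "2 * B / \<epsilon> \<le> ln x" using x x1 by (simp add: ln_ge_iff)
    hence Bl: "B \<le> \<epsilon> / 2 * ln x" using assms(2) by (simp add: field_simps)
    define G where "G = {p \<in> upto_real x. p \<in> E - F}"
    have G: "finite G" "G \<subseteq> E - F" by (auto simp: G_def)
    have nn: "mangoldt n / real n \<ge> (0::real)" for n by (simp add: mangoldt_nonneg)
    have fin: "finite {n. n \<in> upto_real x \<and> \<not> prime n}" by (rule finite_subset[OF _ finite_upto_real[of x]]) auto
    have "(\<Sum>n | n \<in> upto_real x \<and> a n \<noteq> 1. mangoldt n / real n) \<le>
       (\<Sum>n \<in> {n. n \<in> upto_real x \<and> \<not> prime n} \<union> (F \<union> G). mangoldt n / real n)"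
      using F G fin by (intro sum_mono2 nn) (auto simp: G_def E_def)
    also have "\<dots> \<le> (\<Sum>n | n \<in> upto_real x \<and> \<not> prime n. mangoldt n / real n) + (\<Sum>n\<in>F \<union> G. mangoldt n / real n)"
      using fin F G nn by (subst sum.union_inter [symmetric]) (auto intro!: sum_nonneg)
    also have "(\<Sum>n\<in>F \<union> G. mangoldt n / real n) \<le> (\<Sum>n\<in>F. mangoldt n / real n) + (\<Sum>n\<in>G. mangoldt n / real n)"
      using F G nn by (subst sum.union_inter [symmetric]) (auto intro!: sum_nonneg)
    also have "(\<Sum>n\<in>G. mangoldt n / real n) \<le> (\<Sum>n\<in>G. ln x * (1 / real n))"
    proof (rule sum_mono)
      fix n assume "n \<in> G"
      hence n: "n > 0" "real n \<le> x" by (auto simp: G_def upto_real_def)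
      have "mangoldt n \<le> ln (real n)" using n by (intro mangoldt_le) auto
      also have "\<dots> \<le> ln x" using n x1 by simp
      finally show "mangoldt n / real n \<le> ln x * (1 / real n)" by (simp add: divide_right_mono)
    qed
    also have "\<dots> = ln x * (\<Sum>n\<in>G. 1 / real n)" by (rule sum_distrib_left [symmetric])
    also have "\<dots> \<le> ln x * (\<epsilon> / 2)" using F(3)[OF G] x1 by (intro mult_left_mono) auto
    finally show ?thesis using C(2)[of x] Bl by (simp add: B_def algebra_simps)
  qed
  moreover have "exp (2 * B / \<epsilon>) \<ge> 1" using B assms(2) by simp
  ultimately show ?thesis by blast
qed

text \<open>A semi-inner product: vectors of norm 0 need not vanish and completeness is not assumed.
  This is what coefficient families representing combinations of the functions F o T^k
  provide.\<close>

locale isometric_action =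
  fixes ip :: "'v :: real_vector \<Rightarrow> 'v \<Rightarrow> real" and U :: "int \<Rightarrow> 'v \<Rightarrow> 'v"
  assumes ip_add: "ip (x + y) z = ip x z + ip y z"
    and ip_scale: "ip (t *\<^sub>R x) z = t * ip x z"
    and ip_sym: "ip x y = ip y x"
    and ip_nonneg: "ip x x \<ge> 0"
    and U_add: "U k (x + y) = U k x + U k y"
    and U_scale: "U k (t *\<^sub>R x) = t *\<^sub>R U k x"
    and U_ip: "ip (U k x) (U k y) = ip x y"
    and U_U: "U k (U l x) = U (k + l) x"
begin

definition nrm :: "'v \<Rightarrow> real" where
  "nrm x = sqrt (ip x x)"

lemma nrm_nonneg [simp]: "nrm x \<ge> 0"
  by (simp add: nrm_def ip_nonneg)

lemma nrm_sq: "(nrm x)\<^sup>2 = ip x x"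
  by (simp add: nrm_def ip_nonneg)

lemma ip_add_right: "ip z (x + y) = ip z x + ip z y"
  using ip_add ip_sym by metis

lemma ip_scale_right: "ip z (t *\<^sub>R x) = t * ip z x"
  using ip_scale ip_sym by metis

lemma ip_0 [simp]: "ip 0 z = 0" "ip z 0 = 0"
  using ip_scale[of 0 0 z] ip_scale_right[of z 0 0] by auto

lemma ip_minus: "ip (- x) z = - ip x z"
  using ip_scale[of "-1" x z] by simp

lemma ip_diff: "ip (x - y) z = ip x z - ip y z"
  using ip_add[of x "- y" z] by (simp add: ip_minus)

lemma ip_diff_right: "ip z (x - y) = ip z x - ip z y"
  using ip_diff ip_sym by metis

lemma ip_sum_right: "ip z (\<Sum>i\<in>I. f i) = (\<Sum>i\<in>I. ip z (f i))"
  by (induction I rule: infinite_finite_induct) (auto simp: ip_add_right)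

lemma U_0v [simp]: "U k 0 = 0"
  using U_scale[of k 0 0] by simp

lemma U_minus: "U k (- x) = - U k x"
  using U_scale[of k "-1" x] by simp

lemma U_diff: "U k (x - y) = U k x - U k y"
  using U_add[of k x "- y"] by (simp add: U_minus)

lemma U_sum: "U k (\<Sum>i\<in>I. f i) = (\<Sum>i\<in>I. U k (f i))"
  by (induction I rule: infinite_finite_induct) (auto simp: U_add)

lemma nrm_U [simp]: "nrm (U k x) = nrm x"
  by (simp add: nrm_def U_ip)

lemma nrm_diff_sq: "(nrm (x - y))\<^sup>2 = (nrm x)\<^sup>2 - 2 * ip x y + (nrm y)\<^sup>2"
  by (simp add: nrm_sq ip_diff ip_diff_right ip_sym[of y x])

lemma nrm_0 [simp]: "nrm 0 = 0"
  by (simp add: nrm_def)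

lemma nrm_scale: "nrm (t *\<^sub>R x) = \<bar>t\<bar> * nrm x"
  by (simp add: nrm_def ip_scale ip_scale_right real_sqrt_mult flip: mult.assoc)

lemma cauchy_schwarz: "ip x y \<le> nrm x * nrm y"
proof -
  have *: "(nrm x)\<^sup>2 * (nrm y)\<^sup>2 \<ge> (ip x y)\<^sup>2"
  proof (cases "ip y y = 0")
    case False
    define t where "t = ip x y / ip y y"
    have "0 \<le> ip (x - t *\<^sub>R y) (x - t *\<^sub>R y)" by (rule ip_nonneg)
    also have "\<dots> = ip x x - 2 * t * ip x y + t * (t * ip y y)"
      by (simp add: ip_diff ip_diff_right ip_scale ip_scale_right ip_sym[of y x] algebra_simps)
    also have "t * ip y y = ip x y" using False by (simp add: t_def)
    finally have "ip x y * ip x y / ip y y \<le> ip x x" by (simp add: t_def)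
    thus ?thesis using False ip_nonneg[of y] unfolding nrm_sq by (simp add: power2_eq_square field_simps)
  next
    case True
    have "0 \<le> ip x x - 2 * t * ip x y" for t
      using ip_nonneg[of "x - t *\<^sub>R y"] True
      by (simp add: ip_diff ip_diff_right ip_scale ip_scale_right ip_sym[of y x])
    \<comment> \<open>Degenerate direction: were ip x y not 0, this t would make the right-hand side
      equal to -1.\<close>
    from this[of "(ip x x + 1) / (2 * ip x y)"] have "ip x y = 0" by (cases "ip x y = 0") auto
    thus ?thesis by simp
  qed
  show ?thesis by (rule power2_le_imp_le) (use * in \<open>auto simp: power_mult_distrib\<close>)
qed

lemma nrm_triangle: "nrm (x + y) \<le> nrm x + nrm y"
proof (rule power2_le_imp_le)
  show "(nrm (x + y))\<^sup>2 \<le> (nrm x + nrm y)\<^sup>2"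
    using cauchy_schwarz[of x y] by (simp add: power2_sum nrm_sq ip_add ip_add_right ip_sym[of y x])
qed simp

lemma nrm_minus_commute: "nrm (x - y) = nrm (y - x)"
  using nrm_scale[of "-1" "x - y"] by simp

lemma nrm_triangle_diff: "nrm (x - z) \<le> nrm (x - y) + nrm (y - z)"
  using nrm_triangle[of "x - y" "y - z"] by simp

lemma nrm_le_add_diff: "nrm x \<le> nrm y + nrm (x - y)"
  using nrm_triangle[of y "x - y"] by simp

lemma nrm_sum: "nrm (\<Sum>i\<in>I. f i) \<le> (\<Sum>i\<in>I. nrm (f i))"
proof (induction I rule: infinite_finite_induct)
  case (insert i I)
  thus ?case using nrm_triangle[of "f i" "sum f I"] by simp
qed auto

end

section \<open>Nearly maximal averages\<close>

text \<open>\<open>exceptional\<close> is the hypothesis on primes in the form in which it is used: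
  integers with a n \<noteq> 1 carry a negligible share of the mass of \<Lambda>(n) / n. By
  additivity most of the mass of \<Lambda> * \<Lambda> then lies on integers with a n = 2.\<close>

locale mult_average = isometric_action +
  fixes F :: "'a" and a :: "nat \<Rightarrow> int" and q :: nat
  assumes q: "q > 0"
    and additive: "m > 0 \<Longrightarrow> n > 0 \<Longrightarrow> a (m * n) = a m + a n"
    and exceptional: "\<epsilon> > 0 \<Longrightarrow> \<exists>X\<ge>1. \<forall>x\<ge>X. (\<Sum>n | n \<in> upto_real x \<and> a n \<noteq> 1. mangoldt n / real n) \<le> \<epsilon> * ln x"
begin

definition S :: "nat \<Rightarrow> real \<Rightarrow> 'a" where
  "S c x = (\<Sum>m\<in>ap q c x. U (a m) F)"

text \<open>Normalised by x rather than by the number of terms, so that S (c / n) (x / n) / x is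
  exactly 1 / n times the average at (c / n, x / n).\<close>

definition M :: "nat \<Rightarrow> real \<Rightarrow> 'a" where
  "M c x = (1 / x) *\<^sub>R S c x"

lemma S_cong: "[c = c'] (mod q) \<Longrightarrow> S c x = S c' x"
  by (simp add: S_def ap_cong)

lemma M_cong: "[c = c'] (mod q) \<Longrightarrow> M c x = M c' x"
  by (simp add: M_def S_cong[of c c'])

lemma nrm_sum_U_le:
  assumes "finite A"
  shows "nrm (\<Sum>m\<in>A. U (a m) F) \<le> real (card A) * nrm F"
  using nrm_sum[of "\<lambda>m. U (a m) F" A] by simp

lemma card_ap_le: "x \<ge> 0 \<Longrightarrow> real (card (ap q c x)) \<le> x"
  using card_mono[OF finite_upto_real ap_subset, of q c x] card_upto_real[of x] by linarith

lemma nrm_S_le: "x \<ge> 0 \<Longrightarrow> nrm (S c x) \<le> x * nrm F"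
  unfolding S_def
  by (rule order_trans[OF nrm_sum_U_le]) (auto intro!: mult_right_mono card_ap_le)

lemma nrm_M_le:
  assumes "x > 0"
  shows "nrm (M c x) \<le> nrm F"
  using nrm_S_le[of x c] assms by (simp add: M_def nrm_scale field_simps)

text \<open>Passing from y to z adds at most z - y + 1 vectors and changes the normalisation by the
  relative amount (z - y) / z; both are of size d since z \<le> exp d y. The term 1 / y pays for
  counting integers between real limits.\<close>

lemma M_lipschitz:
  assumes y: "1 \<le> y" "y \<le> z" "z \<le> exp d * y"
  shows "nrm (M c y - M c z) \<le> nrm F * (2 * d + 1 / y)"
proof -
  have sub: "ap q c y \<subseteq> ap q c z" using y by (auto simp: ap_def)
  have D: "S c z - S c y = (\<Sum>m\<in>ap q c z - ap q c y. U (a m) F)"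
    using sub by (simp add: S_def sum_diff)
  have "card (ap q c z - ap q c y) \<le> card {nat \<lfloor>y\<rfloor><..nat \<lfloor>z\<rfloor>}"
    by (intro card_mono) (use y in \<open>auto simp: ap_def le_nat_floor nat_less_iff floor_less_iff\<close>)
  also have "\<dots> = nat \<lfloor>z\<rfloor> - nat \<lfloor>y\<rfloor>" by simp
  finally have "real (card (ap q c z - ap q c y)) \<le> z - y + 1"
    using y floor_bounds(3)[of y] floor_bounds(2)[of z] by linarith
  hence "nrm (S c z - S c y) \<le> (z - y + 1) * nrm F"
    unfolding D by (intro order_trans[OF nrm_sum_U_le] mult_right_mono) auto
  hence 1: "nrm ((1 / z) *\<^sub>R (S c z - S c y)) \<le> (z - y + 1) / z * nrm F"
    using y by (simp add: nrm_scale divide_simps)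
  have "(1 / y - 1 / z) * nrm (S c y) \<le> (1 / y - 1 / z) * (y * nrm F)"
    using y by (intro mult_left_mono nrm_S_le) (auto simp: frac_le)
  also have "\<dots> = (z - y) / z * nrm F" using y by (simp add: field_simps)
  finally have 2: "nrm ((1 / y - 1 / z) *\<^sub>R S c y) \<le> (z - y) / z * nrm F"
    using y by (simp add: nrm_scale frac_le)
  have "M c y - M c z = (1 / y - 1 / z) *\<^sub>R S c y - (1 / z) *\<^sub>R (S c z - S c y)"
    by (simp add: M_def algebra_simps)
  hence "nrm (M c y - M c z) \<le> nrm ((1 / y - 1 / z) *\<^sub>R S c y) + nrm ((1 / z) *\<^sub>R (S c z - S c y))"
    using nrm_triangle[of "(1 / y - 1 / z) *\<^sub>R S c y" "- ((1 / z) *\<^sub>R (S c z - S c y))"]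
      nrm_scale[of "-1" "(1 / z) *\<^sub>R (S c z - S c y)"] by simp
  also have "\<dots> \<le> (2 * ((z - y) / z) + 1 / z) * nrm F"
    using 1 2 y by (simp add: field_simps)
  also have "\<dots> \<le> (2 * d + 1 / y) * nrm F"
  proof (intro mult_right_mono add_mono mult_left_mono)
    have "exp (- d) * z \<le> exp (- d) * (exp d * y)" using y by (intro mult_left_mono) auto
    hence "exp (- d) * z \<le> y" by (simp add: exp_minus field_simps)
    moreover have "(1 - d) * z \<le> exp (- d) * z" using y exp_ge_add_one_self[of "- d"] by (intro mult_right_mono) auto
    ultimately show "(z - y) / z \<le> d" using y by (simp add: field_simps)
  qed (use y in \<open>auto simp: frac_le\<close>)
  finally show ?thesis by (simp add: mult.commute)
qed

lemma ln_sq_identity: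
  assumes "coprime c q"
  shows "(\<Sum>k\<in>ap q c x. (ln (real k))\<^sup>2 *\<^sub>R U (a k) F) =
         (\<Sum>n\<in>cop q x. lam2 n *\<^sub>R U (a n) (S (c * rinv q n) (x / real n)))"
proof -
  have "(\<Sum>k\<in>ap q c x. (ln (real k))\<^sup>2 *\<^sub>R U (a k) F) =
        (\<Sum>k\<in>ap q c x. \<Sum>d | d dvd k. lam2 d *\<^sub>R U (a d) (U (a (k div d)) F))"
  proof (intro sum.cong refl)
    fix k assume "k \<in> ap q c x"
    hence k: "k > 0" by (simp add: ap_def)
    have "(ln (real k))\<^sup>2 *\<^sub>R U (a k) F = (\<Sum>d | d dvd k. lam2 d *\<^sub>R U (a k) F)"
      using lam2_sum[OF k] by (simp flip: scaleR_sum_left)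
    also have "\<dots> = (\<Sum>d | d dvd k. lam2 d *\<^sub>R U (a d) (U (a (k div d)) F))"
    proof (intro sum.cong refl)
      fix d assume "d \<in> {d. d dvd k}"
      then obtain e where e: "k = d * e" by blast
      with k show "lam2 d *\<^sub>R U (a k) F = lam2 d *\<^sub>R U (a d) (U (a (k div d)) F)"
        by (simp add: U_U additive)
    qed
    finally show "(ln (real k))\<^sup>2 *\<^sub>R U (a k) F = (\<Sum>d | d dvd k. lam2 d *\<^sub>R U (a d) (U (a (k div d)) F))" .
  qed
  also have "\<dots> = (\<Sum>n\<in>cop q x. \<Sum>m\<in>ap q (c * rinv q n) (x / real n). lam2 n *\<^sub>R U (a n) (U (a m) F))"
    by (rule sum_divisors_ap[OF q assms])
  finally show ?thesis by (simp add: S_def U_sum scaleR_sum_right)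
qed

definition V :: "nat \<Rightarrow> real \<Rightarrow> nat \<Rightarrow> 'a" where
  "V c x n = U (a n) (M (c * rinv q n) (x / real n))"

lemma nrm_V: "nrm (V c x n) = nrm (M (c * rinv q n) (x / real n))"
  by (simp add: V_def)

text \<open>\<open>ln_sq_identity\<close> carries the weight (ln k)^2 instead of (ln x)^2. Their
  difference is at most 2 ln x ln (x / k), and ln (x / k) \<le> 2 sqrt (x / k) sums to O(x), so the
  replacement loses one logarithm only.\<close>

lemma average_identity:
  assumes c: "coprime c q" and x: "x \<ge> 1"
  shows "nrm ((ln x)\<^sup>2 *\<^sub>R M c x - (\<Sum>n\<in>cop q x. (lam2 n / real n) *\<^sub>R V c x n)) \<le> 8 * nrm F * ln x"
proof -
  have "(\<Sum>n\<in>cop q x. (lam2 n / real n) *\<^sub>R V c x n) =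
      (1 / x) *\<^sub>R (\<Sum>n\<in>cop q x. lam2 n *\<^sub>R U (a n) (S (c * rinv q n) (x / real n)))"
    unfolding scaleR_sum_right
    by (intro sum.cong refl) (auto simp: V_def M_def U_scale cop_def)
  also have "\<dots> = (1 / x) *\<^sub>R (\<Sum>k\<in>ap q c x. (ln (real k))\<^sup>2 *\<^sub>R U (a k) F)"
    by (simp add: ln_sq_identity[OF c])
  finally have "(ln x)\<^sup>2 *\<^sub>R M c x - (\<Sum>n\<in>cop q x. (lam2 n / real n) *\<^sub>R V c x n) =
      (1 / x) *\<^sub>R (\<Sum>k\<in>ap q c x. ((ln x)\<^sup>2 - (ln (real k))\<^sup>2) *\<^sub>R U (a k) F)"
    by (simp add: M_def S_def scaleR_sum_right sum_subtractf algebra_simps)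
  also have "nrm \<dots> \<le> (1 / x) * (\<Sum>k\<in>ap q c x. nrm (((ln x)\<^sup>2 - (ln (real k))\<^sup>2) *\<^sub>R U (a k) F))"
  proof -
    have "nrm ((1 / x) *\<^sub>R v) = (1 / x) * nrm v" for v using x by (simp add: nrm_scale)
    thus ?thesis using x by (simp only: mult_left_mono nrm_sum divide_nonneg_nonneg zero_le_one order_trans[OF zero_le_one])
  qed
  also have "\<dots> \<le> (1 / x) * (\<Sum>k\<in>ap q c x. 4 * ln x * sqrt x * nrm F * (1 / sqrt (real k)))"
  proof (intro mult_left_mono sum_mono)
    fix k assume "k \<in> ap q c x"
    hence k: "k > 0" "real k \<le> x" by (auto simp: ap_def)
    have lk: "0 \<le> ln (real k)" "ln (real k) \<le> ln x" using k by auto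
    have "ln x - ln (real k) = ln (x / real k)" using k by (simp add: ln_div)
    also have "\<dots> \<le> 2 * sqrt (x / real k)" using k by (intro ln_le_2_sqrt) simp
    finally have "ln x - ln (real k) \<le> 2 * sqrt x / sqrt (real k)" by (simp add: real_sqrt_divide)
    hence "(ln x - ln (real k)) * (ln x + ln (real k)) \<le> (2 * sqrt x / sqrt (real k)) * (2 * ln x)"
      using lk by (intro mult_mono) auto
    moreover have "(ln x)\<^sup>2 - (ln (real k))\<^sup>2 = (ln x - ln (real k)) * (ln x + ln (real k))"
      by (simp add: power2_eq_square algebra_simps)
    moreover have "(ln x)\<^sup>2 - (ln (real k))\<^sup>2 \<ge> 0" using lk by (simp add: power_mono)
    ultimately have "\<bar>(ln x)\<^sup>2 - (ln (real k))\<^sup>2\<bar> * nrm F \<le> (2 * sqrt x / sqrt (real k)) * (2 * ln x) * nrm F"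
      by (intro mult_right_mono) auto
    thus "nrm (((ln x)\<^sup>2 - (ln (real k))\<^sup>2) *\<^sub>R U (a k) F) \<le> 4 * ln x * sqrt x * nrm F * (1 / sqrt (real k))"
      by (simp add: nrm_scale mult_ac)
  qed (use x in auto)
  also have "\<dots> = 4 * ln x * sqrt x * nrm F / x * (\<Sum>k\<in>ap q c x. 1 / sqrt (real k))"
    by (simp add: sum_distrib_left)
  also have "\<dots> \<le> 4 * ln x * sqrt x * nrm F / x * (2 * sqrt x)"
  proof (rule mult_left_mono)
    have "(\<Sum>k\<in>ap q c x. 1 / sqrt (real k)) \<le> (\<Sum>k\<in>upto_real x. 1 / sqrt (real k))"
      by (intro sum_mono2 ap_subset) auto
    thus "(\<Sum>k\<in>ap q c x. 1 / sqrt (real k)) \<le> 2 * sqrt x"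
      using sum_inverse_sqrt_upto_le[of x] x by simp
  qed (use x in auto)
  also have "\<dots> = 8 * ln x * nrm F * ((sqrt x * sqrt x) / x)"
  proof -
    have "4 * l * s * n / y * (2 * s) = 8 * l * n * ((s * s) / y)" for l s n y :: real
      by (simp add: divide_inverse algebra_simps)
    thus ?thesis .
  qed
  also have "(sqrt x * sqrt x) / x = 1" using x by simp
  finally show ?thesis by (simp add: mult_ac)
qed

text \<open>Quantitative strict convexity. Expanding the square, the weights sum to at most l^2, the
  weighted mean of the V is nearly M c x, and the V have norm at most L + \<epsilon>. This leaves
  l^2 ((L + \<epsilon>)^2 - (L - \<epsilon>)^2) = 4 L \<epsilon> l^2; the fifth L \<epsilon> l^2
  absorbs all terms linear in l = ln x.\<close>

lemma variance_bound:
  assumes L: "0 < \<epsilon>" "\<epsilon> \<le> L" and N0: "N0 \<ge> 1"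
    and up: "\<And>c y. coprime c q \<Longrightarrow> y \<ge> N0 \<Longrightarrow> nrm (M c y) \<le> L + \<epsilon>"
  shows "\<exists>X\<ge>1. \<forall>x\<ge>X. \<forall>c. coprime c q \<longrightarrow> nrm (M c x) \<ge> L - \<epsilon> \<longrightarrow>
     (\<Sum>n\<in>cop q x. lam2 n / real n * (nrm (M c x - V c x n))\<^sup>2) \<le> 5 * L * \<epsilon> * (ln x)\<^sup>2"
proof -
  obtain C where C: "C \<ge> 0" "\<And>x. x \<ge> 1 \<Longrightarrow> (\<Sum>n\<in>upto_real x. lam2 n / real n) \<le> (ln x)\<^sup>2 + C * (ln x + 1)"
    using sum_lam2_div_le by blast
  obtain K where K: "K \<ge> 0" "\<And>x. x \<ge> 1 \<Longrightarrow> \<bar>(\<Sum>n\<in>upto_real x. lam2 n) - 2 * (x * ln x)\<bar> \<le> K * x"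
    using selberg_ap[of "Suc 0"] by (auto simp: ap_1)
  define f where "f = nrm F"
  have f: "f \<ge> 0" by (simp add: f_def)
  have main: "(\<Sum>n\<in>cop q x. lam2 n / real n * (nrm (M c x - V c x n))\<^sup>2) \<le>
      4 * L * \<epsilon> * (ln x)\<^sup>2 + (f\<^sup>2 * (C + 16 + N0 * (2 + K)) + C * (L + \<epsilon>)\<^sup>2) * (ln x + 1)"
    if x: "x \<ge> 1" and c: "coprime c q" and m: "nrm (M c x) \<ge> L - \<epsilon>" for x c
  proof -
    define l m where "l = ln x" and "m = nrm (M c x)"
    define w where "w = (\<lambda>n. lam2 n / real n)"
    define W where "W = (\<Sum>n\<in>cop q x. w n)"
    define \<Sigma> where "\<Sigma> = (\<Sum>n\<in>cop q x. w n *\<^sub>R V c x n)"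
    have l0: "l \<ge> 0" using x by (simp add: l_def)
    have w0: "w n \<ge> 0" if "n \<in> upto_real x" for n using that lam2_nonneg by (auto simp: w_def upto_real_def)
    have w0c: "w n \<ge> 0" if "n \<in> cop q x" for n using that w0 cop_subset by blast
    have mf: "m \<le> f" "m \<ge> 0" using nrm_M_le[of x c] x by (auto simp: m_def f_def)
    have "(\<Sum>n\<in>cop q x. w n * (nrm (M c x - V c x n))\<^sup>2) =
        W * m\<^sup>2 - 2 * (\<Sum>n\<in>cop q x. ip (M c x) (w n *\<^sub>R V c x n)) + (\<Sum>n\<in>cop q x. w n * (nrm (V c x n))\<^sup>2)"
      unfolding W_def m_def
      by (simp add: nrm_diff_sq ip_scale_right algebra_simps sum.distrib sum_subtractf sum_distrib_left sum_distrib_right)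
    also have "(\<Sum>n\<in>cop q x. ip (M c x) (w n *\<^sub>R V c x n)) = ip (M c x) \<Sigma>" by (simp add: \<Sigma>_def ip_sum_right)
    finally have eq: "(\<Sum>n\<in>cop q x. w n * (nrm (M c x - V c x n))\<^sup>2) =
        W * m\<^sup>2 - 2 * ip (M c x) \<Sigma> + (\<Sum>n\<in>cop q x. w n * (nrm (V c x n))\<^sup>2)" .
    have "W \<le> (\<Sum>n\<in>upto_real x. w n)" unfolding W_def using w0 by (intro sum_mono2 cop_subset) auto
    also have "\<dots> \<le> l\<^sup>2 + C * (l + 1)" using C(2)[OF x] by (simp add: w_def l_def)
    finally have W: "W \<le> l\<^sup>2 + C * (l + 1)" .
    have "ip (M c x) (l\<^sup>2 *\<^sub>R M c x - \<Sigma>) \<le> m * (8 * f * l)"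
    proof -
      have "ip (M c x) (l\<^sup>2 *\<^sub>R M c x - \<Sigma>) \<le> m * nrm (l\<^sup>2 *\<^sub>R M c x - \<Sigma>)" unfolding m_def by (rule cauchy_schwarz)
      also have "\<dots> \<le> m * (8 * f * l)"
        unfolding \<Sigma>_def w_def l_def f_def using average_identity[OF c x] mf by (intro mult_left_mono) auto
      finally show ?thesis .
    qed
    also have "\<dots> \<le> f * (8 * f * l)" using mf f l0 by (intro mult_right_mono) auto
    finally have "ip (M c x) (l\<^sup>2 *\<^sub>R M c x - \<Sigma>) \<le> f * (8 * f * l)" .
    moreover have "ip (M c x) (l\<^sup>2 *\<^sub>R M c x - \<Sigma>) = l\<^sup>2 * m\<^sup>2 - ip (M c x) \<Sigma>"
      by (simp add: ip_diff_right ip_scale_right m_def nrm_sq)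
    ultimately have ipb: "l\<^sup>2 * m\<^sup>2 - 8 * f\<^sup>2 * l \<le> ip (M c x) \<Sigma>"
      by (simp add: power2_eq_square[of f])
    have "(\<Sum>n\<in>cop q x. w n * (nrm (V c x n))\<^sup>2) \<le> (\<Sum>n\<in>cop q x. w n * (L + \<epsilon>)\<^sup>2 + lam2 n * (N0 / x * f\<^sup>2))"
    proof (rule sum_mono)
      fix n assume n: "n \<in> cop q x"
      hence n': "n > 0" "real n \<le> x" "coprime n q" by (auto simp: cop_def)
      have cop: "coprime (c * rinv q n) q" using c n' by (simp add: coprime_rinv)
      have lam: "lam2 n \<ge> 0" using n' by (intro lam2_nonneg)
      show "w n * (nrm (V c x n))\<^sup>2 \<le> w n * (L + \<epsilon>)\<^sup>2 + lam2 n * (N0 / x * f\<^sup>2)"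
      proof (cases "x / real n \<ge> N0")
        case True
        have "(nrm (V c x n))\<^sup>2 \<le> (L + \<epsilon>)\<^sup>2" unfolding nrm_V by (intro power_mono up cop True) simp
        hence "w n * (nrm (V c x n))\<^sup>2 \<le> w n * (L + \<epsilon>)\<^sup>2" using w0c[OF n] by (rule mult_left_mono)
        moreover have "lam2 n * (N0 / x * f\<^sup>2) \<ge> 0" using lam N0 x by simp
        ultimately show ?thesis by linarith
      next
        case False
        \<comment> \<open>When x / n is below N0 only the trivial norm bound is available, but by
          Selberg's formula such n have total weight O(ln x).\<close>
        have "1 / real n \<le> N0 / x" using False n' x by (simp add: field_simps)
        hence "w n \<le> lam2 n * (N0 / x)" unfolding w_def using lam mult_left_mono[of "1 / real n" "N0 / x" "lam2 n"] by simp
        moreover have "(nrm (V c x n))\<^sup>2 \<le> f\<^sup>2" unfolding nrm_V f_def using n' x by (intro power_mono nrm_M_le) auto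
        ultimately have "w n * (nrm (V c x n))\<^sup>2 \<le> lam2 n * (N0 / x) * f\<^sup>2"
          using lam N0 x by (intro mult_mono) auto
        moreover have "w n * (L + \<epsilon>)\<^sup>2 \<ge> 0" using w0c[OF n] by simp
        ultimately show ?thesis by (simp add: mult_ac)
      qed
    qed
    also have "\<dots> = W * (L + \<epsilon>)\<^sup>2 + (\<Sum>n\<in>cop q x. lam2 n) * (N0 / x * f\<^sup>2)"
      by (simp only: sum.distrib W_def sum_distrib_right)
    also have "(\<Sum>n\<in>cop q x. lam2 n) * (N0 / x * f\<^sup>2) \<le> (2 * (x * l) + K * x) * (N0 / x * f\<^sup>2)"
    proof (rule mult_right_mono)
      have "(\<Sum>n\<in>cop q x. lam2 n) \<le> (\<Sum>n\<in>upto_real x. lam2 n)"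
        by (intro sum_mono2 cop_subset finite_upto_real) (auto simp: upto_real_def intro!: lam2_nonneg)
      also have "\<dots> \<le> 2 * (x * l) + K * x" using K(2)[OF x] by (simp add: l_def)
      finally show "(\<Sum>n\<in>cop q x. lam2 n) \<le> 2 * (x * l) + K * x" .
    qed (use N0 x in auto)
    also have "\<dots> = N0 * f\<^sup>2 * (2 * l + K)" using x by (simp add: field_simps)
    also have "\<dots> \<le> N0 * f\<^sup>2 * ((2 + K) * (l + 1))"
      using N0 K l0 by (intro mult_left_mono) (auto simp: algebra_simps)
    finally have Vb: "(\<Sum>n\<in>cop q x. w n * (nrm (V c x n))\<^sup>2) \<le> W * (L + \<epsilon>)\<^sup>2 + N0 * f\<^sup>2 * ((2 + K) * (l + 1))" by simp
    have W1: "W * m\<^sup>2 \<le> l\<^sup>2 * m\<^sup>2 + C * (l + 1) * f\<^sup>2"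
    proof -
      have "W * m\<^sup>2 \<le> (l\<^sup>2 + C * (l + 1)) * m\<^sup>2" using W by (rule mult_right_mono) simp
      moreover have "C * (l + 1) * m\<^sup>2 \<le> C * (l + 1) * f\<^sup>2" using C(1) l0 mf by (intro mult_left_mono power_mono) auto
      ultimately show ?thesis by (simp add: distrib_right)
    qed
    have W2: "W * (L + \<epsilon>)\<^sup>2 \<le> l\<^sup>2 * (L + \<epsilon>)\<^sup>2 + C * (l + 1) * (L + \<epsilon>)\<^sup>2"
      using mult_right_mono[OF W, of "(L + \<epsilon>)\<^sup>2"] by (simp add: distrib_right)
    have "(L - \<epsilon>)\<^sup>2 \<le> m\<^sup>2" using m L by (intro power_mono) (auto simp: m_def)
    hence "(L + \<epsilon>)\<^sup>2 - m\<^sup>2 \<le> 4 * L * \<epsilon>" by (simp add: power2_sum power2_diff)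
    hence "l\<^sup>2 * ((L + \<epsilon>)\<^sup>2 - m\<^sup>2) \<le> l\<^sup>2 * (4 * L * \<epsilon>)" by (rule mult_left_mono) simp
    hence W3: "l\<^sup>2 * (L + \<epsilon>)\<^sup>2 - l\<^sup>2 * m\<^sup>2 \<le> 4 * L * \<epsilon> * l\<^sup>2" by (simp add: algebra_simps)
    have W4: "16 * f\<^sup>2 * l \<le> 16 * f\<^sup>2 * (l + 1)" by (intro mult_left_mono) auto
    have "(\<Sum>n\<in>cop q x. w n * (nrm (M c x - V c x n))\<^sup>2) \<le>
       4 * L * \<epsilon> * l\<^sup>2 + C * (l + 1) * f\<^sup>2 + 16 * f\<^sup>2 * (l + 1) + C * (l + 1) * (L + \<epsilon>)\<^sup>2 + N0 * f\<^sup>2 * ((2 + K) * (l + 1))"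
      unfolding eq using ipb Vb W1 W2 W3 W4 by linarith
    also have "\<dots> = 4 * L * \<epsilon> * l\<^sup>2 + (f\<^sup>2 * (C + 16 + N0 * (2 + K)) + C * (L + \<epsilon>)\<^sup>2) * (l + 1)"
      by (simp add: algebra_simps)
    finally show ?thesis by (simp add: w_def l_def)
  qed
  define A where "A = f\<^sup>2 * (C + 16 + N0 * (2 + K)) + C * (L + \<epsilon>)\<^sup>2"
  have pos: "L * \<epsilon> > 0" using L by simp
  have A: "A \<ge> 0" using C K N0 by (simp add: A_def)
  have "(\<Sum>n\<in>cop q x. lam2 n / real n * (nrm (M c x - V c x n))\<^sup>2) \<le> 5 * L * \<epsilon> * (ln x)\<^sup>2"
    if x: "x \<ge> exp (1 + 2 * A / (L * \<epsilon>))" and c: "coprime c q" and m: "nrm (M c x) \<ge> L - \<epsilon>" for x c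
  proof -
    have "exp (1 + 2 * A / (L * \<epsilon>)) \<ge> 1" using A pos by simp
    hence x1: "x \<ge> 1" using x by linarith
    have l: "1 + 2 * A / (L * \<epsilon>) \<le> ln x" using x x1 by (simp add: ln_ge_iff)
    have "2 * A / (L * \<epsilon>) \<ge> 0" using A pos by simp
    with l have l1: "ln x \<ge> 1" "2 * A / (L * \<epsilon>) \<le> ln x" by linarith+
    have "A * (ln x + 1) \<le> A * (2 * ln x)" using A l1 by (intro mult_left_mono) auto
    also have "\<dots> = (2 * A / (L * \<epsilon>)) * (L * \<epsilon> * ln x)" using L by simp
    also have "\<dots> \<le> ln x * (L * \<epsilon> * ln x)" using l1 pos by (intro mult_right_mono) auto
    finally have "A * (ln x + 1) \<le> L * \<epsilon> * (ln x)\<^sup>2" by (simp add: power2_eq_square mult_ac)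
    thus ?thesis using main[OF x1 c m] unfolding A_def[symmetric] by linarith
  qed
  moreover have "exp (1 + 2 * A / (L * \<epsilon>)) \<ge> 1" using A pos by simp
  ultimately show ?thesis by blast
qed

end

section \<open>A two-valued type of residue classes and its character\<close>

lemma rinv_div_cong:
  assumes "q > 0" "coprime c q" "coprime b q"
  shows "[c * rinv q (c * rinv q b) = b] (mod q)"
proof -
  have "[b * (c * rinv q b) = c] (mod q)" using cong_rinv_iff[OF assms(3,1)] by simp
  hence "[(c * rinv q b) * b = c] (mod q)" by (simp add: mult_ac)
  hence "[b = c * rinv q (c * rinv q b)] (mod q)"
    using cong_rinv_iff[of "c * rinv q b" q b c] assms by (simp add: coprime_rinv)
  thus ?thesis by (rule cong_sym)
qed

text \<open>Multiplication by a unit h permutes the unit classes and by \<open>P_mult\<close>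
  respects the partition into two nonempty types, so it either keeps or exchanges them. The sign of
  this action is \<psi>, and s is the sign of the type of 1.\<close>

lemma type_character:
  fixes P :: "nat \<Rightarrow> bool"
  assumes q: "q > 0"
    and P_cong: "\<And>g g'. [g = g'] (mod q) \<Longrightarrow> P g = P g'"
    and P_mult: "\<And>g g' h. coprime g q \<Longrightarrow> coprime g' q \<Longrightarrow> coprime h q \<Longrightarrow> P g = P g' \<Longrightarrow> P (g * h) = P (g' * h)"
    and ex: "coprime u q" "P u" "coprime v q" "\<not> P v"
  shows "\<exists>\<psi> s. real_char q \<psi> \<and> \<bar>s\<bar> = 1 \<and> (\<forall>g. coprime g q \<longrightarrow> (if P g then 1 else - 1 :: real) = s * \<psi> g)"
proof -
  define \<sigma> where "\<sigma> = (\<lambda>g. if P g then 1 else - 1 :: real)"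
  have \<sigma>: "\<sigma> g = 1 \<or> \<sigma> g = - 1" for g by (simp add: \<sigma>_def)
  have \<sigma>_cong: "\<sigma> g = \<sigma> g'" if "[g = g'] (mod q)" for g g' using P_cong[OF that] by (simp add: \<sigma>_def)
  define \<psi> where "\<psi> = (\<lambda>h. if coprime h q then \<sigma> h * \<sigma> 1 else 0)"
  \<comment> \<open>If classes of different types were sent to one type, multiplication by h would
    send every unit class there; being onto, it would leave only one type.\<close>
  have sep: "P (g * h) \<noteq> P (g' * h)" if "coprime g q" "coprime g' q" "coprime h q" "P g \<noteq> P g'" for g g' h
  proof
    assume eq: "P (g * h) = P (g' * h)"
    have all: "P (b * h) = P (g * h)" if "coprime b q" for b
      using P_mult[of b g h] P_mult[of b g' h] that \<open>coprime g q\<close> \<open>coprime g' q\<close> \<open>coprime h q\<close> \<open>P g \<noteq> P g'\<close> eq by blast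
    have "P b = P (g * h)" if b: "coprime b q" for b
    proof -
      have "[h * (b * rinv q h) = b] (mod q)" using cong_rinv_iff[OF \<open>coprime h q\<close> q] by simp
      hence "P b = P ((b * rinv q h) * h)" using P_cong by (metis mult.commute)
      also have "\<dots> = P (g * h)" using b \<open>coprime h q\<close> by (intro all) (simp add: coprime_rinv)
      finally show ?thesis .
    qed
    with ex show False by metis
  qed
  have \<sigma>_mult: "\<sigma> (g * h) = \<sigma> g * \<psi> h" if "coprime g q" "coprime h q" for g h
  proof (cases "P g = P 1")
    case True
    thus ?thesis using P_mult[of g 1 h] that \<sigma>[of 1] by (auto simp: \<sigma>_def \<psi>_def)
  next
    case False
    thus ?thesis using sep[of g 1 h] that \<sigma>[of 1] by (auto simp: \<sigma>_def \<psi>_def)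
  qed
  have copmult: "coprime (m * n) q \<longleftrightarrow> coprime m q \<and> coprime n q" for m n :: nat by simp
  have mult: "\<psi> (m * n) = \<psi> m * \<psi> n" for m n
  proof (cases "coprime m q \<and> coprime n q")
    case True
    hence "\<psi> (m * n) = \<sigma> m * \<psi> n * \<sigma> 1" using \<sigma>_mult[of m n] by (simp add: \<psi>_def)
    thus ?thesis using True by (simp add: \<psi>_def)
  next
    case False
    thus ?thesis by (auto simp: \<psi>_def)
  qed
  have cong: "\<psi> m = \<psi> n" if "[m = n] (mod q)" for m n
  proof -
    have "coprime m q = coprime n q" using that cong_imp_coprime cong_sym by blast
    thus ?thesis using \<sigma>_cong[OF that] by (simp add: \<psi>_def)
  qed
  have unimod: "\<psi> n = 1 \<or> \<psi> n = - 1" if "coprime n q" for n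
    using \<sigma>[of n] \<sigma>[of 1] that by (auto simp: \<psi>_def)
  have "(\<Sum>i<q. \<psi> i) = 0"
  proof -
    have "\<exists>h. coprime h q \<and> \<psi> h = - 1"
    proof (cases "P 1")
      case True
      thus ?thesis using ex by (intro exI[of _ v]) (auto simp: \<psi>_def \<sigma>_def)
    next
      case False
      thus ?thesis using ex by (intro exI[of _ u]) (auto simp: \<psi>_def \<sigma>_def)
    qed
    then obtain h where h: "coprime h q" "\<psi> h = - 1" by blast
    have inv: "[h * rinv q h = 1] (mod q)" by (rule rinv_cong[OF h(1) q])
    \<comment> \<open>Multiplication by h permutes the residues and changes the sign of every \<psi>
      i, so the sum equals its own negative.\<close>
    have "(\<Sum>i<q. \<psi> i) = (\<Sum>i<q. \<psi> (h * i mod q))"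
    proof (rule sum.reindex_bij_witness[of _ "\<lambda>i. h * i mod q" "\<lambda>i. rinv q h * i mod q"])
      fix i assume "i \<in> {..<q}"
      have "[h * (rinv q h * i mod q) = h * rinv q h * i] (mod q)"
        unfolding mult.assoc by (intro cong_mult cong_refl) (simp add: cong_def)
      also have "[h * rinv q h * i = 1 * i] (mod q)" by (intro cong_mult inv cong_refl)
      finally show 1: "h * (rinv q h * i mod q) mod q = i" using \<open>i \<in> {..<q}\<close> by (simp add: cong_def)
      show "\<psi> (h * (rinv q h * i mod q) mod q) = \<psi> i" by (simp only: 1)
      have "[rinv q h * (h * i mod q) = h * rinv q h * i] (mod q)"
        by (simp add: cong_def mod_mult_right_eq mult_ac)
      also have "[h * rinv q h * i = 1 * i] (mod q)" by (intro cong_mult inv cong_refl)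
      finally show "rinv q h * (h * i mod q) mod q = i" using \<open>i \<in> {..<q}\<close> by (simp add: cong_def)
    qed (use q in auto)
    also have "\<dots> = (\<Sum>i<q. \<psi> h * \<psi> i)" by (intro sum.cong refl) (simp add: cong[of "h * _ mod q" "h * _"] cong_def mult[symmetric])
    also have "\<dots> = - (\<Sum>i<q. \<psi> i)" by (simp add: h(2) sum_negf)
    finally show ?thesis by simp
  qed
  with q mult cong unimod have "real_char q \<psi>" by unfold_locales (auto simp: \<psi>_def)
  moreover have "\<bar>\<sigma> 1\<bar> = 1" using \<sigma>[of 1] by auto
  moreover have "\<forall>g. coprime g q \<longrightarrow> (if P g then 1 else - 1) = \<sigma> 1 * \<psi> g"
    using \<sigma>[of 1] by (auto simp: \<psi>_def \<sigma>_def)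
  ultimately show ?thesis by blast
qed

section \<open>Windows carrying little bad mass\<close>

definition intv :: "real \<Rightarrow> real \<Rightarrow> nat set" where
  "intv y z = {n. y < real n \<and> real n \<le> z}"

lemma finite_intv [simp, intro]: "finite (intv y z)"
proof (rule finite_subset)
  show "intv y z \<subseteq> insert 0 (upto_real z)" by (auto simp: intv_def upto_real_def)
qed simp

text \<open>Pigeonhole over the floor (l / (4 D)) \<ge> l / (8 D) disjoint windows of logarithmic
  length D which fit between x^(1/4) and x^(1/2), where l = ln x. The lower end keeps ln Y
  comparable with ln x; the upper end keeps x / n \<ge> sqrt x, so that averages at x / n vary
  slowly.\<close>

lemma light_window:
  fixes \<beta> :: "nat \<Rightarrow> real"
  assumes D: "D > 0" and x: "x \<ge> 1" "ln x \<ge> 8 * D"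
    and \<beta>: "\<And>n. n > 0 \<Longrightarrow> \<beta> n \<ge> 0" "(\<Sum>n\<in>upto_real x. \<beta> n) \<le> B"
  shows "\<exists>Y>0. ln x / 4 \<le> ln Y \<and> ln Y + D \<le> ln x / 2 \<and> (\<Sum>n\<in>intv Y (exp D * Y). \<beta> n) \<le> 8 * D * B / ln x"
proof (rule ccontr)
  define l where "l = ln x"
  have l: "l \<ge> 8 * D" using x by (simp add: l_def)
  with D have l0: "l > 0" by linarith
  note l = l l0
  define m where "m = nat \<lfloor>l / (4 * D)\<rfloor>"
  have q2: "l / (4 * D) \<ge> 2" using l D by (simp add: field_simps)
  have m: "real m \<le> l / (4 * D)" "real m \<ge> l / (4 * D) - 1" "m \<ge> 1"
    using q2 by (auto simp: m_def) linarith+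
  have m2: "real m \<ge> l / (8 * D)" using m q2 by (simp add: field_simps)
  define Y where "Y = (\<lambda>k. exp (l / 4 + real k * D))"
  assume "\<not> ?thesis"
  hence big: "(\<Sum>n\<in>intv Y (exp D * Y). \<beta> n) > 8 * D * B / l" if "Y > 0" "l / 4 \<le> ln Y" "ln Y + D \<le> l / 2" for Y
    using that unfolding l_def by (meson not_le)
  have YS: "exp D * Y k = Y (Suc k)" for k by (simp add: Y_def algebra_simps flip: exp_add)
  have bigk: "(\<Sum>n\<in>intv (Y k) (Y (Suc k)). \<beta> n) > 8 * D * B / l" if "k < m" for k
  proof -
    have "(real k + 1) * D \<le> real m * D" using that D by (intro mult_right_mono) auto
    also have "\<dots> \<le> l / (4 * D) * D" using m D by (intro mult_right_mono) auto
    also have "\<dots> = l / 4" using D by simp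
    finally have "ln (Y k) + D \<le> l / 2" by (simp add: Y_def algebra_simps)
    thus ?thesis using big[of "Y k"] D unfolding YS by (simp add: Y_def)
  qed
  have Ymono: "Y i \<le> Y j" if "i \<le> j" for i j using that D by (simp add: Y_def mult_right_mono)
  have Ym: "Y m \<le> x"
  proof -
    have "real m * D \<le> l / (4 * D) * D" using m D by (intro mult_right_mono) auto
    hence "l / 4 + real m * D \<le> l" using D l by simp
    hence "Y m \<le> exp l" by (simp add: Y_def)
    thus ?thesis using x by (simp add: l_def)
  qed
  have B0: "B \<ge> 0" using \<beta> sum_nonneg[of "upto_real x" \<beta>] by (force simp: upto_real_def)
  have "B \<le> real m * (8 * D * B / l)"
  proof -
    have "l / (8 * D) * (8 * D * B / l) \<le> real m * (8 * D * B / l)" using m2 B0 D l by (intro mult_right_mono) auto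
    thus ?thesis using D l by simp
  qed
  also have "\<dots> = (\<Sum>k<m. 8 * D * B / l)" by simp
  also have "\<dots> < (\<Sum>k<m. \<Sum>n\<in>intv (Y k) (Y (Suc k)). \<beta> n)"
    using m(3) bigk by (intro sum_strict_mono) (auto simp: lessThan_empty_iff)
  also have "\<dots> = (\<Sum>n\<in>(\<Union>k<m. intv (Y k) (Y (Suc k))). \<beta> n)"
  proof (rule sum.UNION_disjoint[symmetric])
    show "\<forall>i\<in>{..<m}. \<forall>j\<in>{..<m}. i \<noteq> j \<longrightarrow> intv (Y i) (Y (Suc i)) \<inter> intv (Y j) (Y (Suc j)) = {}"
    proof (intro ballI impI)
      fix i j :: nat assume "i \<noteq> j"
      then consider "Suc i \<le> j" | "Suc j \<le> i" by linarith
      thus "intv (Y i) (Y (Suc i)) \<inter> intv (Y j) (Y (Suc j)) = {}"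
        by cases (auto simp: intv_def dest!: Ymono)
    qed
  qed auto
  also have "\<dots> \<le> (\<Sum>n\<in>upto_real x. \<beta> n)"
  proof (rule sum_mono2)
    show "(\<Union>k<m. intv (Y k) (Y (Suc k))) \<subseteq> upto_real x"
    proof safe
      fix k n assume k: "k < m" and n: "n \<in> intv (Y k) (Y (Suc k))"
      have "0 < Y k" by (simp add: Y_def)
      with n have "real n > 0" by (auto simp: intv_def)
      moreover have "real n \<le> x" using n Ymono[of "Suc k" m] k Ym by (auto simp: intv_def)
      ultimately show "n \<in> upto_real x" by (simp add: upto_real_def)
    qed
    show "\<beta> n \<ge> 0" if "n \<in> upto_real x - (\<Union>k<m. intv (Y k) (Y (Suc k)))" for n
      using that by (intro \<beta>) (simp add: upto_real_def)
  qed simp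
  finally show False using \<beta>(2) by simp
qed

context mult_average
begin

text \<open>The part of lam2 n / n that says nothing about M c x. The prime part and the product
  part are tested separately against a n = 1 and a n = 2, because a prime power may carry
  both.\<close>

definition bad :: "nat \<Rightarrow> real \<Rightarrow> real \<Rightarrow> nat \<Rightarrow> real" where
  "bad c x tol n =
     (if a n = 1 \<and> nrm (M c x - V c x n) \<le> tol then 0 else mangoldt n * ln (real n) / real n) +
     (if a n = 2 \<and> nrm (M c x - V c x n) \<le> tol then 0 else lam_conv n / real n)"

lemma bad_nonneg: "n > 0 \<Longrightarrow> bad c x tol n \<ge> 0"
  by (auto simp: bad_def lam_conv_nonneg mangoldt_nonneg intro!: add_nonneg_nonneg)

text \<open>Integers with V far from M are handled by Chebyshev's inequality, giving \<kappa> /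
  tol^2. With E the exceptional mass of \<Lambda>(n) / n, the prime part with a n \<noteq> 1 costs E
  ln x. In the product part a n \<noteq> 2 forces an exceptional factor, which costs at most 2 E
  times 2 ln x. Hence 5 E ln x in total, and the choice \<eta> / 5.\<close>

lemma bad_sum_bound:
  assumes tol: "tol > 0" and \<eta>: "\<eta> > 0"
  shows "\<exists>X\<ge>1. \<forall>x\<ge>X. \<forall>c \<kappa>. (\<Sum>n\<in>cop q x. lam2 n / real n * (nrm (M c x - V c x n))\<^sup>2) \<le> \<kappa> * (ln x)\<^sup>2 \<longrightarrow>
     (\<Sum>n\<in>cop q x. bad c x tol n) \<le> (\<kappa> / tol\<^sup>2 + \<eta>) * (ln x)\<^sup>2"
proof -
  obtain C where C: "C \<ge> 0" "\<And>x. x \<ge> 1 \<Longrightarrow> \<bar>(\<Sum>n\<in>upto_real x. mangoldt n / real n) - ln x\<bar> \<le> C"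
    using sum_mangoldt_div by blast
  obtain X where X: "X \<ge> 1" "\<And>x. x \<ge> X \<Longrightarrow> (\<Sum>n | n \<in> upto_real x \<and> a n \<noteq> 1. mangoldt n / real n) \<le> \<eta> / 5 * ln x"
    using exceptional[of "\<eta> / 5"] \<eta> by auto
  have "(\<Sum>n\<in>cop q x. bad c x tol n) \<le> (\<kappa> / tol\<^sup>2 + \<eta>) * (ln x)\<^sup>2"
    if x: "x \<ge> max X (exp C)" and D: "(\<Sum>n\<in>cop q x. lam2 n / real n * (nrm (M c x - V c x n))\<^sup>2) \<le> \<kappa> * (ln x)\<^sup>2" for x c \<kappa>
  proof -
    define l where "l = ln x"
    have x1: "x \<ge> 1" using x X by simp
    have l: "l \<ge> C" using x x1 by (simp add: l_def ln_ge_iff)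
    define E where "E = (\<Sum>n | n \<in> upto_real x \<and> a n \<noteq> 1. mangoldt n / real n)"
    define e where "e = (\<lambda>n. if a n \<noteq> 1 then mangoldt n / real n else 0 :: real)"
    define f where "f = (\<lambda>n. mangoldt n / real n :: real)"
    have f0: "f n \<ge> 0" "e n \<ge> 0" for n by (auto simp: f_def e_def mangoldt_nonneg)
    have E: "E \<le> \<eta> / 5 * l" "E = (\<Sum>n\<in>upto_real x. e n)"
      using X(2)[of x] x by (auto simp: E_def l_def e_def sum.inter_filter)
    have E0: "E \<ge> 0" unfolding E(2) by (intro sum_nonneg f0)
    have f: "(\<Sum>n\<in>upto_real x. f n) \<le> 2 * l" using C(2)[OF x1] l by (simp add: f_def l_def)
    have "(\<Sum>n\<in>cop q x. bad c x tol n) \<le> (\<Sum>n\<in>cop q x. lam2 n / real n * (nrm (M c x - V c x n))\<^sup>2 / tol\<^sup>2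
        + (if a n \<noteq> 1 then mangoldt n * ln (real n) / real n else 0) + (if a n \<noteq> 2 then lam_conv n / real n else 0))"
    proof (rule sum_mono)
      fix n assume "n \<in> cop q x"
      hence n: "n > 0" by (simp add: cop_def)
      define d where "d = nrm (M c x - V c x n)"
      have nn: "mangoldt n * ln (real n) / real n \<ge> 0" "lam_conv n / real n \<ge> 0"
        using n by (auto simp: lam_conv_nonneg mangoldt_nonneg)
      have lam: "lam2 n / real n = mangoldt n * ln (real n) / real n + lam_conv n / real n"
        by (simp add: lam2_def add_divide_distrib)
      show "bad c x tol n \<le> lam2 n / real n * (nrm (M c x - V c x n))\<^sup>2 / tol\<^sup>2
        + (if a n \<noteq> 1 then mangoldt n * ln (real n) / real n else 0) + (if a n \<noteq> 2 then lam_conv n / real n else 0)"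
      proof (cases "d \<le> tol")
        case True
        have "0 \<le> lam2 n / real n * d\<^sup>2 / tol\<^sup>2" using nn lam by simp
        thus ?thesis using True unfolding bad_def d_def[symmetric] by simp
      next
        case False
        have "tol\<^sup>2 \<le> d\<^sup>2" using False tol by (intro power_mono) auto
        hence "lam2 n / real n * 1 \<le> lam2 n / real n * (d\<^sup>2 / tol\<^sup>2)"
          using tol nn lam by (intro mult_left_mono) (auto simp: field_simps)
        thus ?thesis using False nn lam unfolding bad_def d_def[symmetric] by simp
      qed
    qed
    also have "\<dots> = (\<Sum>n\<in>cop q x. lam2 n / real n * (nrm (M c x - V c x n))\<^sup>2) / tol\<^sup>2
        + (\<Sum>n\<in>cop q x. if a n \<noteq> 1 then mangoldt n * ln (real n) / real n else 0)
        + (\<Sum>n\<in>cop q x. if a n \<noteq> 2 then lam_conv n / real n else 0)"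
      by (simp only: sum.distrib sum_divide_distrib)
    also have "(\<Sum>n\<in>cop q x. lam2 n / real n * (nrm (M c x - V c x n))\<^sup>2) / tol\<^sup>2 \<le> \<kappa> * l\<^sup>2 / tol\<^sup>2"
      using D unfolding l_def by (rule divide_right_mono) simp
    also have "(\<Sum>n\<in>cop q x. if a n \<noteq> 1 then mangoldt n * ln (real n) / real n else 0) \<le> (\<Sum>n\<in>cop q x. e n * l)"
    proof (rule sum_mono)
      fix n assume n: "n \<in> cop q x"
      have "ln (real n) \<le> l" using n x1 by (auto simp: cop_def l_def)
      hence "mangoldt n / real n * ln (real n) \<le> mangoldt n / real n * l" by (intro mult_left_mono) (auto simp: mangoldt_nonneg)
      thus "(if a n \<noteq> 1 then mangoldt n * ln (real n) / real n else 0) \<le> e n * l" by (simp add: e_def)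
    qed
    also have "\<dots> \<le> (\<Sum>n\<in>upto_real x. e n * l)"
      by (intro sum_mono2 cop_subset finite_upto_real mult_nonneg_nonneg f0) (use x1 in \<open>auto simp: l_def\<close>)
    also have "\<dots> = E * l" by (simp add: E(2) sum_distrib_right)
    also have "(\<Sum>n\<in>cop q x. if a n \<noteq> 2 then lam_conv n / real n else 0) \<le>
        (\<Sum>n\<in>upto_real x. if a n \<noteq> 2 then lam_conv n / real n else 0)"
      by (intro sum_mono2 cop_subset finite_upto_real) (auto simp: lam_conv_nonneg)
    also have "\<dots> \<le> (\<Sum>n\<in>upto_real x. \<Sum>d | d dvd n. e d * f (n div d) + f d * e (n div d))"
    proof (rule sum_mono)
      fix n assume "n \<in> upto_real x"
      hence n: "n > 0" by (simp add: upto_real_def)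
      show "(if a n \<noteq> 2 then lam_conv n / real n else 0) \<le> (\<Sum>d | d dvd n. e d * f (n div d) + f d * e (n div d))"
      proof (cases "a n = 2")
        case True
        thus ?thesis by (auto intro!: sum_nonneg add_nonneg_nonneg mult_nonneg_nonneg f0)
      next
        case False
        have "lam_conv n / real n \<le> (\<Sum>d | d dvd n. e d * f (n div d) + f d * e (n div d))"
          unfolding lam_conv_def sum_divide_distrib
        proof (rule sum_mono)
          fix d assume "d \<in> {d. d dvd n}"
          then obtain k where k: "n = d * k" by blast
          with n have pos: "d > 0" "k > 0" by auto
          have "a d \<noteq> 1 \<or> a k \<noteq> 1" using False additive[OF pos] k by auto
          moreover have "mangoldt d * mangoldt (n div d) / real n = f d * f k" using pos k by (simp add: f_def)
          moreover have "e d * f k \<ge> 0" "f d * e k \<ge> 0" by (intro mult_nonneg_nonneg f0)+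
          ultimately show "mangoldt d * mangoldt (n div d) / real n \<le> e d * f (n div d) + f d * e (n div d)"
            using pos k by (auto simp: e_def f_def mult.commute)
        qed
        thus ?thesis using False by simp
      qed
    qed
    also have "\<dots> = (\<Sum>d\<in>upto_real x. \<Sum>m\<in>upto_real (x / real d). e d * f m + f d * e m)"
      by (rule sum_divisors_upto)
    also have "\<dots> \<le> (\<Sum>d\<in>upto_real x. \<Sum>m\<in>upto_real x. e d * f m + f d * e m)"
    proof (intro sum_mono sum_mono2 finite_upto_real add_nonneg_nonneg mult_nonneg_nonneg f0)
      fix d assume "d \<in> upto_real x"
      hence "x / real d \<le> x / 1" using x1 by (intro divide_left_mono) (auto simp: upto_real_def)
      thus "upto_real (x / real d) \<subseteq> upto_real x" by (auto simp: upto_real_def)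
    qed
    also have "\<dots> = 2 * (E * (\<Sum>n\<in>upto_real x. f n))"
      unfolding E(2) sum.distrib sum_product[symmetric] by (simp add: mult.commute)
    also have "\<dots> \<le> 2 * (E * (2 * l))" using f E0 by (intro mult_left_mono) auto
    finally have "(\<Sum>n\<in>cop q x. bad c x tol n) \<le> \<kappa> * l\<^sup>2 / tol\<^sup>2 + 5 * (E * l)" by simp
    also have "E * l \<le> \<eta> / 5 * l * l" using E(1) x1 by (intro mult_right_mono) (auto simp: l_def)
    finally show ?thesis by (simp add: l_def algebra_simps power2_eq_square)
  qed
  moreover have "max X (exp C) \<ge> 1" using X by simp
  ultimately show ?thesis by blast
qed

end

section \<open>Cutting a window into short intervals and residue classes\<close>

lemma sum_apI_split:
  fixes h :: "nat \<Rightarrow> real"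
  assumes "Y > 0" "\<delta> \<ge> 0"
  shows "(\<Sum>j<R. \<Sum>n\<in>apI q g (exp (real j * \<delta>) * Y) (exp \<delta> * (exp (real j * \<delta>) * Y)). h n) =
         (\<Sum>n\<in>apI q g Y (exp (real R * \<delta>) * Y). h n)"
proof (induction R)
  case 0
  have "apI q g Y Y = {}" by (auto simp: apI_def)
  thus ?case by simp
next
  case (Suc R)
  define y z where "y = exp (real R * \<delta>) * Y" and "z = exp (real (Suc R) * \<delta>) * Y"
  have z: "exp \<delta> * y = z" by (simp add: y_def z_def algebra_simps flip: exp_add)
  have "Y \<le> y" "y \<le> z" using assms by (auto simp: y_def z_def mult_right_mono)
  hence "apI q g Y z = apI q g Y y \<union> apI q g y z" by (auto simp: apI_def)
  moreover have "apI q g Y y \<inter> apI q g y z = {}" by (auto simp: apI_def)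
  ultimately have "(\<Sum>n\<in>apI q g Y z. h n) = (\<Sum>n\<in>apI q g Y y. h n) + (\<Sum>n\<in>apI q g y z. h n)"
    by (simp add: sum.union_disjoint)
  thus ?case using Suc unfolding y_def[symmetric] z_def[symmetric] by (simp add: z y_def[symmetric])
qed

lemma sum_res_apI:
  fixes h :: "nat \<Rightarrow> real"
  assumes "q > 0"
  shows "(\<Sum>g\<in>res q. \<Sum>n\<in>apI q g Y Z. h n) = (\<Sum>n | n \<in> intv Y Z \<and> coprime n q. h n)"
proof -
  have "{n. n \<in> intv Y Z \<and> coprime n q} = (\<Union>g\<in>res q. apI q g Y Z)"
  proof safe
    fix n assume n: "n \<in> intv Y Z" "coprime n q"
    have "n mod q \<in> res q" using n assms by (simp add: res_def)
    moreover have "n \<in> apI q (n mod q) Y Z" using n by (simp add: apI_def intv_def cong_def)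
    ultimately show "n \<in> (\<Union>g\<in>res q. apI q g Y Z)" by blast
  next
    fix n g assume gn: "g \<in> res q" "n \<in> apI q g Y Z"
    thus "n \<in> intv Y Z" by (simp add: apI_def intv_def)
    have "[g = n] (mod q)" "coprime g q" using gn by (auto simp: apI_def res_def cong_sym)
    thus "coprime n q" by (rule cong_imp_coprime)
  qed
  moreover have "(\<Sum>n\<in>(\<Union>g\<in>res q. apI q g Y Z). h n) = (\<Sum>g\<in>res q. \<Sum>n\<in>apI q g Y Z. h n)"
  proof (rule sum.UNION_disjoint)
    show "\<forall>i\<in>res q. \<forall>j\<in>res q. i \<noteq> j \<longrightarrow> apI q i Y Z \<inter> apI q j Y Z = {}"
    proof (intro ballI impI)
      fix i j assume ij: "i \<in> res q" "j \<in> res q" "i \<noteq> j"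
      have "i mod q \<noteq> j mod q" using ij by (simp add: res_def)
      thus "apI q i Y Z \<inter> apI q j Y Z = {}" by (auto simp: apI_def cong_def)
    qed
  qed auto
  ultimately show ?thesis by simp
qed

lemma apI_cong: "[g = g'] (mod q) \<Longrightarrow> apI q g y z = apI q g' y z"
  by (auto simp: apI_def intro: cong_trans cong_sym)

lemma sum_upto_diff:
  fixes h :: "nat \<Rightarrow> real"
  assumes "1 \<le> Y" "Y \<le> Z"
  shows "(\<Sum>n\<in>intv Y Z. h n) = (\<Sum>n\<in>upto_real Z. h n) - (\<Sum>n\<in>upto_real Y. h n)"
proof -
  have "intv Y Z = upto_real Z - upto_real Y" "upto_real Y \<subseteq> upto_real Z"
    using assms by (auto simp: intv_def upto_real_def intro!: Nat.gr0I)
  thus ?thesis by (simp add: sum_diff)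
qed

context mult_average
begin

lemma V_cong: "[c = c'] (mod q) \<Longrightarrow> V c x n = V c' x n"
  unfolding V_def by (intro arg_cong[of _ _ "U (a n)"] M_cong cong_mult) auto

lemma bad_cong: "[c = c'] (mod q) \<Longrightarrow> bad c x tol n = bad c' x tol n"
  by (simp add: bad_def V_cong[of c c'] M_cong[of c c'])

text \<open>One and the same window serves all base classes in \<open>Cs\<close>; this is what
  allows averages of different classes to be compared.\<close>

definition light :: "real \<Rightarrow> real \<Rightarrow> real \<Rightarrow> real \<Rightarrow> nat set \<Rightarrow> real \<Rightarrow> bool" where
  "light D tol \<theta> x Cs Y \<longleftrightarrow> Y > 0 \<and> ln x / 4 \<le> ln Y \<and> ln Y + D \<le> ln x / 2 \<and>
     (\<forall>c\<in>Cs. (\<Sum>n | n \<in> intv Y (exp D * Y) \<and> coprime n q. bad c x tol n) \<le> \<theta> * ln x)"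

lemma good_window:
  assumes L: "L > 0"
    and up: "\<And>\<epsilon>. \<epsilon> > 0 \<Longrightarrow> \<exists>N0\<ge>1. \<forall>c y. coprime c q \<longrightarrow> y \<ge> N0 \<longrightarrow> nrm (M c y) \<le> L + \<epsilon>"
    and tol: "tol > 0" and D: "D > 0" and \<theta>: "\<theta> > 0"
  shows "\<exists>\<epsilon>>0. \<exists>X0\<ge>1. \<forall>x\<ge>X0. \<forall>Cs\<subseteq>res q. (\<forall>c\<in>Cs. nrm (M c x) \<ge> L - \<epsilon>) \<longrightarrow>
    (\<exists>Y. light D tol \<theta> x Cs Y)"
proof -
  have phi: "phi q \<ge> 1" by (rule phi_ge_1[OF q])
  \<comment> \<open>At most phi q base classes with bad mass 2 \<eta> (ln x)^2 each give \<theta>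
    (ln x)^2 / (8 D), which \<open>light_window\<close> turns into \<theta> ln x. Below, \<epsilon>
    is chosen to push the variance term under \<eta>.\<close>
  define \<eta> where "\<eta> = \<theta> / (16 * D * phi q)"
  have \<eta>: "\<eta> > 0" using \<theta> D phi by (simp add: \<eta>_def)
  define \<epsilon> where "\<epsilon> = min L (\<eta> * tol\<^sup>2 / (5 * L))"
  have \<epsilon>: "\<epsilon> > 0" "\<epsilon> \<le> L" using L \<eta> tol by (auto simp: \<epsilon>_def)
  have "5 * L * \<epsilon> \<le> 5 * L * (\<eta> * tol\<^sup>2 / (5 * L))" using L by (intro mult_left_mono) (auto simp: \<epsilon>_def)
  hence k: "5 * L * \<epsilon> / tol\<^sup>2 \<le> \<eta>" using L tol by (simp add: field_simps)
  obtain N0 where N0: "N0 \<ge> 1" "\<And>c y. coprime c q \<Longrightarrow> y \<ge> N0 \<Longrightarrow> nrm (M c y) \<le> L + \<epsilon>"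
    using up[OF \<epsilon>(1)] by blast
  obtain X1 where X1: "X1 \<ge> 1" "\<And>x c. x \<ge> X1 \<Longrightarrow> coprime c q \<Longrightarrow> nrm (M c x) \<ge> L - \<epsilon> \<Longrightarrow>
     (\<Sum>n\<in>cop q x. lam2 n / real n * (nrm (M c x - V c x n))\<^sup>2) \<le> 5 * L * \<epsilon> * (ln x)\<^sup>2"
    using variance_bound[OF \<epsilon> N0] by blast
  obtain X2 where X2: "X2 \<ge> 1" "\<And>x c \<kappa>. x \<ge> X2 \<Longrightarrow>
     (\<Sum>n\<in>cop q x. lam2 n / real n * (nrm (M c x - V c x n))\<^sup>2) \<le> \<kappa> * (ln x)\<^sup>2 \<Longrightarrow>
     (\<Sum>n\<in>cop q x. bad c x tol n) \<le> (\<kappa> / tol\<^sup>2 + \<eta>) * (ln x)\<^sup>2"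
    using bad_sum_bound[OF tol \<eta>] by blast
  define X0 where "X0 = max (max X1 X2) (exp (8 * D))"
  have main: "\<exists>Y. light D tol \<theta> x Cs Y"
    if x: "x \<ge> X0" and Cs: "Cs \<subseteq> res q" and near: "\<And>c. c \<in> Cs \<Longrightarrow> nrm (M c x) \<ge> L - \<epsilon>" for x Cs
  proof -
    have x1: "x \<ge> 1" "x \<ge> X1" "x \<ge> X2" using x X1 by (auto simp: X0_def)
    have lx: "ln x \<ge> 8 * D" using x x1 by (simp add: X0_def ln_ge_iff)
    have finC: "finite Cs" using Cs finite_res finite_subset by blast
    define \<beta> where "\<beta> = (\<lambda>n. if coprime n q then \<Sum>c\<in>Cs. bad c x tol n else 0)"
    have "(\<Sum>n\<in>upto_real x. \<beta> n) = (\<Sum>n\<in>cop q x. \<Sum>c\<in>Cs. bad c x tol n)"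
      by (rule sum.mono_neutral_cong_right) (auto simp: cop_def upto_real_altdef \<beta>_def le_nat_floor, linarith)
    also have "\<dots> = (\<Sum>c\<in>Cs. \<Sum>n\<in>cop q x. bad c x tol n)" by (rule sum.swap)
    also have "\<dots> \<le> (\<Sum>c\<in>Cs. (\<eta> + \<eta>) * (ln x)\<^sup>2)"
    proof (rule sum_mono)
      fix c assume c: "c \<in> Cs"
      hence "coprime c q" using Cs by (auto simp: res_def)
      hence "(\<Sum>n\<in>cop q x. bad c x tol n) \<le> (5 * L * \<epsilon> / tol\<^sup>2 + \<eta>) * (ln x)\<^sup>2"
        using X1(2) X2(2) x1 near[OF c] by blast
      also have "\<dots> \<le> (\<eta> + \<eta>) * (ln x)\<^sup>2" using k by (intro mult_right_mono) auto
      finally show "(\<Sum>n\<in>cop q x. bad c x tol n) \<le> (\<eta> + \<eta>) * (ln x)\<^sup>2" .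
    qed
    also have "\<dots> = real (card Cs) * ((\<eta> + \<eta>) * (ln x)\<^sup>2)" by simp
    also have "\<dots> \<le> phi q * ((\<eta> + \<eta>) * (ln x)\<^sup>2)"
      using \<eta> card_mono[OF finite_res Cs] by (intro mult_right_mono) (auto simp: phi_def)
    also have "\<dots> = \<theta> * (ln x)\<^sup>2 / (8 * D)" using phi by (simp add: \<eta>_def field_simps)
    finally have B: "(\<Sum>n\<in>upto_real x. \<beta> n) \<le> \<theta> * (ln x)\<^sup>2 / (8 * D)" .
    have \<beta>0: "\<beta> n \<ge> 0" if "n > 0" for n using that by (simp add: \<beta>_def sum_nonneg bad_nonneg)
    obtain Y where Y: "Y > 0" "ln x / 4 \<le> ln Y" "ln Y + D \<le> ln x / 2"
      "(\<Sum>n\<in>intv Y (exp D * Y). \<beta> n) \<le> 8 * D * (\<theta> * (ln x)\<^sup>2 / (8 * D)) / ln x"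
      using light_window[OF D x1(1) lx \<beta>0 B] by blast
    have lpos: "ln x > 0" using lx D by linarith
    have tot: "(\<Sum>n\<in>intv Y (exp D * Y). \<beta> n) \<le> \<theta> * ln x" using Y(4) D lpos by (simp add: power2_eq_square)
    have "(\<Sum>n | n \<in> intv Y (exp D * Y) \<and> coprime n q. bad c x tol n) \<le> \<theta> * ln x" if c: "c \<in> Cs" for c
    proof -
      have pos: "n > 0" if "n \<in> intv Y (exp D * Y)" for n using that Y(1) by (auto simp: intv_def intro: Nat.gr0I)
      have "(\<Sum>n | n \<in> intv Y (exp D * Y) \<and> coprime n q. bad c x tol n) \<le>
            (\<Sum>n | n \<in> intv Y (exp D * Y) \<and> coprime n q. \<beta> n)"
      proof (rule sum_mono)
        fix n assume n: "n \<in> {n. n \<in> intv Y (exp D * Y) \<and> coprime n q}"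
        hence "bad c x tol n \<le> (\<Sum>c\<in>Cs. bad c x tol n)"
          using finC c pos by (intro member_le_sum) (auto intro!: bad_nonneg)
        thus "bad c x tol n \<le> \<beta> n" using n by (simp add: \<beta>_def)
      qed
      also have "\<dots> \<le> (\<Sum>n\<in>intv Y (exp D * Y). \<beta> n)"
        by (rule sum_mono2) (auto intro!: \<beta>0 pos)
      finally show ?thesis using tot by linarith
    qed
    thus ?thesis using Y unfolding light_def by blast
  qed
  have X01: "X0 \<ge> 1" using X1 by (simp add: X0_def)
  show ?thesis
  proof (rule exI[of _ \<epsilon>], rule conjI[OF \<epsilon>(1)], rule exI[of _ X0], rule conjI[OF X01], intro allI impI)
    fix x Cs assume "X0 \<le> x" "Cs \<subseteq> res q" "\<forall>c\<in>Cs. L - \<epsilon> \<le> nrm (M c x)"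
    thus "\<exists>Y. light D tol \<theta> x Cs Y" by (intro main) auto
  qed
qed

text \<open>The index 1 selects the prime part of lam2 n / n and the index 2 the product part; it is
  an integer because it is also the exponent of \<open>U\<close>.\<close>

definition wt :: "int \<Rightarrow> nat \<Rightarrow> real" where
  "wt k n = (if k = 1 then mangoldt n * ln (real n) else lam_conv n) / real n"

lemma wt_sum: "wt 1 n + wt 2 n = lam2 n / real n"
  by (simp add: wt_def lam2_def add_divide_distrib)

text \<open>If every n of the class in this interval failed, all the mass \<open>wt k\<close> found
  there would be bad and would exceed the allowance T of the window.\<close>

lemma good_exists:
  assumes I: "apI q g y z \<subseteq> intv Y Z" and Y: "Y > 0" and g: "coprime g q"
    and T: "(\<Sum>n | n \<in> intv Y Z \<and> coprime n q. bad c x tol n) \<le> T"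
    and k: "k = 1 \<or> k = 2" and wt: "(\<Sum>n\<in>apI q g y z. wt k n) > T"
  shows "\<exists>n\<in>apI q g y z. nrm (M c x - U k (M (c * rinv q g) (x / real n))) \<le> tol"
proof (rule ccontr)
  assume neg: "\<not> ?thesis"
  have "(\<Sum>n\<in>apI q g y z. wt k n) \<le> (\<Sum>n\<in>apI q g y z. bad c x tol n)"
  proof (rule sum_mono)
    fix n assume n: "n \<in> apI q g y z"
    have pos: "n > 0" using n I Y by (auto simp: intv_def intro!: Nat.gr0I)
    have "[n = g] (mod q)" using n by (simp add: apI_def)
    hence "[c * rinv q n = c * rinv q g] (mod q)" unfolding rinv_def by (intro cong_mult cong_pow) auto
    hence "V c x n = U k (M (c * rinv q g) (x / real n))" if "a n = k"
      using that by (simp add: V_def M_cong)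
    hence "\<not> (a n = k \<and> nrm (M c x - V c x n) \<le> tol)" using neg n by metis
    moreover have "mangoldt n * ln (real n) / real n \<ge> 0" "lam_conv n / real n \<ge> 0"
      using pos by (auto simp: lam_conv_nonneg mangoldt_nonneg)
    ultimately show "wt k n \<le> bad c x tol n" using k by (auto simp: wt_def bad_def)
  qed
  also have "\<dots> \<le> (\<Sum>n | n \<in> intv Y Z \<and> coprime n q. bad c x tol n)"
  proof (rule sum_mono2)
    show "finite {n \<in> intv Y Z. coprime n q}" by simp
    show "apI q g y z \<subseteq> {n \<in> intv Y Z. coprime n q}"
    proof safe
      fix n assume n: "n \<in> apI q g y z"
      thus "n \<in> intv Y Z" using I by blast
      have "[g = n] (mod q)" using n by (auto simp: apI_def cong_sym)
      thus "coprime n q" using g by (rule cong_imp_coprime)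
    qed
    show "bad c x tol n \<ge> 0" if "n \<in> {n \<in> intv Y Z. coprime n q} - apI q g y z" for n
      using that Y by (intro bad_nonneg Nat.gr0I) (auto simp: intv_def)
  qed
  finally show False using T wt by linarith
qed

text \<open>Since w \<le> sqrt x, the points x / w and x / y are at least sqrt x and within a factor
  exp \<delta> of each other.\<close>

lemma M_shift:
  assumes y: "1 \<le> y" "exp \<delta> * y \<le> sqrt x" "y \<le> w" "w \<le> exp \<delta> * y"
  shows "nrm (M b (x / w) - M b (x / y)) \<le> nrm F * (2 * \<delta> + 1 / sqrt x)"
proof -
  have sx: "sqrt x \<ge> 1" using y by linarith
  have x0: "x \<ge> 0" using sx by simp
  have x: "x = sqrt x * sqrt x" using x0 by simp
  have w: "1 \<le> w" "w \<le> sqrt x" using y by linarith+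
  have "sqrt x * w \<le> sqrt x * sqrt x" using w sx by (intro mult_left_mono) auto
  hence xw: "x / w \<ge> sqrt x" using w unfolding x[symmetric] by (simp add: pos_le_divide_eq)
  have "nrm (M b (x / w) - M b (x / y)) \<le> nrm F * (2 * \<delta> + 1 / (x / w))"
  proof (rule M_lipschitz)
    show "1 \<le> x / w" using xw sx by linarith
    show "x / w \<le> x / y" using y w x sx by (intro divide_left_mono) auto
    have "x * w \<le> x * (exp \<delta> * y)" using y x0 by (intro mult_left_mono) auto
    thus "x / y \<le> exp \<delta> * (x / w)" using y w by (simp add: field_simps)
  qed
  also have "\<dots> \<le> nrm F * (2 * \<delta> + 1 / sqrt x)"
    using xw sx by (intro mult_left_mono add_left_mono frac_le) auto
  finally show ?thesis .
qed

lemma good_shift: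
  assumes I: "apI q g y (exp \<delta> * y) \<subseteq> intv Y Z" and Y: "Y > 0" and g: "coprime g q"
    and T: "(\<Sum>n | n \<in> intv Y Z \<and> coprime n q. bad c x tol n) \<le> T"
    and k: "k = 1 \<or> k = 2" and wt: "(\<Sum>n\<in>apI q g y (exp \<delta> * y). wt k n) > T"
    and y: "1 \<le> y" "exp \<delta> * y \<le> sqrt x"
  shows "nrm (M c x - U k (M (c * rinv q g) (x / y))) \<le> tol + nrm F * (2 * \<delta> + 1 / sqrt x)"
proof -
  obtain n where n: "n \<in> apI q g y (exp \<delta> * y)" "nrm (M c x - U k (M (c * rinv q g) (x / real n))) \<le> tol"
    using good_exists[OF I Y g T k wt] by blast
  have "nrm (U k (M (c * rinv q g) (x / real n)) - U k (M (c * rinv q g) (x / y))) =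
        nrm (M (c * rinv q g) (x / real n) - M (c * rinv q g) (x / y))"
    by (simp flip: U_diff)
  also have "\<dots> \<le> nrm F * (2 * \<delta> + 1 / sqrt x)" using n y by (intro M_shift) (auto simp: apI_def)
  finally show ?thesis
    using n(2) nrm_triangle_diff[of "M c x" "U k (M (c * rinv q g) (x / y))" "U k (M (c * rinv q g) (x / real n))"]
    by linarith
qed


text \<open>Spreads near-maximality from one class c to all unit classes at a common smaller point.
  To reach b, take the class g = c / b: Selberg's formula guarantees mass there, so some good n
  \<equiv> g exists. Then M c x is close to a power of the isometry applied to M b (x / Y), and
  isometries preserve the norm.\<close>

lemma near_max_all_classes:
  assumes L: "L > 0"
    and up: "\<And>\<epsilon>. \<epsilon> > 0 \<Longrightarrow> \<exists>N0\<ge>1. \<forall>c y. coprime c q \<longrightarrow> y \<ge> N0 \<longrightarrow> nrm (M c y) \<le> L + \<epsilon>"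
    and freq: "\<And>\<epsilon> N. \<epsilon> > 0 \<Longrightarrow> \<exists>x\<ge>N. \<exists>c. coprime c q \<and> nrm (M c x) \<ge> L - \<epsilon>"
    and e: "e > 0"
  shows "\<exists>x\<ge>N. \<forall>b. coprime b q \<longrightarrow> nrm (M b x) \<ge> L - e"
proof -
  have phi: "phi q \<ge> 1" by (rule phi_ge_1[OF q])
  define f where "f = nrm F"
  have f0: "f \<ge> 0" by (simp add: f_def)
  obtain \<delta>0 where \<delta>0: "\<delta>0 > 0" "\<And>\<delta>. 0 < \<delta> \<Longrightarrow> \<delta> \<le> \<delta>0 \<Longrightarrow> \<exists>Y\<ge>1. \<forall>y\<ge>Y. \<forall>c. coprime c q \<longrightarrow>
     \<bar>(\<Sum>n\<in>apI q c y (exp \<delta> * y). lam2 n / real n) - 2 / phi q * \<delta> * ln y\<bar> \<le> 1 / phi q * \<delta> * ln y"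
    using selberg_ap_local[OF q, of "1 / phi q"] phi by auto
  define \<delta> where "\<delta> = min \<delta>0 (e / (8 * (f + 1)))"
  have \<delta>: "0 < \<delta>" "\<delta> \<le> \<delta>0" using \<delta>0(1) e f0 by (auto simp: \<delta>_def)
  have "f * (2 * \<delta>) \<le> (f + 1) * (2 * (e / (8 * (f + 1))))"
    using f0 \<delta> by (intro mult_mono) (auto simp: \<delta>_def)
  also have "\<dots> = e / 4" using f0 by (simp add: field_simps)
  finally have f\<delta>: "f * (2 * \<delta>) \<le> e / 4" .
  obtain Y0 where Y0: "Y0 \<ge> 1" "\<And>y c. y \<ge> Y0 \<Longrightarrow> coprime c q \<Longrightarrow>
     \<bar>(\<Sum>n\<in>apI q c y (exp \<delta> * y). lam2 n / real n) - 2 / phi q * \<delta> * ln y\<bar> \<le> 1 / phi q * \<delta> * ln y"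
    using \<delta>0(2)[OF \<delta>] by blast
  \<comment> \<open>Since ln Y \<ge> ln x / 4, the guaranteed mass \<delta> ln Y / phi q exceeds 2
    \<theta> ln x, so its prime part or its product part exceeds the bad mass \<theta> ln x.\<close>
  define \<theta> where "\<theta> = \<delta> / (16 * phi q)"
  have \<theta>: "\<theta> > 0" using \<delta> phi by (simp add: \<theta>_def)
  have e4: "e / 4 > 0" using e by simp
  have "\<exists>\<epsilon>>0. \<exists>X0\<ge>1. \<forall>x\<ge>X0. \<forall>Cs\<subseteq>res q. (\<forall>c\<in>Cs. nrm (M c x) \<ge> L - \<epsilon>) \<longrightarrow> (\<exists>Y. light \<delta> (e / 4) \<theta> x Cs Y)"
    by (rule good_window[OF L _ e4 \<delta>(1) \<theta>]) (rule up)
  then obtain \<epsilon> X0 where \<epsilon>: "\<epsilon> > 0" and X0: "X0 \<ge> 1" "\<forall>x\<ge>X0. \<forall>Cs\<subseteq>res q. (\<forall>c\<in>Cs. nrm (M c x) \<ge> L - \<epsilon>) \<longrightarrow> (\<exists>Y. light \<delta> (e / 4) \<theta> x Cs Y)"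
    by (elim exE conjE)
  define \<epsilon>' where "\<epsilon>' = min \<epsilon> (e / 4)"
  have \<epsilon>': "\<epsilon>' > 0" using \<epsilon> e by (simp add: \<epsilon>'_def)
  \<comment> \<open>The fourth power yields Y \<ge> Y0 from ln Y \<ge> ln x / 4, and the square of N
    yields x / Y \<ge> sqrt x \<ge> N. The fourth entry makes the rounding term f / sqrt x at most e
    / 4.\<close>
  define B where "B = Max {X0, Y0 ^ 4, N\<^sup>2, (4 * (f + 1) / e)\<^sup>2, exp 1}"
  have B: "B \<ge> X0" "B \<ge> Y0 ^ 4" "B \<ge> N\<^sup>2" "B \<ge> (4 * (f + 1) / e)\<^sup>2" "B \<ge> exp 1" by (auto simp: B_def)
  obtain x c where x: "x \<ge> B" and c: "coprime c q" "nrm (M c x) \<ge> L - \<epsilon>'"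
    using freq[OF \<epsilon>', of B] by blast
  have x1: "x \<ge> 1" using x B X0 by linarith
  have lx: "ln x \<ge> 1" using x B x1 by (simp add: ln_ge_iff)
  have sN: "N \<le> sqrt x" using x B by (intro real_le_rsqrt) linarith
  have "4 * (f + 1) / e \<le> sqrt x" using x B by (intro real_le_rsqrt) linarith
  hence "f * (1 / sqrt x) \<le> e / 4" using e f0 x1 by (simp add: field_simps)
  hence lip: "e / 4 + f * (2 * \<delta> + 1 / sqrt x) \<le> 3 * e / 4" using f\<delta> by (simp add: distrib_left)
  define c' where "c' = c mod q"
  have cc: "[c' = c] (mod q)" by (simp add: c'_def cong_def)
  have c': "c' \<in> res q" "coprime c' q" using c q cong_imp_coprime[OF cong_sym[OF cc]] by (auto simp: res_def c'_def)
  have m: "nrm (M c' x) \<ge> L - \<epsilon>'" using c M_cong[OF cc] by simp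
  have ge: "nrm (M c' x) \<ge> L - \<epsilon>" using m by (simp add: \<epsilon>'_def)
  have "\<exists>Y. light \<delta> (e / 4) \<theta> x {c'} Y"
    by (rule X0(2)[rule_format]) (use x B c' ge in auto)
  then obtain Y where Y: "Y > 0" "ln x / 4 \<le> ln Y" "ln Y + \<delta> \<le> ln x / 2"
    "(\<Sum>n | n \<in> intv Y (exp \<delta> * Y) \<and> coprime n q. bad c' x (e / 4) n) \<le> \<theta> * ln x"
    by (auto simp: light_def)
  have "exp (ln Y + \<delta>) \<le> exp (ln x / 2)" using Y by simp
  hence Ysq: "exp \<delta> * Y \<le> sqrt x" using Y x1 by (simp add: exp_add mult.commute ln_sqrt[symmetric])
  have "ln (Y0 ^ 4) \<le> ln x" using x B Y0 x1 by (subst ln_le_cancel_iff) (auto intro: order_trans)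
  hence "4 * ln Y0 \<le> ln x" using Y0 by (simp add: ln_realpow)
  hence "ln Y0 \<le> ln Y" using Y by linarith
  hence YY0: "Y0 \<le> Y" using Y0 Y by simp
  hence Y1: "Y \<ge> 1" using Y0 by linarith
  have XN: "x / Y \<ge> N"
  proof -
    have "1 * Y \<le> exp \<delta> * Y" using \<delta> Y by (intro mult_right_mono) auto
    hence "Y \<le> sqrt x" using Ysq by linarith
    hence "sqrt x * Y \<le> sqrt x * sqrt x" using x1 by (intro mult_left_mono) auto
    hence "sqrt x \<le> x / Y" using Y x1 by (simp add: pos_le_divide_eq)
    thus ?thesis using sN by linarith
  qed
  have "nrm (M b (x / Y)) \<ge> L - e" if b: "coprime b q" for b
  proof -
    define g where "g = c' * rinv q b"
    have g: "coprime g q" using b c' by (simp add: g_def coprime_rinv)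
    have gb: "[c' * rinv q g = b] (mod q)" unfolding g_def by (rule rinv_div_cong[OF q c'(2) b])
    have "(\<Sum>n\<in>apI q g Y (exp \<delta> * Y). lam2 n / real n) \<ge> 1 / phi q * \<delta> * ln Y"
      using Y0(2)[OF YY0 g] by (simp add: abs_le_iff)
    moreover have "2 * (\<theta> * ln x) < 1 / phi q * \<delta> * ln Y"
    proof -
      have "2 * (\<theta> * ln x) = \<delta> / phi q * (ln x / 8)" by (simp add: \<theta>_def)
      also have "\<dots> < \<delta> / phi q * ln Y" using Y lx \<delta> phi by (intro mult_strict_left_mono) auto
      finally show ?thesis by simp
    qed
    moreover have "(\<Sum>n\<in>apI q g Y (exp \<delta> * Y). lam2 n / real n) =
       (\<Sum>n\<in>apI q g Y (exp \<delta> * Y). wt 1 n) + (\<Sum>n\<in>apI q g Y (exp \<delta> * Y). wt 2 n)"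
      by (simp only: wt_sum sum.distrib[symmetric])
    ultimately have "(\<Sum>n\<in>apI q g Y (exp \<delta> * Y). wt 1 n) > \<theta> * ln x \<or> (\<Sum>n\<in>apI q g Y (exp \<delta> * Y). wt 2 n) > \<theta> * ln x"
      by linarith
    then obtain k :: int where k: "k = 1 \<or> k = 2" "(\<Sum>n\<in>apI q g Y (exp \<delta> * Y). wt k n) > \<theta> * ln x" by blast
    have "nrm (M c' x - U k (M (c' * rinv q g) (x / Y))) \<le> e / 4 + nrm F * (2 * \<delta> + 1 / sqrt x)"
      by (rule good_shift[OF _ Y(1) g Y(4) k Y1 Ysq]) (auto simp: apI_def intv_def)
    hence "nrm (M c' x - U k (M b (x / Y))) \<le> 3 * e / 4"
      using lip M_cong[OF gb] by (simp add: f_def)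
    hence "nrm (M c' x) \<le> nrm (M b (x / Y)) + 3 * e / 4"
      using nrm_le_add_diff[of "M c' x" "U k (M b (x / Y))"] by simp
    thus ?thesis using m by (simp add: \<epsilon>'_def)
  qed
  thus ?thesis using XN by blast
qed


text \<open>Assuming that near-maximal averages are moved by at least \<kappa>, every class of a
  window gets exactly one type. The window is taken at an x where all unit classes are nearly
  maximal, so that the types seen from different base classes can be compared.\<close>

lemma near_invariant:
  assumes L: "L > 0"
    and up: "\<And>\<epsilon>. \<epsilon> > 0 \<Longrightarrow> \<exists>N0\<ge>1. \<forall>c y. coprime c q \<longrightarrow> y \<ge> N0 \<longrightarrow> nrm (M c y) \<le> L + \<epsilon>"
    and freq: "\<And>\<epsilon> N. \<epsilon> > 0 \<Longrightarrow> \<exists>x\<ge>N. \<exists>c. coprime c q \<and> nrm (M c x) \<ge> L - \<epsilon>"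
    and \<kappa>: "\<kappa> > 0"
  shows "\<exists>x\<ge>N. \<exists>c. coprime c q \<and> nrm (M c x) \<ge> L - \<kappa> \<and> nrm (M c x - U 1 (M c x)) < \<kappa>"
proof (rule ccontr)
  assume "\<not> ?thesis"
  hence separated: "nrm (M c x - U 1 (M c x)) \<ge> \<kappa>" if "x \<ge> N" "coprime c q" "nrm (M c x) \<ge> L - \<kappa>" for c x
    using that by (meson not_le)
  have phi: "phi q \<ge> 1" by (rule phi_ge_1[OF q])
  define f where "f = nrm F"
  have f0: "f \<ge> 0" by (simp add: f_def)
  \<comment> \<open>With this \<theta> the errors 4 \<theta> D of all phi q classes add up to D / (4
    phi q), below what a single class of prime type contributes.\<close>
  define \<theta> where "\<theta> = 1 / (16 * (phi q)\<^sup>2)"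
  have \<theta>: "\<theta> > 0" "\<theta> \<le> 1 / (16 * phi q)" "\<theta> \<le> 1 / 16"
    using phi self_le_power[of "phi q" 2] by (auto simp: \<theta>_def field_simps)
  have \<theta>phi: "4 * \<theta> * phi q = 1 / (4 * phi q)" using phi by (simp add: \<theta>_def power2_eq_square)
  obtain \<delta>0 where \<delta>0: "\<delta>0 > 0" "\<And>\<delta>. 0 < \<delta> \<Longrightarrow> \<delta> \<le> \<delta>0 \<Longrightarrow> \<exists>Y\<ge>1. \<forall>y\<ge>Y. \<forall>c. coprime c q \<longrightarrow>
     \<bar>(\<Sum>n\<in>apI q c y (exp \<delta> * y). lam2 n / real n) - 2 / phi q * \<delta> * ln y\<bar> \<le> \<theta> * \<delta> * ln y"
    using selberg_ap_local[OF q \<theta>(1)] by auto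
  define \<delta> where "\<delta> = min \<delta>0 (\<kappa> / (80 * (f + 1)))"
  have \<delta>: "0 < \<delta>" "\<delta> \<le> \<delta>0" using \<delta>0(1) \<kappa> f0 by (auto simp: \<delta>_def)
  have "f * (2 * \<delta>) \<le> (f + 1) * (2 * (\<kappa> / (80 * (f + 1))))"
    using f0 \<delta> by (intro mult_mono) (auto simp: \<delta>_def)
  also have "\<dots> = \<kappa> / 40" using f0 by (simp add: field_simps)
  finally have f\<delta>: "f * (2 * \<delta>) \<le> \<kappa> / 40" .
  obtain Y0 where Y0: "Y0 \<ge> 1" "\<And>y c. y \<ge> Y0 \<Longrightarrow> coprime c q \<Longrightarrow>
     \<bar>(\<Sum>n\<in>apI q c y (exp \<delta> * y). lam2 n / real n) - 2 / phi q * \<delta> * ln y\<bar> \<le> \<theta> * \<delta> * ln y"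
    using \<delta>0(2)[OF \<delta>] by blast
  obtain K1 where K1: "K1 \<ge> 0" "\<And>x. x \<ge> 1 \<Longrightarrow> \<bar>(\<Sum>n\<in>cop q x. mangoldt n / real n) - ln x\<bar> \<le> K1"
    using sum_mangoldt_cop[OF q] by blast
  obtain K2 where K2: "K2 \<ge> 0" "\<And>\<psi> x. real_char q \<psi> \<Longrightarrow> x \<ge> 1 \<Longrightarrow> \<bar>\<Sum>n\<in>upto_real x. \<psi> n * (mangoldt n / real n)\<bar> \<le> K2"
    using real_chars_mangoldt_bound by blast
  \<comment> \<open>The number of short intervals of logarithmic length \<delta>. It makes the
    window length D exceed both the Mertens error 2 K1, with a factor to spare, and the character
    bound 2 K2 phi q.\<close>
  define R where "R = Suc (nat \<lceil>(4 * K1 + 2 * K2 * phi q + 1) / \<delta>\<rceil>)"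
  define D where "D = real R * \<delta>"
  have "(4 * K1 + 2 * K2 * phi q + 1) / \<delta> \<le> real R" unfolding R_def by linarith
  hence D: "4 * K1 + 2 * K2 * phi q + 1 \<le> D" using \<delta> by (simp add: D_def field_simps)
  have KK: "K2 * phi q \<ge> 0" using K2 phi by simp
  have D0: "D > 0" using D K1 KK by linarith
  \<comment> \<open>The comparisons below accumulate tolerances 5 t and 8 t; both are less than
    \<kappa>.\<close>
  define t where "t = \<kappa> / 20"
  have t: "t > 0" using \<kappa> by (simp add: t_def)
  \<comment> \<open>Together with ln x \<le> 4 ln Y this bounds the bad mass T by half of \<theta>
    \<delta> ln Y, so that it disappears in the Selberg error.\<close>
  define \<theta>' where "\<theta>' = \<theta> * \<delta> / 8"
  have \<theta>': "\<theta>' > 0" using \<theta> \<delta> by (simp add: \<theta>'_def)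
  have "\<exists>\<epsilon>>0. \<exists>X0\<ge>1. \<forall>x\<ge>X0. \<forall>Cs\<subseteq>res q. (\<forall>c\<in>Cs. nrm (M c x) \<ge> L - \<epsilon>) \<longrightarrow> (\<exists>Y. light D t \<theta>' x Cs Y)"
    by (rule good_window[OF L _ t D0 \<theta>']) (rule up)
  then obtain \<epsilon> X0 where \<epsilon>: "\<epsilon> > 0" and X0: "X0 \<ge> 1"
      "\<forall>x\<ge>X0. \<forall>Cs\<subseteq>res q. (\<forall>c\<in>Cs. nrm (M c x) \<ge> L - \<epsilon>) \<longrightarrow> (\<exists>Y. light D t \<theta>' x Cs Y)"
    by (elim exE conjE)
  define B where "B = Max {X0, Y0 ^ 4, N, (40 * (f + 1) / \<kappa>)\<^sup>2, exp (4 * \<delta> / \<theta>)}"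
  have B: "B \<ge> X0" "B \<ge> Y0 ^ 4" "B \<ge> N" "B \<ge> (40 * (f + 1) / \<kappa>)\<^sup>2" "B \<ge> exp (4 * \<delta> / \<theta>)" by (auto simp: B_def)
  have "\<exists>x\<ge>B. \<forall>b. coprime b q \<longrightarrow> nrm (M b x) \<ge> L - min \<epsilon> \<kappa>"
    by (rule near_max_all_classes[OF L]) (use up freq \<epsilon> \<kappa> in auto)
  then obtain x where x: "x \<ge> B" and near: "\<And>b. coprime b q \<Longrightarrow> nrm (M b x) \<ge> L - min \<epsilon> \<kappa>" by blast
  have x1: "x \<ge> 1" using x B X0 by linarith
  have "\<exists>Y. light D t \<theta>' x (res q) Y"
  proof (rule X0(2)[rule_format])
    show "L - \<epsilon> \<le> nrm (M c x)" if "c \<in> res q" for c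
      using near[of c] that min.cobounded1[of \<epsilon> \<kappa>] by (simp add: res_def)
  qed (use x B in auto)
  then obtain Y where Y: "Y > 0" "ln x / 4 \<le> ln Y" "ln Y + D \<le> ln x / 2"
    and badres: "\<And>c. c \<in> res q \<Longrightarrow> (\<Sum>n | n \<in> intv Y (exp D * Y) \<and> coprime n q. bad c x t n) \<le> \<theta>' * ln x"
    by (auto simp: light_def)
  have badle: "(\<Sum>n | n \<in> intv Y (exp D * Y) \<and> coprime n q. bad c x t n) \<le> \<theta>' * ln x" if "coprime c q" for c
  proof -
    have cc: "[c mod q = c] (mod q)" by (simp add: cong_def)
    have "c mod q \<in> res q" using that q by (simp add: res_def)
    from badres[OF this] show ?thesis by (simp only: bad_cong[OF cc])
  qed
  have sep: "nrm (M c x - U 1 (M c x)) \<ge> \<kappa>" if "coprime c q" for c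
    using separated[of x c] near[OF that] that x B min.cobounded2[of \<epsilon> \<kappa>] by linarith
  have lnx: "4 * \<delta> / \<theta> \<le> ln x" using x B x1 by (simp add: ln_ge_iff)
  have "exp (ln Y + D) \<le> exp (ln x / 2)" using Y by simp
  hence Ysq: "exp D * Y \<le> sqrt x" using Y x1 by (simp add: exp_add mult.commute ln_sqrt[symmetric])
  have "ln (Y0 ^ 4) \<le> ln x" using x B Y0 x1 by (subst ln_le_cancel_iff) (auto intro: order_trans)
  hence "4 * ln Y0 \<le> ln x" using Y0 by (simp add: ln_realpow)
  hence "ln Y0 \<le> ln Y" using Y by linarith
  hence YY0: "Y0 \<le> Y" using Y0 Y by simp
  hence Y1: "Y \<ge> 1" using Y0 by linarith
  have \<delta>Y: "\<delta> \<le> \<theta> * ln Y"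
  proof -
    have "\<delta> / \<theta> \<le> ln Y" using lnx Y(2) by simp
    thus ?thesis using \<theta> by (simp add: pos_divide_le_eq mult.commute)
  qed
  have lnY: "ln Y > 0" using \<delta>Y \<delta> \<theta> by (smt (verit) mult_nonneg_nonpos)
  define T where "T = \<theta>' * ln x"
  have TY: "T \<le> \<theta> * \<delta> * ln Y / 2"
  proof -
    have "T \<le> \<theta>' * (4 * ln Y)" unfolding T_def using Y \<theta>' by (intro mult_left_mono) auto
    thus ?thesis by (simp add: \<theta>'_def mult_ac)
  qed
  have "40 * (f + 1) / \<kappa> \<le> sqrt x" using x B by (intro real_le_rsqrt) linarith
  hence "f * (1 / sqrt x) \<le> \<kappa> / 40" using \<kappa> f0 x1 by (simp add: field_simps)
  hence lip: "f * (2 * \<delta> + 1 / sqrt x) \<le> t" using f\<delta> unfolding distrib_left t_def by linarith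
  define y where "y = (\<lambda>j. exp (real j * \<delta>) * Y)"
  have y0: "y 0 = Y" by (simp add: y_def)
  have yS: "y (Suc j) = exp \<delta> * y j" for j by (simp add: y_def algebra_simps flip: exp_add)
  have ypos: "y j > 0" for j using Y by (simp add: y_def)
  have ymono: "y i \<le> y j" if "i \<le> j" for i j using that \<delta> Y by (simp add: y_def mult_right_mono)
  have yR: "y R = exp D * Y" by (simp add: y_def D_def)
  have yY: "y j \<ge> Y" for j using ymono[of 0 j] y0 by simp
  have y1: "y j \<ge> 1" for j using yY[of j] Y1 by linarith
  have lny: "ln (y j) \<ge> ln Y" for j using yY[of j] Y by simp
  have ysq: "exp \<delta> * y j \<le> sqrt x" if "j < R" for j
    using ymono[of "Suc j" R] that Ysq unfolding yS[symmetric] yR by simp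
  define I where "I = (\<lambda>j g. apI q g (y j) (exp \<delta> * y j))"
  have Isub: "apI q g (y j) (exp \<delta> * y j) \<subseteq> intv Y (exp D * Y)" if "j < R" for j g
    using yY[of j] ymono[of "Suc j" R] that unfolding yS[symmetric] yR by (auto simp: apI_def intv_def)
  define ws where "ws = (\<lambda>k j g. \<Sum>n\<in>I j g. wt k n)"
  have close: "nrm (M c x - U k (M (c * rinv q g) (x / y j))) \<le> 2 * t"
    if "j < R" "coprime c q" "coprime g q" "k = 1 \<or> k = 2" "ws k j g > T" for j c g k
  proof -
    have "nrm (M c x - U k (M (c * rinv q g) (x / y j))) \<le> t + nrm F * (2 * \<delta> + 1 / sqrt x)"
      using that unfolding ws_def I_def T_def
      by (intro good_shift[OF Isub Y(1) _ badle _ _ y1 ysq]) auto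
    thus ?thesis using lip by (simp add: f_def)
  qed
  have total: "\<bar>ws 1 j g + ws 2 j g - 2 / phi q * \<delta> * ln (y j)\<bar> \<le> \<theta> * \<delta> * ln (y j)" if "coprime g q" for j g
  proof -
    have "ws 1 j g + ws 2 j g = (\<Sum>n\<in>I j g. lam2 n / real n)"
      by (simp only: ws_def wt_sum sum.distrib[symmetric])
    thus ?thesis using Y0(2)[of "y j" g] that YY0 yY[of j] by (simp add: I_def)
  qed
  have Ty: "T \<le> \<theta> * \<delta> * ln (y j) / 2" for j
  proof -
    have "\<theta> * \<delta> * ln Y \<le> \<theta> * \<delta> * ln (y j)" using lny[of j] \<theta> \<delta> by (intro mult_left_mono) auto
    thus ?thesis using TY by linarith
  qed
  have ws0: "ws k j g \<ge> 0" for k j g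
    unfolding ws_def wt_def I_def using ypos
    by (intro sum_nonneg) (auto simp: apI_def lam_conv_nonneg intro!: divide_nonneg_nonneg mult_nonneg_nonneg mangoldt_nonneg ln_ge_zero intro: order_trans[OF y1] less_imp_le)
  have some_type: "ws 1 j g > T \<or> ws 2 j g > T" if "coprime g q" for j g
  proof -
    have "2 * \<theta> * (\<delta> * ln (y j)) \<le> (2 / phi q - \<theta>) * (\<delta> * ln (y j))"
    proof (rule mult_right_mono)
      have "\<theta> * 3 \<le> 2 / phi q" using \<theta>(2) phi by (simp add: field_simps)
      thus "2 * \<theta> \<le> 2 / phi q - \<theta>" by simp
    qed (use \<delta> lny[of j] lnY in auto)
    hence "2 * (\<theta> * \<delta> * ln (y j)) \<le> ws 1 j g + ws 2 j g"
      using total[OF that, of j] by (simp add: algebra_simps abs_le_iff)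
    moreover have "\<theta> * \<delta> * ln (y j) > 0" using \<theta> \<delta> lny[of j] lnY by (intro mult_pos_pos) auto
    ultimately show ?thesis using Ty[of j] by linarith
  qed
  have M_step: "nrm (M b (x / y (Suc j)) - M b (x / y j)) \<le> t" if "j < R" for b j
    using M_shift[of "y j" \<delta> x "y (Suc j)" b] y1[of j] ysq[OF that] ymono[of j "Suc j"] lip
    unfolding yS by (simp add: f_def)
  \<comment> \<open>a class cannot have the prime type at one place and the semiprime type next to it\<close>
  have clash: False if "i < R" "j < R" "coprime g q" "ws 1 i g > T" "ws 2 j g > T"
    "nrm (M (1 * rinv q g) (x / y j) - M (1 * rinv q g) (x / y i)) \<le> t" for i j g
  proof -
    define m v w where "m = M 1 x" and "v = M (1 * rinv q g) (x / y i)" and "w = M (1 * rinv q g) (x / y j)"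
    have 1: "nrm (m - U 1 v) \<le> 2 * t" "nrm (m - U 2 w) \<le> 2 * t"
      unfolding m_def v_def w_def using that by (intro close; simp)+
    \<comment> \<open>Since v and w are close, m is close to U 2 w, then to U 2 v = U 1 (U 1 v), and
      then to U 1 m; the errors are 2 t, t and 2 t.\<close>
    have "nrm (U 2 w - U 2 v) \<le> t" using that(6) unfolding U_diff[symmetric] by (simp add: v_def w_def)
    moreover have "nrm (U 2 v - U 1 m) \<le> 2 * t"
      using 1(1) nrm_U[of 1 "U 1 v - m"] by (simp add: U_diff U_U nrm_minus_commute[of m])
    ultimately have "nrm (m - U 1 m) \<le> 5 * t"
      using 1(2) nrm_triangle_diff[of m "U 1 m" "U 2 w"] nrm_triangle_diff[of "U 2 w" "U 1 m" "U 2 v"] by linarith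
    thus False using sep[of 1] t by (simp add: m_def t_def)
  qed
  define P where "P = (\<lambda>g. ws 1 0 g > T)"
  have R0: "0 < R" by (simp add: R_def)
  have nrm_self: "nrm (v - v) \<le> t" for v using t by simp
  \<comment> \<open>Averages at neighbouring base points differ by at most t, so the type of a class
    cannot change between adjacent short intervals, nor can both types occur in one.\<close>
  have const: "(ws 1 j g > T) = P g \<and> (ws 2 j g > T) = (\<not> P g)" if "j < R" "coprime g q" for j g
    using that(1)
  proof (induction j)
    case 0
    show ?case using clash[OF R0 R0 that(2)] some_type[OF that(2), of 0] nrm_self unfolding P_def by blast
  next
    case (Suc j)
    hence j: "j < R" by simp
    have same: "\<not> (ws 1 (Suc j) g > T \<and> ws 2 (Suc j) g > T)"
      using clash[OF Suc.prems Suc.prems that(2)] nrm_self by blast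
    have "\<not> (ws 1 j g > T \<and> ws 2 (Suc j) g > T)"
      using clash[OF j Suc.prems that(2)] M_step[OF j] by blast
    moreover have "\<not> (ws 1 (Suc j) g > T \<and> ws 2 j g > T)"
      using clash[OF Suc.prems j that(2)] M_step[OF j] nrm_minus_commute by metis
    ultimately show ?case using same some_type[OF that(2), of "Suc j"] Suc.IH[OF j] by blast
  qed
  have P_cong: "P g = P g'" if "[g = g'] (mod q)" for g g'
    unfolding P_def ws_def I_def using apI_cong[OF that] by simp
  define ty where "ty = (\<lambda>g. if P g then 1 else 2 :: int)"
  have ty: "nrm (M c x - U (ty g) (M (c * rinv q g) (x / Y))) \<le> 2 * t" if "coprime c q" "coprime g q" for c g
    using close[OF R0 that, of "ty g"] const[OF R0 that(2)] unfolding y0 by (auto simp: ty_def)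
  \<comment> \<open>Take h as base class besides 1. The class b h seen from h leads to the same
    average as b seen from 1, so M h x is close to m moved by ty (b h) - ty b. Equal types of g and
    g' with unequal types of the products would put M h x close to two consecutive shifts of m,
    making m nearly invariant.\<close>
  have P_mult: "P (g * h) = P (g' * h)" if g: "coprime g q" and g': "coprime g' q" and h: "coprime h q" and eq: "P g = P g'" for g g' h
  proof (rule ccontr)
    assume neq: "P (g * h) \<noteq> P (g' * h)"
    define m where "m = M 1 x"
    define k where "k = ty g"
    have k': "ty g' = k" using eq by (simp add: k_def ty_def)
    have shift: "nrm (M h x - U (ty (b * h) - k) m) \<le> 4 * t" if b: "coprime b q" "ty b = k" for b
    proof -
      define w where "w = M (1 * rinv q b) (x / Y)"
      have "[h * rinv q (b * h) = 1 * rinv q b] (mod q)"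
      proof -
        have "[h * rinv q h * rinv q b = 1 * rinv q b] (mod q)" by (intro cong_mult rinv_cong h q cong_refl)
        thus ?thesis by (simp add: rinv_mult mult_ac)
      qed
      hence "M (h * rinv q (b * h)) (x / Y) = w" unfolding w_def by (rule M_cong)
      hence 1: "nrm (M h x - U (ty (b * h)) w) \<le> 2 * t" using ty[of h "b * h"] b h by simp
      have "nrm (m - U k w) \<le> 2 * t" using ty[of 1 b] b by (simp add: m_def w_def)
      hence "nrm (U (ty (b * h) - k) (U k w - m)) \<le> 2 * t" by (simp add: nrm_minus_commute)
      hence "nrm (U (ty (b * h)) w - U (ty (b * h) - k) m) \<le> 2 * t" by (simp add: U_diff U_U)
      with 1 nrm_triangle_diff[of "M h x" "U (ty (b * h) - k) m" "U (ty (b * h)) w"] show ?thesis by linarith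
    qed
    have "nrm (M h x - U (1 - k) m) \<le> 4 * t" "nrm (M h x - U (2 - k) m) \<le> 4 * t"
      using shift[OF g] shift[OF g' k'] neq by (auto simp: k_def ty_def split: if_splits)
    hence "nrm (U (1 - k) m - U (2 - k) m) \<le> 8 * t"
      using nrm_triangle_diff[of "U (1 - k) m" "U (2 - k) m" "M h x"] by (simp add: nrm_minus_commute)
    moreover have "U (2 - k) m = U (1 - k) (U 1 m)" by (simp add: U_U)
    ultimately have "nrm (m - U 1 m) \<le> 8 * t" by (simp flip: U_diff)
    thus False using sep[of 1] \<kappa> by (simp add: m_def t_def)
  qed
  \<comment> \<open>the window has prime density \<open>2 / phi q\<close> in the classes of prime type and almost none in the others\<close>
  define A where "A = (\<lambda>g. \<Sum>n\<in>apI q g Y (exp D * Y). mangoldt n / real n)"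
  have A_eq: "A g = (\<Sum>j<R. \<Sum>n\<in>I j g. mangoldt n / real n)" for g
    unfolding A_def I_def y_def D_def using Y \<delta> by (intro sum_apI_split[symmetric]) auto
  have A_bound: "\<bar>A g - (if P g then 2 / phi q else 0) * D\<bar> \<le> 4 * \<theta> * D" if g: "coprime g q" for g
  proof -
    define \<alpha> where "\<alpha> = (if P g then 2 / phi q else 0)"
    have \<alpha>: "0 \<le> \<alpha>" "\<alpha> \<le> 2" using phi by (auto simp: \<alpha>_def field_simps)
    have "\<bar>(\<Sum>n\<in>I j g. mangoldt n / real n) - \<alpha> * \<delta>\<bar> \<le> 4 * \<theta> * \<delta>" if j: "j < R" for j
    proof -
      define l a where "l = ln (y j)" and "a = (\<Sum>n\<in>I j g. mangoldt n / real n)"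
      have "ln Y \<le> l" using lny[of j] by (simp add: l_def)
      hence "\<theta> * ln Y \<le> \<theta> * l" using \<theta> by (intro mult_left_mono) auto
      hence l: "l > 0" "\<delta> \<le> \<theta> * l" using \<open>ln Y \<le> l\<close> lnY \<delta>Y by linarith+
      have a0: "a \<ge> 0" unfolding a_def by (intro sum_nonneg) (auto simp: mangoldt_nonneg)
      have "l * a \<le> ws 1 j g" unfolding a_def ws_def sum_distrib_left
      proof (rule sum_mono)
        fix n assume "n \<in> I j g"
        hence "y j \<le> real n" by (auto simp: I_def apI_def)
        hence "l \<le> ln (real n)" using ypos[of j] by (simp add: l_def)
        hence "l * (mangoldt n / real n) \<le> ln (real n) * (mangoldt n / real n)" by (rule mult_right_mono) (simp add: mangoldt_nonneg)
        thus "l * (mangoldt n / real n) \<le> wt 1 n" by (simp add: wt_def mult.commute)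
      qed
      moreover have "ws 1 j g \<le> (l + \<delta>) * a" unfolding a_def ws_def sum_distrib_left
      proof (rule sum_mono)
        fix n assume "n \<in> I j g"
        hence n: "y j < real n" "real n \<le> exp \<delta> * y j" by (auto simp: I_def apI_def)
        hence "ln (real n) \<le> ln (exp \<delta> * y j)" using ypos[of j] by (subst ln_le_cancel_iff) auto
        also have "\<dots> = l + \<delta>" using ypos[of j] by (simp add: ln_mult l_def)
        finally have "ln (real n) * (mangoldt n / real n) \<le> (l + \<delta>) * (mangoldt n / real n)" by (rule mult_right_mono) (simp add: mangoldt_nonneg)
        thus "wt 1 n \<le> (l + \<delta>) * (mangoldt n / real n)" by (simp add: wt_def mult.commute)
      qed
      moreover have "(l + \<delta>) * a \<le> (l + \<theta> * l) * a" using l a0 by (intro mult_right_mono) auto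
      \<comment> \<open>In a class of prime type the product part is at most T, so the prime part
        takes nearly all of the Selberg mass; otherwise the prime part itself is at most T.\<close>
      moreover have "(\<alpha> - 2 * \<theta>) * \<delta> * l \<le> ws 1 j g \<and> ws 1 j g \<le> (\<alpha> + \<theta>) * \<delta> * l"
      proof (cases "P g")
        case True
        hence "ws 2 j g \<le> T" using const[OF j g] by auto
        thus ?thesis using True total[OF g, of j] Ty[of j] ws0[of 2 j g] unfolding \<alpha>_def l_def[symmetric]
          by (simp add: algebra_simps abs_le_iff)
      next
        case False
        hence "ws 1 j g \<le> T" using const[OF j g] by auto
        moreover have "\<theta> * \<delta> * l \<ge> 0" using \<theta> \<delta> l by simp
        ultimately show ?thesis using False Ty[of j] ws0[of 1 j g] unfolding \<alpha>_def l_def[symmetric]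
          by (simp add: algebra_simps)
      qed
      ultimately have 1: "l * a \<le> l * ((\<alpha> + \<theta>) * \<delta>)" "l * ((\<alpha> - 2 * \<theta>) * \<delta>) \<le> l * ((1 + \<theta>) * a)"
        by (simp_all add: algebra_simps)
      hence up: "a \<le> (\<alpha> + \<theta>) * \<delta>" and lo: "(\<alpha> - 2 * \<theta>) * \<delta> \<le> (1 + \<theta>) * a" using l by simp_all
      show ?thesis
      proof (cases "a \<le> \<alpha> * \<delta>")
        case True
        have "\<theta> * a \<le> \<theta> * (2 * \<delta>)"
        proof -
          have "\<alpha> * \<delta> \<le> 2 * \<delta>" using \<alpha> \<delta> by (intro mult_right_mono) auto
          thus ?thesis using True \<theta> by (intro mult_left_mono) auto
        qed
        moreover have "\<alpha> * \<delta> - 2 * (\<theta> * \<delta>) \<le> a + \<theta> * a" using lo by (simp add: algebra_simps)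
        moreover have "\<theta> * (2 * \<delta>) = 2 * (\<theta> * \<delta>)" "4 * \<theta> * \<delta> = 4 * (\<theta> * \<delta>)" by simp_all
        ultimately show ?thesis using True unfolding a_def[symmetric] by linarith
      next
        case False
        have "\<theta> * \<delta> \<ge> 0" using \<theta> \<delta> by simp
        thus ?thesis using False up unfolding a_def[symmetric] by (simp add: algebra_simps)
      qed
    qed
    hence "(\<Sum>j<R. \<bar>(\<Sum>n\<in>I j g. mangoldt n / real n) - \<alpha> * \<delta>\<bar>) \<le> (\<Sum>j<R. 4 * \<theta> * \<delta>)" by (intro sum_mono) auto
    hence "\<bar>\<Sum>j<R. (\<Sum>n\<in>I j g. mangoldt n / real n) - \<alpha> * \<delta>\<bar> \<le> (\<Sum>j<R. 4 * \<theta> * \<delta>)"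
      by (rule order_trans[OF sum_abs])
    thus ?thesis unfolding A_eq \<alpha>_def[symmetric] D_def by (simp add: sum_subtractf algebra_simps)
  qed
  have YD: "1 \<le> Y" "Y \<le> exp D * Y" "1 \<le> exp D * Y" using Y1 ymono[of 0 R] y0 yR y1[of R] by auto
  have sumA: "\<bar>(\<Sum>g\<in>res q. A g) - D\<bar> \<le> 2 * K1"
  proof -
    have "(\<Sum>g\<in>res q. A g) = (\<Sum>n\<in>intv Y (exp D * Y). of_bool (coprime n q) * (mangoldt n / real n))"
      unfolding A_def sum_res_apI[OF q] by (rule sum.mono_neutral_cong_left) auto
    also have "\<dots> = (\<Sum>n\<in>cop q (exp D * Y). mangoldt n / real n) - (\<Sum>n\<in>cop q Y. mangoldt n / real n)"
      unfolding sum_upto_diff[OF YD(1,2)] sum_cop_weight ..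
    finally have eq: "(\<Sum>g\<in>res q. A g) = (\<Sum>n\<in>cop q (exp D * Y). mangoldt n / real n) - (\<Sum>n\<in>cop q Y. mangoldt n / real n)" .
    have "ln (exp D * Y) = D + ln Y" using Y by (simp add: ln_mult)
    thus ?thesis unfolding eq using K1(2)[OF YD(1)] K1(2)[OF YD(3)] by linarith
  qed
  have sum_err: "\<bar>(\<Sum>g\<in>res q. s g * A g) - (\<Sum>g\<in>res q. s g * ((if P g then 2 / phi q else 0) * D))\<bar> \<le> D / (4 * phi q)"
    if s: "\<And>g. g \<in> res q \<Longrightarrow> \<bar>s g\<bar> = 1" for s :: "nat \<Rightarrow> real"
  proof -
    have "\<bar>(\<Sum>g\<in>res q. s g * A g) - (\<Sum>g\<in>res q. s g * ((if P g then 2 / phi q else 0) * D))\<bar> =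
       \<bar>\<Sum>g\<in>res q. s g * (A g - (if P g then 2 / phi q else 0) * D)\<bar>"
      unfolding sum_subtractf[symmetric] right_diff_distrib ..
    also have "\<dots> \<le> (\<Sum>g\<in>res q. \<bar>s g * (A g - (if P g then 2 / phi q else 0) * D)\<bar>)" by (rule sum_abs)
    also have "\<dots> \<le> (\<Sum>g\<in>res q. 4 * \<theta> * D)"
    proof (rule sum_mono)
      fix g assume g: "g \<in> res q"
      have "coprime g q" using g by (simp add: res_def)
      thus "\<bar>s g * (A g - (if P g then 2 / phi q else 0) * D)\<bar> \<le> 4 * \<theta> * D"
        unfolding abs_mult s[OF g] using A_bound by simp
    qed
    also have "\<dots> = (4 * \<theta> * phi q) * D" by (simp add: phi_def)
    also have "\<dots> = D / (4 * phi q)" unfolding \<theta>phi by simp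
    finally show ?thesis .
  qed
  have Dphi: "D / (4 * phi q) \<le> D / 4" using D0 phi by (intro divide_left_mono) auto
  \<comment> \<open>By Mertens the masses A g add up to D up to 2 K1. Without classes of prime type
    the total would be near 0, and with no others near 2 D.\<close>
  have exP: "\<exists>u\<in>res q. P u"
  proof (rule ccontr)
    assume "\<not> ?thesis"
    hence "(\<Sum>g\<in>res q. 1 * ((if P g then 2 / phi q else 0) * D)) = 0" by (intro sum.neutral) auto
    thus False using sum_err[of "\<lambda>_. 1"] sumA Dphi D K1 KK by simp
  qed
  have exnP: "\<exists>v\<in>res q. \<not> P v"
  proof (rule ccontr)
    assume "\<not> ?thesis"
    hence "(\<Sum>g\<in>res q. 1 * ((if P g then 2 / phi q else 0) * D)) = (\<Sum>g\<in>res q. 2 / phi q * D)" by (intro sum.cong) auto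
    also have "\<dots> = phi q * (2 / phi q * D)" by (simp only: sum_constant phi_def)
    also have "\<dots> = 2 * D" using phi by simp
    finally show False using sum_err[of "\<lambda>_. 1"] sumA Dphi D K1 KK by simp
  qed
  obtain u v where uv: "coprime u q" "P u" "coprime v q" "\<not> P v" "u \<in> res q" using exP exnP by (auto simp: res_def)
  obtain \<psi> s where \<psi>: "real_char q \<psi>" and s: "\<bar>s\<bar> = 1" "\<And>g. coprime g q \<Longrightarrow> (if P g then 1 else - 1 :: real) = s * \<psi> g"
    using type_character[OF q P_cong P_mult uv(1-4)] by blast
  interpret real_char q \<psi> by (rule \<psi>)
  have "(\<Sum>g\<in>res q. \<psi> g * A g) = (\<Sum>g\<in>res q. \<Sum>n\<in>apI q g Y (exp D * Y). \<psi> n * (mangoldt n / real n))"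
    unfolding A_def sum_distrib_left by (intro sum.cong refl) (auto simp: apI_def dest: cong)
  also have "\<dots> = (\<Sum>n\<in>intv Y (exp D * Y). \<psi> n * (mangoldt n / real n))"
    unfolding sum_res_apI[OF q] by (rule sum.mono_neutral_left) (auto simp: zero)
  also have "\<bar>\<dots>\<bar> \<le> 2 * K2"
    unfolding sum_upto_diff[OF YD(1,2)] using K2(2)[OF \<psi> YD(1)] K2(2)[OF \<psi> YD(3)] by linarith
  finally have small: "\<bar>\<Sum>g\<in>res q. \<psi> g * A g\<bar> \<le> 2 * K2" .
  have "\<bar>\<Sum>g\<in>res q. s * \<psi> g * A g\<bar> = \<bar>s * (\<Sum>g\<in>res q. \<psi> g * A g)\<bar>" by (simp add: sum_distrib_left mult.assoc)
  hence small': "\<bar>\<Sum>g\<in>res q. s * \<psi> g * A g\<bar> \<le> 2 * K2" using small s by (simp add: abs_mult)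
  \<comment> \<open>s \<psi> is 1 exactly on the classes of prime type, and the others have main
    term 0, so there is no cancellation and the single class u already gives the bound.\<close>
  have "2 / phi q * D \<le> (\<Sum>g\<in>res q. s * \<psi> g * ((if P g then 2 / phi q else 0) * D))"
  proof -
    have eq: "s * \<psi> g * ((if P g then 2 / phi q else 0) * D) = (if P g then 2 / phi q * D else 0)" if "g \<in> res q" for g
      using s(2)[of g] that by (auto simp: res_def split: if_splits)
    have "2 / phi q * D = (if P u then 2 / phi q * D else 0)" using uv by simp
    also have "\<dots> \<le> (\<Sum>g\<in>res q. if P g then 2 / phi q * D else 0)"
      by (rule member_le_sum) (use uv D0 phi in auto)
    also have "\<dots> = (\<Sum>g\<in>res q. s * \<psi> g * ((if P g then 2 / phi q else 0) * D))" using eq by simp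
    finally show ?thesis .
  qed
  moreover have smod: "\<bar>s * \<psi> g\<bar> = 1" if "g \<in> res q" for g
    using s(1) unimod[of g] that by (auto simp: res_def abs_mult)
  ultimately have "2 / phi q * D - D / (4 * phi q) \<le> 2 * K2" using sum_err[of "\<lambda>g. s * \<psi> g", OF smod] small' by linarith
  moreover have "2 / phi q * D - D / (4 * phi q) \<ge> D / phi q" using phi D0 by (simp add: field_simps)
  ultimately have "D \<le> 2 * K2 * phi q" using phi by (simp add: field_simps)
  thus False using D K1 by linarith
qed


text \<open>Dyadic convex combinations of the forward orbit of F. Midpoints are what the
  parallelogram law needs in the search for small elements, and they keep the induction of
  \<open>hull_close\<close> simple.\<close>

inductive_set orbit_hull :: "'a set" where
  base: "F \<in> orbit_hull"
| shift: "v \<in> orbit_hull \<Longrightarrow> U 1 v \<in> orbit_hull"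
| midpoint: "v \<in> orbit_hull \<Longrightarrow> w \<in> orbit_hull \<Longrightarrow> (1 / 2) *\<^sub>R (v + w) \<in> orbit_hull"

definition avg :: "nat \<Rightarrow> real \<Rightarrow> 'a \<Rightarrow> 'a" where
  "avg c x v = (1 / x) *\<^sub>R (\<Sum>m\<in>ap q c x. U (a m) v)"

lemma avg_F: "avg c x F = M c x"
  by (simp add: avg_def M_def S_def)

lemma avg_U: "avg c x (U k v) = U k (avg c x v)"
  by (simp add: avg_def U_scale U_sum U_U add.commute)

lemma avg_add: "avg c x (v + w) = avg c x v + avg c x w"
  by (simp add: avg_def U_add sum.distrib scaleR_add_right)

lemma avg_scale: "avg c x (t *\<^sub>R v) = t *\<^sub>R avg c x v"
  by (simp add: avg_def U_scale flip: scaleR_sum_right)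

lemma nrm_avg_le:
  assumes "x > 0"
  shows "nrm (avg c x v) \<le> nrm v"
proof -
  have "nrm (\<Sum>m\<in>ap q c x. U (a m) v) \<le> real (card (ap q c x)) * nrm v"
    using nrm_sum[of "\<lambda>m. U (a m) v" "ap q c x"] by simp
  also have "\<dots> \<le> x * nrm v" using assms by (intro mult_right_mono card_ap_le) auto
  finally show ?thesis using assms by (simp add: avg_def nrm_scale field_simps)
qed

text \<open>Averaging commutes with U, so shifting F by one step moves the average only by the
  defect of invariance of M c x. C depends on how g was built, but not on c and x.\<close>

lemma hull_close:
  assumes "g \<in> orbit_hull"
  shows "\<exists>C\<ge>0. \<forall>c x. nrm (M c x - avg c x g) \<le> C * nrm (M c x - U 1 (M c x))"
  using assms
proof induction
  case base
  show ?case by (rule exI[of _ 0]) (simp add: avg_F)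
next
  case (shift v)
  then obtain C where C: "C \<ge> 0" "\<And>c x. nrm (M c x - avg c x v) \<le> C * nrm (M c x - U 1 (M c x))" by blast
  have "nrm (M c x - avg c x (U 1 v)) \<le> (1 + C) * nrm (M c x - U 1 (M c x))" for c x
  proof -
    have "nrm (U 1 (M c x) - U 1 (avg c x v)) \<le> C * nrm (M c x - U 1 (M c x))"
      unfolding U_diff[symmetric] nrm_U by (rule C(2))
    thus ?thesis
      using nrm_triangle_diff[of "M c x" "U 1 (avg c x v)" "U 1 (M c x)"] by (simp add: avg_U algebra_simps)
  qed
  thus ?case using C(1) by (intro exI[of _ "1 + C"]) auto
next
  case (midpoint v w)
  then obtain C C' where C: "C \<ge> 0" "\<And>c x. nrm (M c x - avg c x v) \<le> C * nrm (M c x - U 1 (M c x))"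
    and C': "C' \<ge> 0" "\<And>c x. nrm (M c x - avg c x w) \<le> C' * nrm (M c x - U 1 (M c x))" by metis
  have "nrm (M c x - avg c x ((1 / 2) *\<^sub>R (v + w))) \<le> (C + C') * nrm (M c x - U 1 (M c x))" for c x
  proof -
    have "M c x - avg c x ((1 / 2) *\<^sub>R (v + w)) = (1 / 2) *\<^sub>R ((M c x - avg c x v) + (M c x - avg c x w))"
    proof -
      have "M c x = (1 / 2) *\<^sub>R (M c x + M c x)" by (simp add: scaleR_2[symmetric])
      thus ?thesis by (simp add: avg_scale avg_add algebra_simps)
    qed
    hence "nrm (M c x - avg c x ((1 / 2) *\<^sub>R (v + w))) = 1 / 2 * nrm ((M c x - avg c x v) + (M c x - avg c x w))"
      by (simp only: nrm_scale)
    also have "\<dots> \<le> 1 * (nrm (M c x - avg c x v) + nrm (M c x - avg c x w))"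
      by (intro mult_mono nrm_triangle) auto
    finally show ?thesis using C(2)[of c x] C'(2)[of c x] by (simp add: distrib_right)
  qed
  thus ?case using C(1) C'(1) by (intro exI[of _ "C + C'"]) auto
qed

text \<open>The largest limiting norm \<open>L\<close> of the averages vanishes: near the maximum an average would be
  almost invariant, hence close to the average of a small element of the hull.\<close>

theorem M_tendsto_0:
  assumes small: "\<And>\<epsilon>. \<epsilon> > 0 \<Longrightarrow> \<exists>g\<in>orbit_hull. nrm g < \<epsilon>" and "\<epsilon> > 0"
  shows "\<exists>N. \<forall>x\<ge>N. \<forall>c. coprime c q \<longrightarrow> nrm (M c x) < \<epsilon>"
proof -
  \<comment> \<open>The set of eventual bounds, so that its infimum L is the upper limit of the
    norms over all unit classes together.\<close>
  define Ls where "Ls = {l. l \<ge> 0 \<and> (\<exists>N\<ge>1. \<forall>c y. coprime c q \<longrightarrow> y \<ge> N \<longrightarrow> nrm (M c y) \<le> l)}"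
  define L where "L = Inf Ls"
  have "nrm F \<in> Ls" by (auto simp: Ls_def intro!: exI[of _ 1] nrm_M_le)
  hence ne: "Ls \<noteq> {}" by blast
  have bdd: "bdd_below Ls" by (rule bdd_belowI[of _ 0]) (simp add: Ls_def)
  have L0: "L \<ge> 0" unfolding L_def by (rule cInf_greatest[OF ne]) (simp add: Ls_def)
  have up: "\<exists>N0\<ge>1. \<forall>c y. coprime c q \<longrightarrow> y \<ge> N0 \<longrightarrow> nrm (M c y) \<le> L + e" if e: "e > 0" for e
  proof -
    have "Inf Ls < L + e" using e by (simp add: L_def)
    then obtain l where l: "l \<in> Ls" "l < L + e" using cInf_lessD[OF ne] by blast
    then obtain N where N: "N \<ge> 1" "\<And>c y. coprime c q \<Longrightarrow> y \<ge> N \<Longrightarrow> nrm (M c y) \<le> l" by (auto simp: Ls_def)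
    have "nrm (M c y) \<le> L + e" if "coprime c q" "y \<ge> N" for c y using N(2)[OF that] l(2) by linarith
    thus ?thesis using N(1) by blast
  qed
  have freq: "\<exists>x\<ge>N. \<exists>c. coprime c q \<and> nrm (M c x) \<ge> L - e" if e: "e > 0" for e N
  proof (cases "L - e \<ge> 0")
    case True
    have "L - e \<notin> Ls" using e cInf_lower[OF _ bdd, of "L - e"] by (auto simp: L_def)
    with True have "\<not> (\<forall>c y. coprime c q \<longrightarrow> y \<ge> max N 1 \<longrightarrow> nrm (M c y) \<le> L - e)"
      unfolding Ls_def using max.cobounded2[of 1 N] by blast
    then obtain c y where "coprime c q" "y \<ge> max N 1" "nrm (M c y) > L - e" by (auto simp: not_le)
    thus ?thesis by (intro exI[of _ y]) (auto intro!: exI[of _ c])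
  next
    case False
    have "nrm (M 1 N) \<ge> L - e" using False nrm_nonneg[of "M 1 N"] by linarith
    thus ?thesis by (intro exI[of _ N] conjI order_refl exI[of _ 1]) auto
  qed
  have "L = 0"
  proof (rule ccontr)
    assume "L \<noteq> 0"
    hence L: "L > 0" using L0 by simp
    then obtain g where g: "g \<in> orbit_hull" "nrm g < L / 4" using small[of "L / 4"] by auto
    obtain C where C: "C \<ge> 0" "\<And>c x. nrm (M c x - avg c x g) \<le> C * nrm (M c x - U 1 (M c x))"
      using hull_close[OF g(1)] by blast
    \<comment> \<open>The average then has norm at least 3 L / 4, but as it is within (C + 1)
      \<kappa> = L / 4 of the average of g, its norm is below L / 2.\<close>
    define \<kappa> where "\<kappa> = L / 4 / (C + 1)"
    have "C + 1 > 0" using C by simp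
    hence \<kappa>: "\<kappa> > 0" "(C + 1) * \<kappa> = L / 4"
      using L unfolding \<kappa>_def by (simp, metis less_irrefl nonzero_mult_div_cancel_left times_divide_eq_right)
    have "1 * \<kappa> \<le> (C + 1) * \<kappa>" using \<kappa> C by (intro mult_right_mono) auto
    hence \<kappa>L: "\<kappa> \<le> L / 4" using \<kappa> by simp
    have "\<exists>x\<ge>1. \<exists>c. coprime c q \<and> nrm (M c x) \<ge> L - \<kappa> \<and> nrm (M c x - U 1 (M c x)) < \<kappa>"
      by (rule near_invariant[OF L _ _ \<kappa>(1)]) (use up freq in auto)
    then obtain x c where x: "x \<ge> 1" "nrm (M c x) \<ge> L - \<kappa>" "nrm (M c x - U 1 (M c x)) < \<kappa>" by blast
    have "nrm (M c x) \<le> nrm (avg c x g) + nrm (M c x - avg c x g)" by (rule nrm_le_add_diff)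
    also have "nrm (avg c x g) \<le> nrm g" using x by (intro nrm_avg_le) simp
    also have "nrm (M c x - avg c x g) \<le> (C + 1) * \<kappa>"
    proof -
      have "C * nrm (M c x - U 1 (M c x)) \<le> (C + 1) * \<kappa>" using x C by (intro mult_mono) auto
      thus ?thesis using C(2)[of c x] by linarith
    qed
    finally show False using g x \<kappa> \<kappa>L L by linarith
  qed
  obtain N0 where "\<forall>c y. coprime c q \<longrightarrow> y \<ge> N0 \<longrightarrow> nrm (M c y) \<le> \<epsilon> / 2"
    using up[of "\<epsilon> / 2"] assms(2) \<open>L = 0\<close> by auto
  hence "\<forall>x\<ge>N0. \<forall>c. coprime c q \<longrightarrow> nrm (M c x) < \<epsilon>" using assms(2) by (smt (verit) field_sum_of_halves)
  thus ?thesis ..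
qed

end

section \<open>Ergodic systems\<close>

lemma funpow_mem: "(\<And>x. x \<in> S \<Longrightarrow> f x \<in> S) \<Longrightarrow> x \<in> S \<Longrightarrow> (f ^^ n) x \<in> S"
  by (induction n) auto

locale ergodic_sys =
  fixes \<mu> :: "'a measure" and T :: "'a \<Rightarrow> 'a"
  assumes erg: "ergodic_additive_system \<mu> T"
begin

sublocale prob_space \<mu>
  using erg by (simp add: ergodic_additive_system_def additive_system_def regular_prob_space_def)

definition Ti :: "'a \<Rightarrow> 'a" where "Ti = inv_into (space \<mu>) T"

lemma bij: "bij_betw T (space \<mu>) (space \<mu>)" and T_meas [measurable]: "T \<in> measurable \<mu> \<mu>"
  and Ti_meas [measurable]: "Ti \<in> measurable \<mu> \<mu>" and distr_T: "distr \<mu> \<mu> T = \<mu>"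
  using erg by (auto simp: ergodic_additive_system_def additive_system_def Ti_def)

lemma invariant_sets: "A \<in> sets \<mu> \<Longrightarrow> T -` A \<inter> space \<mu> = A \<Longrightarrow> prob A = 0 \<or> prob A = 1"
  using erg by (auto simp: ergodic_additive_system_def)

lemma T_space: "x \<in> space \<mu> \<Longrightarrow> T x \<in> space \<mu>" and Ti_space: "x \<in> space \<mu> \<Longrightarrow> Ti x \<in> space \<mu>"
  using measurable_space T_meas Ti_meas by metis+

lemma Ti_T: "x \<in> space \<mu> \<Longrightarrow> Ti (T x) = x"
  unfolding Ti_def using bij by (simp add: bij_betw_inv_into_left)

lemma T_Ti: "x \<in> space \<mu> \<Longrightarrow> T (Ti x) = x"
  unfolding Ti_def using bij by (simp add: bij_betw_inv_into_right)

lemma distr_Ti: "distr \<mu> \<mu> Ti = \<mu>"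
proof -
  have "distr \<mu> \<mu> Ti = distr (distr \<mu> \<mu> T) \<mu> Ti" by (simp add: distr_T)
  also have "\<dots> = distr \<mu> \<mu> (Ti \<circ> T)" by (rule distr_distr) auto
  also have "\<dots> = distr \<mu> \<mu> (\<lambda>x. x)" by (rule distr_cong) (auto simp: Ti_T)
  finally show ?thesis by simp
qed

abbreviation it :: "int \<Rightarrow> 'a \<Rightarrow> 'a" where "it \<equiv> int_iterate \<mu> T"

lemma it_space: "x \<in> space \<mu> \<Longrightarrow> it k x \<in> space \<mu>"
  unfolding int_iterate_def Ti_def[symmetric] by (auto intro!: funpow_mem T_space Ti_space)

lemma it_0 [simp]: "it 0 x = x"
  by (simp add: int_iterate_def)

lemma it_1 [simp]: "it 1 x = T x"
  by (simp add: int_iterate_def)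

lemma it_minus_1: "it (-1) x = Ti x"
  by (simp add: int_iterate_def Ti_def)

lemma it_Suc:
  assumes x: "x \<in> space \<mu>"
  shows "it (k + 1) x = T (it k x)"
proof (cases "k \<ge> 0")
  case True
  hence "nat (k + 1) = Suc (nat k)" by simp
  thus ?thesis using True by (simp add: int_iterate_def)
next
  case False
  define n where "n = nat (- k - 1)"
  have n: "nat (- k) = Suc n" "nat (- (k + 1)) = n" using False by (auto simp: n_def)
  have "it k x = Ti ((Ti ^^ n) x)" using False by (simp add: int_iterate_def n(1) Ti_def[symmetric])
  moreover have "it (k + 1) x = (Ti ^^ n) x"
  proof (cases "k + 1 \<ge> 0")
    case True
    hence "n = 0" "k + 1 = 0" using False by (auto simp: n_def)
    thus ?thesis by simp
  next
    case False
    thus ?thesis unfolding int_iterate_def n(2) Ti_def[symmetric] by simp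
  qed
  moreover have "(Ti ^^ n) x \<in> space \<mu>" using x by (auto intro!: funpow_mem Ti_space)
  ultimately show ?thesis by (simp add: T_Ti)
qed

lemma it_add:
  assumes x: "x \<in> space \<mu>"
  shows "it (k + l) x = it k (it l x)"
proof (induction k rule: int_induct[where k = 0])
  case (step1 k)
  have "it ((k + l) + 1) x = it (k + 1) (it l x)"
    using step1 x by (simp only: it_Suc it_space)
  thus ?case by (simp add: algebra_simps)
next
  case (step2 k)
  have "T (it (k - 1 + l) x) = T (it (k - 1) (it l x))"
    using step2 it_Suc[OF x, of "k - 1 + l"] it_Suc[OF it_space[OF x], of "k - 1" l] by simp
  thus ?case using Ti_T it_space x by metis
qed simp

lemma it_meas [measurable]: "it k \<in> measurable \<mu> \<mu>"
  unfolding int_iterate_def Ti_def[symmetric] by (auto intro!: measurable_compose_n)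

lemma distr_it: "distr \<mu> \<mu> (it k) = \<mu>"
proof (induction k rule: int_induct[where k = 0])
  case base
  have "distr \<mu> \<mu> (it 0) = distr \<mu> \<mu> (\<lambda>x. x)" by (rule distr_cong) auto
  thus ?case by simp
next
  case (step1 k)
  have "distr \<mu> \<mu> (it (k + 1)) = distr \<mu> \<mu> (T \<circ> it k)" by (rule distr_cong) (auto simp: it_Suc)
  also have "\<dots> = distr (distr \<mu> \<mu> (it k)) \<mu> T" by (rule distr_distr[symmetric]) auto
  finally show ?case by (simp add: step1 distr_T)
next
  case (step2 k)
  have "it (k - 1) x = Ti (it k x)" if "x \<in> space \<mu>" for x
    using it_add[OF that, of "-1" k] by (simp add: it_minus_1)
  hence "distr \<mu> \<mu> (it (k - 1)) = distr \<mu> \<mu> (Ti \<circ> it k)" by (intro distr_cong) auto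
  also have "\<dots> = distr (distr \<mu> \<mu> (it k)) \<mu> Ti" by (rule distr_distr[symmetric]) auto
  finally show ?case by (simp add: step2 distr_Ti)
qed

lemma integral_it:
  fixes f :: "'a \<Rightarrow> 'c :: {banach, second_countable_topology}"
  assumes "f \<in> borel_measurable \<mu>"
  shows "(\<integral>x. f (it k x) \<partial>\<mu>) = (\<integral>x. f x \<partial>\<mu>)"
  using integral_distr[OF it_meas[of k] assms] by (simp add: distr_it)

lemma nn_integral_it:
  assumes "f \<in> borel_measurable \<mu>"
  shows "(\<integral>\<^sup>+x. f (it k x) \<partial>\<mu>) = (\<integral>\<^sup>+x. f x \<partial>\<mu>)"
  using nn_integral_distr[OF it_meas[of k], of f] assms by (simp add: distr_it)

lemma integrable_it:
  fixes f :: "'a \<Rightarrow> 'c :: {banach, second_countable_topology}"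
  assumes "integrable \<mu> f"
  shows "integrable \<mu> (\<lambda>x. f (it k x))"
  using integrable_distr[OF it_meas[of k], of f] assms by (simp add: distr_it)

lemma AE_it:
  assumes [measurable]: "Measurable.pred \<mu> P" and "AE x in \<mu>. P x"
  shows "AE x in \<mu>. P (it k x)"
proof -
  have "AE x in distr \<mu> \<mu> (it k). P x" unfolding distr_it by (rule assms(2))
  thus ?thesis by (subst (asm) AE_distr_iff) auto
qed

text \<open>Ergodicity is stated for exactly invariant sets. The set B of points whose forward orbit
  eventually stays in A is exactly invariant, and it differs from A by a null set.\<close>

lemma almost_invariant_set:
  assumes A [measurable]: "A \<in> sets \<mu>" and inv: "AE x in \<mu>. T x \<in> A \<longleftrightarrow> x \<in> A"
  shows "prob A = 0 \<or> prob A = 1"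
proof -
  define B where "B = {x \<in> space \<mu>. \<exists>N. \<forall>n\<ge>N. it (int n) x \<in> A}"
  have B [measurable]: "B \<in> sets \<mu>" unfolding B_def by measurable
  have "T -` B \<inter> space \<mu> = B"
  proof (intro equalityI subsetI)
    fix x assume "x \<in> T -` B \<inter> space \<mu>"
    then obtain N where x: "x \<in> space \<mu>" and N: "\<And>n. n \<ge> N \<Longrightarrow> it (int n) (T x) \<in> A" by (auto simp: B_def)
    have "it (int n) x \<in> A" if n: "n \<ge> Suc N" for n
    proof -
      have e: "int (n - 1) + 1 = int n" using n by simp
      have "it (int n) x = it (int (n - 1)) (T x)" using it_add[OF x, of "int (n - 1)" 1] unfolding e by simp
      thus ?thesis using N[of "n - 1"] n by simp
    qed
    thus "x \<in> B" using x unfolding B_def by blast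
  next
    fix x assume "x \<in> B"
    then obtain N where x: "x \<in> space \<mu>" and N: "\<And>n. n \<ge> N \<Longrightarrow> it (int n) x \<in> A" by (auto simp: B_def)
    have "it (int n) (T x) \<in> A" if n: "n \<ge> N" for n
      using N[of "Suc n"] it_add[OF x, of "int n" 1] n by (simp add: add.commute)
    thus "x \<in> T -` B \<inter> space \<mu>" using x T_space unfolding B_def by blast
  qed
  hence 01: "prob B = 0 \<or> prob B = 1" by (rule invariant_sets[OF B])
  have "AE x in \<mu>. \<forall>n. it (int n) (T x) \<in> A \<longleftrightarrow> it (int n) x \<in> A"
  proof (subst AE_all_countable, rule allI)
    fix n
    have "AE x in \<mu>. T (it (int n) x) \<in> A \<longleftrightarrow> it (int n) x \<in> A"
      by (rule AE_it[OF _ inv]) measurable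
    thus "AE x in \<mu>. it (int n) (T x) \<in> A \<longleftrightarrow> it (int n) x \<in> A"
    proof (rule AE_mp, intro AE_I2 impI)
      fix x assume x: "x \<in> space \<mu>" and "T (it (int n) x) \<in> A \<longleftrightarrow> it (int n) x \<in> A"
      thus "it (int n) (T x) \<in> A \<longleftrightarrow> it (int n) x \<in> A"
        using it_add[OF x, of "int n" 1] it_Suc[OF x, of "int n"] by simp
    qed
  qed
  hence "AE x in \<mu>. x \<in> A \<longleftrightarrow> x \<in> B"
  proof (rule AE_mp, intro AE_I2 impI)
    fix x assume x: "x \<in> space \<mu>" and step: "\<forall>n. it (int n) (T x) \<in> A \<longleftrightarrow> it (int n) x \<in> A"
    have "it (int n) x \<in> A \<longleftrightarrow> x \<in> A" for n
    proof (induction n)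
      case (Suc n)
      thus ?case using step it_add[OF x, of "int n" 1] by (simp add: add.commute)
    qed simp
    thus "x \<in> A \<longleftrightarrow> x \<in> B" using x by (auto simp: B_def)
  qed
  hence "prob A = prob B" by (intro finite_measure_eq_AE) auto
  with 01 show ?thesis by simp
qed

text \<open>Sublevel sets are almost invariant, so the distribution function of u takes only the
  values 0 and 1; u equals the point of the jump almost everywhere.\<close>

lemma almost_invariant_const:
  fixes u :: "'a \<Rightarrow> real"
  assumes u [measurable]: "u \<in> borel_measurable \<mu>" and inv: "AE x in \<mu>. u (T x) = u x"
  shows "\<exists>c. AE x in \<mu>. u x = c"
proof -
  interpret D: real_distribution "distr \<mu> borel u" by (rule real_distribution_distr) measurable
  define \<phi> where "\<phi> = cdf (distr \<mu> borel u)"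
  have \<phi>: "\<phi> t = prob {x \<in> space \<mu>. u x \<le> t}" for t
    by (simp add: \<phi>_def cdf_def measure_distr vimage_def Int_def conj_commute)
  have 01: "\<phi> t = 0 \<or> \<phi> t = 1" for t
    unfolding \<phi>
  proof (rule almost_invariant_set)
    show "AE x in \<mu>. (T x \<in> {x \<in> space \<mu>. u x \<le> t}) = (x \<in> {x \<in> space \<mu>. u x \<le> t})"
      using inv by (rule AE_mp) (auto intro!: AE_I2 simp: T_space)
  qed measurable
  have mono: "\<phi> s \<le> \<phi> t" if "s \<le> t" for s t
    unfolding \<phi>_def using that by (rule D.cdf_nondecreasing)
  define X where "X = {t. \<phi> t = 1}"
  have "(\<phi> \<longlongrightarrow> 1) at_top" unfolding \<phi>_def by (rule D.cdf_lim_at_top_prob)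
  hence "\<forall>\<^sub>F t in at_top. \<phi> t > 0" by (rule order_tendstoD) simp
  then obtain t1 where "\<phi> t1 > 0" by (auto simp: eventually_at_top_linorder)
  hence ne: "X \<noteq> {}" using 01[of t1] by (auto simp: X_def)
  have "(\<phi> \<longlongrightarrow> 0) at_bot" unfolding \<phi>_def by (rule D.cdf_lim_at_bot)
  hence "\<forall>\<^sub>F t in at_bot. \<phi> t < 1" by (rule order_tendstoD) simp
  then obtain t0 where t0: "\<phi> t0 < 1" by (auto simp: eventually_at_bot_linorder)
  have bdd: "bdd_below X"
  proof (rule bdd_belowI[of _ t0])
    fix t assume "t \<in> X"
    thus "t0 \<le> t" using mono[of t t0] t0 by (cases "t0 \<le> t") (auto simp: X_def)
  qed
  define c where "c = Inf X"
  have up: "AE x in \<mu>. u x \<le> c + 1 / real (Suc n)" for n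
  proof -
    have "Inf X < c + 1 / real (Suc n)" by (simp add: c_def)
    then obtain t where "t \<in> X" "t < c + 1 / real (Suc n)" using cInf_lessD[OF ne] by blast
    hence "\<phi> (c + 1 / real (Suc n)) = 1" using mono[of t "c + 1 / real (Suc n)"] 01[of "c + 1 / real (Suc n)"] by (auto simp: X_def)
    hence "prob {x \<in> space \<mu>. u x \<le> c + 1 / real (Suc n)} = 1" by (simp only: \<phi>)
    hence "AE x in \<mu>. x \<in> {x \<in> space \<mu>. u x \<le> c + 1 / real (Suc n)}" by (rule AE_prob_1)
    thus ?thesis by eventually_elim simp
  qed
  have lo: "AE x in \<mu>. u x > c - 1 / real (Suc n)" for n
  proof -
    have "c - 1 / real (Suc n) \<notin> X" using cInf_lower[OF _ bdd, of "c - 1 / real (Suc n)"] by (auto simp: c_def)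
    hence "\<phi> (c - 1 / real (Suc n)) = 0" using 01[of "c - 1 / real (Suc n)"] by (auto simp: X_def)
    hence "prob {x \<in> space \<mu>. u x \<le> c - 1 / real (Suc n)} = 0" by (simp only: \<phi>)
    hence "AE x in \<mu>. x \<notin> {x \<in> space \<mu>. u x \<le> c - 1 / real (Suc n)}" by (subst (asm) prob_eq_0) measurable
    thus ?thesis using AE_space by eventually_elim auto
  qed
  have "AE x in \<mu>. \<forall>n. u x \<le> c + 1 / real (Suc n) \<and> u x > c - 1 / real (Suc n)"
    unfolding AE_all_countable using up lo by (auto intro: AE_conjI)
  hence "AE x in \<mu>. u x = c"
  proof (rule AE_mp, intro AE_I2 impI)
    fix x assume *: "\<forall>n. u x \<le> c + 1 / real (Suc n) \<and> u x > c - 1 / real (Suc n)"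
    show "u x = c"
    proof (rule ccontr)
      assume "u x \<noteq> c"
      then obtain n where "1 / real (Suc n) < \<bar>u x - c\<bar>" using nat_approx_posE[of "\<bar>u x - c\<bar>"] by auto
      with * show False by (smt (verit))
    qed
  qed
  thus ?thesis ..
qed

end

text \<open>Finitely supported coefficient families on \<open>\<int>\<close>, standing for the linear combinations of the
  functions \<open>F \<circ> T\<^sup>k\<close>. The \<open>L\<^sup>2\<close> inner product of those is only a semi-inner product on coefficients.\<close>

typedef coeffs = "{f :: int \<Rightarrow> real. finite {k. f k \<noteq> 0}}"
  morphisms weight Coeffs
  by (rule exI[of _ "\<lambda>_. 0"]) simp

setup_lifting type_definition_coeffs

instantiation coeffs :: real_vector
begin

lift_definition zero_coeffs :: coeffs is "\<lambda>_. 0" by simp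

lift_definition plus_coeffs :: "coeffs \<Rightarrow> coeffs \<Rightarrow> coeffs" is "\<lambda>f g k. f k + g k"
proof -
  fix f g :: "int \<Rightarrow> real" assume "finite {k. f k \<noteq> 0}" "finite {k. g k \<noteq> 0}"
  thus "finite {k. f k + g k \<noteq> 0}" by (rule finite_subset[rotated, OF finite_UnI]) auto
qed

lift_definition minus_coeffs :: "coeffs \<Rightarrow> coeffs \<Rightarrow> coeffs" is "\<lambda>f g k. f k - g k"
proof -
  fix f g :: "int \<Rightarrow> real" assume "finite {k. f k \<noteq> 0}" "finite {k. g k \<noteq> 0}"
  thus "finite {k. f k - g k \<noteq> 0}" by (rule finite_subset[rotated, OF finite_UnI]) auto
qed

lift_definition uminus_coeffs :: "coeffs \<Rightarrow> coeffs" is "\<lambda>f k. - f k" by simp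

lift_definition scaleR_coeffs :: "real \<Rightarrow> coeffs \<Rightarrow> coeffs" is "\<lambda>t f k. t * f k"
proof -
  fix t and f :: "int \<Rightarrow> real" assume "finite {k. f k \<noteq> 0}"
  thus "finite {k. t * f k \<noteq> 0}" by (rule finite_subset[rotated]) auto
qed

instance
  by standard (transfer; simp add: fun_eq_iff algebra_simps)+

end

lift_definition unit_coeffs :: coeffs is "\<lambda>k. if k = 0 then 1 else 0" by simp

lift_definition shift_coeffs :: "int \<Rightarrow> coeffs \<Rightarrow> coeffs" is "\<lambda>l f k. f (k - l)"
proof -
  fix l and f :: "int \<Rightarrow> real" assume "finite {k. f k \<noteq> 0}"
  hence "finite ((\<lambda>k. k + l) ` {k. f k \<noteq> 0})" by simp
  thus "finite {k. f (k - l) \<noteq> 0}"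
    by (rule finite_subset[rotated]) (auto simp: image_iff intro!: exI[of _ "_ - l"])
qed

lemma finite_weight: "finite {k. weight v k \<noteq> 0}"
  using weight[of v] by simp

section \<open>Square-integrable functions\<close>

lemma L2_fun_add:
  assumes "L2_fun M f" "L2_fun M g"
  shows "L2_fun M (\<lambda>x. f x + g x)"
proof -
  have [measurable]: "f \<in> borel_measurable M" "g \<in> borel_measurable M" using assms by (auto simp: L2_fun_def)
  have int: "integrable M (\<lambda>x. 2 * (cmod (f x))\<^sup>2 + 2 * (cmod (g x))\<^sup>2)"
    using assms by (intro Bochner_Integration.integrable_add integrable_mult_right) (auto simp: L2_fun_def)
  have le: "(cmod (u + v))\<^sup>2 \<le> 2 * (cmod u)\<^sup>2 + 2 * (cmod v)\<^sup>2" for u v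
  proof -
    have "(cmod (u + v))\<^sup>2 \<le> (cmod u + cmod v)\<^sup>2" by (intro power_mono norm_triangle_ineq) simp
    also have "\<dots> \<le> 2 * (cmod u)\<^sup>2 + 2 * (cmod v)\<^sup>2"
      using sum_squares_bound[of "cmod u" "cmod v"] by (simp add: power2_sum)
    finally show ?thesis .
  qed
  have "integrable M (\<lambda>x. (cmod (f x + g x))\<^sup>2)"
    by (rule Bochner_Integration.integrable_bound[OF int]) (auto intro!: AE_I2 order_trans[OF le])
  thus ?thesis by (simp add: L2_fun_def)
qed

lemma L2_fun_scale: "L2_fun M f \<Longrightarrow> L2_fun M (\<lambda>x. t *\<^sub>R f x)"
  by (auto simp: L2_fun_def power_mult_distrib)

lemma L2_fun_0: "L2_fun M (\<lambda>x. 0)"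
  by (simp add: L2_fun_def)

lemma L2_fun_sum: "(\<And>i. i \<in> I \<Longrightarrow> L2_fun M (f i)) \<Longrightarrow> L2_fun M (\<lambda>x. \<Sum>i\<in>I. f i x)"
  by (induction I rule: infinite_finite_induct) (auto simp: L2_fun_0 L2_fun_add)

lemma L2_fun_diff: "L2_fun M f \<Longrightarrow> L2_fun M g \<Longrightarrow> L2_fun M (\<lambda>x. f x - g x)"
  using L2_fun_add[of M f "\<lambda>x. (-1) *\<^sub>R g x"] L2_fun_scale[of M g "-1"] by simp

lemma L2_fun_inner:
  assumes "L2_fun M f" "L2_fun M g"
  shows "integrable M (\<lambda>x. inner (f x) (g x))"
proof -
  have [measurable]: "f \<in> borel_measurable M" "g \<in> borel_measurable M" using assms by (auto simp: L2_fun_def)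
  have int: "integrable M (\<lambda>x. (cmod (f x))\<^sup>2 + (cmod (g x))\<^sup>2)"
    using assms by (intro Bochner_Integration.integrable_add) (auto simp: L2_fun_def)
  have le: "\<bar>inner u v\<bar> \<le> (cmod u)\<^sup>2 + (cmod v)\<^sup>2" for u v :: complex
  proof -
    have "\<bar>inner u v\<bar> \<le> cmod u * cmod v" by (rule Cauchy_Schwarz_ineq2)
    moreover have "2 * (cmod u * cmod v) \<le> (cmod u)\<^sup>2 + (cmod v)\<^sup>2" using sum_squares_bound[of "cmod u" "cmod v"] by simp
    moreover have "cmod u * cmod v \<ge> 0" by simp
    ultimately show ?thesis by linarith
  qed
  show ?thesis by (rule Bochner_Integration.integrable_bound[OF int]) (auto intro!: AE_I2 order_trans[OF le])
qed

context prob_space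
begin

lemma L2_fun_const: "L2_fun M (\<lambda>_. c)"
  by (simp add: L2_fun_def)

text \<open>Integrated form of 2 e |u| \<le> |u|^2 + e^2, in place of Cauchy-Schwarz: when the
  integral of |f|^2 is at most e^2, that of |f| is at most e.\<close>

lemma L2_fun_norm_bound:
  assumes "L2_fun M f" "e > 0"
  shows "integrable M f" "(\<integral>x. cmod (f x) \<partial>M) \<le> (e + (\<integral>x. (cmod (f x))\<^sup>2 \<partial>M) / e) / 2"
proof -
  have [measurable]: "f \<in> borel_measurable M" and sq: "integrable M (\<lambda>x. (cmod (f x))\<^sup>2)"
    using assms by (auto simp: L2_fun_def)
  have le: "cmod u \<le> (e + (cmod u)\<^sup>2 / e) / 2" for u
  proof -
    have "2 * (cmod u * e) \<le> (cmod u)\<^sup>2 + e\<^sup>2" using sum_squares_bound[of "cmod u" e] by simp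
    thus ?thesis using assms(2) by (simp add: field_simps power2_eq_square)
  qed
  have int: "integrable M (\<lambda>x. (e + (cmod (f x))\<^sup>2 / e) / 2)" using sq by simp
  show i: "integrable M f"
  proof (rule Bochner_Integration.integrable_bound[OF int])
    show "AE x in M. norm (f x) \<le> norm ((e + (cmod (f x))\<^sup>2 / e) / 2)"
      unfolding real_norm_def by (rule AE_I2) (rule order_trans[OF le abs_ge_self])
  qed simp
  have "(\<integral>x. cmod (f x) \<partial>M) \<le> (\<integral>x. (e + (cmod (f x))\<^sup>2 / e) / 2 \<partial>M)"
    using i int by (intro integral_mono le) auto
  also have "\<dots> = (e + (\<integral>x. (cmod (f x))\<^sup>2 \<partial>M) / e) / 2" using sq by (simp add: prob_space)
  finally show "(\<integral>x. cmod (f x) \<partial>M) \<le> (e + (\<integral>x. (cmod (f x))\<^sup>2 \<partial>M) / e) / 2" .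
qed

end

locale ergodic_L2 = ergodic_sys +
  fixes F :: "'a \<Rightarrow> complex"
  assumes F: "L2_fun \<mu> F"
begin

lemma L2_fun_it: "L2_fun \<mu> f \<Longrightarrow> L2_fun \<mu> (\<lambda>x. f (it k x))"
  unfolding L2_fun_def using integrable_it[of "\<lambda>x. (cmod (f x))\<^sup>2" k] by auto

definition ev :: "coeffs \<Rightarrow> 'a \<Rightarrow> complex" where
  "ev v x = (\<Sum>k | weight v k \<noteq> 0. weight v k *\<^sub>R F (it k x))"

lemma ev_eq:
  assumes "finite A" "{k. weight v k \<noteq> 0} \<subseteq> A"
  shows "ev v x = (\<Sum>k\<in>A. weight v k *\<^sub>R F (it k x))"
  unfolding ev_def using assms by (intro sum.mono_neutral_left) auto

lemma ev_add: "ev (v + w) x = ev v x + ev w x"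
proof -
  define A where "A = {k. weight v k \<noteq> 0} \<union> {k. weight w k \<noteq> 0}"
  have A: "finite A" by (simp add: A_def finite_weight)
  have wt: "weight (v + w) k = weight v k + weight w k" for k by transfer simp
  show ?thesis
    by (subst (1 2 3) ev_eq[OF A]) (auto simp: A_def wt scaleR_add_left sum.distrib)
qed

lemma ev_scale: "ev (t *\<^sub>R v) x = t *\<^sub>R ev v x"
proof -
  have A: "finite {k. weight v k \<noteq> 0}" by (rule finite_weight)
  have wt: "weight (t *\<^sub>R v) k = t * weight v k" for k by transfer simp
  show ?thesis
    by (subst (1 2) ev_eq[OF A]) (auto simp: wt scaleR_sum_right)
qed

lemma ev_minus: "ev (v - w) x = ev v x - ev w x"
  using ev_add[of v "(-1) *\<^sub>R w" x] ev_scale[of "-1" w x] by simp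

lemma ev_sum: "ev (\<Sum>i\<in>I. v i) x = (\<Sum>i\<in>I. ev (v i) x)"
proof (induction I rule: infinite_finite_induct)
  case empty
  show ?case using ev_scale[of 0 0 x] by simp
next
  case (infinite I)
  thus ?case using ev_scale[of 0 0 x] by simp
qed (auto simp: ev_add)

lemma ev_shift:
  assumes x: "x \<in> space \<mu>"
  shows "ev (shift_coeffs l v) x = ev v (it l x)"
proof -
  have wt: "weight (shift_coeffs l v) k = weight v (k - l)" for k by transfer simp
  show ?thesis
    unfolding ev_def wt
    by (rule sum.reindex_bij_witness[of _ "\<lambda>k. k + l" "\<lambda>k. k - l"])
       (auto simp: it_add[OF x, symmetric])
qed

lemma ev_unit: "ev unit_coeffs x = F x"
proof -
  have wt: "weight unit_coeffs k = (if k = 0 then 1 else 0)" for k by transfer simp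
  show ?thesis by (subst ev_eq[of "{0}"]) (auto simp: wt)
qed

lemma ev_L2: "L2_fun \<mu> (ev v)"
  unfolding ev_def by (intro L2_fun_sum L2_fun_scale L2_fun_it F)

lemma ev_meas [measurable]: "ev v \<in> borel_measurable \<mu>"
  using ev_L2 by (simp add: L2_fun_def)

text \<open>The real part of the Hermitian product: complex values are treated as real vectors,
  which leaves the norm unchanged.\<close>

definition ip :: "coeffs \<Rightarrow> coeffs \<Rightarrow> real" where
  "ip v w = (\<integral>x. inner (ev v x) (ev w x) \<partial>\<mu>)"

sublocale isometric_action ip shift_coeffs
proof
  note int = L2_fun_inner[OF ev_L2 ev_L2]
  show "ip (x + y) z = ip x z + ip y z" for x y z
    unfolding ip_def ev_add inner_add_left by (rule Bochner_Integration.integral_add[OF int int])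
  show "ip (t *\<^sub>R x) z = t * ip x z" for t x z
    unfolding ip_def ev_scale inner_scaleR_left by simp
  show "ip x y = ip y x" for x y by (simp add: ip_def inner_commute)
  show "ip x x \<ge> 0" for x by (simp add: ip_def)
  show "shift_coeffs k (x + y) = shift_coeffs k x + shift_coeffs k y" for k x y by transfer simp
  show "shift_coeffs k (t *\<^sub>R x) = t *\<^sub>R shift_coeffs k x" for k t x by transfer simp
  show "shift_coeffs k (shift_coeffs l x) = shift_coeffs (k + l) x" for k l x
    by transfer (simp add: fun_eq_iff algebra_simps)
  show "ip (shift_coeffs k x) (shift_coeffs k y) = ip x y" for k x y
  proof -
    have "ip (shift_coeffs k x) (shift_coeffs k y) = (\<integral>z. inner (ev x (it k z)) (ev y (it k z)) \<partial>\<mu>)"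
      unfolding ip_def by (rule Bochner_Integration.integral_cong) (auto simp: ev_shift)
    also have "\<dots> = ip x y" unfolding ip_def by (rule integral_it) measurable
    finally show ?thesis .
  qed
qed

lemma nrm_sq_eq: "(nrm v)\<^sup>2 = (\<integral>x. (cmod (ev v x))\<^sup>2 \<partial>\<mu>)"
  by (simp add: nrm_sq ip_def power2_norm_eq_inner)

lemma nrm_eq: "nrm v = L2_norm \<mu> (ev v)"
  by (simp add: nrm_def ip_def L2_norm_def power2_norm_eq_inner)

lemma nn_nrm: "(\<integral>\<^sup>+x. ennreal ((cmod (ev v x))\<^sup>2) \<partial>\<mu>) = ennreal ((nrm v)\<^sup>2)"
  unfolding nrm_sq_eq using ev_L2[of v] by (intro nn_integral_eq_integral) (auto simp: L2_fun_def)


text \<open>The counterpart of \<open>orbit_hull\<close>, set up before any function a or modulus is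
  chosen, as minimising the norm over it concerns F and T alone.\<close>

inductive_set orb :: "coeffs set" where
  base: "unit_coeffs \<in> orb"
| shift: "v \<in> orb \<Longrightarrow> shift_coeffs 1 v \<in> orb"
| midpoint: "v \<in> orb \<Longrightarrow> w \<in> orb \<Longrightarrow> (1 / 2) *\<^sub>R (v + w) \<in> orb"

lemma integrable_ev: "integrable \<mu> (ev v)"
  using L2_fun_norm_bound(1)[OF ev_L2, of 1] by simp

lemma integral_orb:
  assumes "v \<in> orb"
  shows "(\<integral>x. ev v x \<partial>\<mu>) = (\<integral>x. F x \<partial>\<mu>)"
  using assms
proof induction
  case base
  show ?case by (simp add: ev_unit)
next
  case (shift v)
  have "(\<integral>x. ev (shift_coeffs 1 v) x \<partial>\<mu>) = (\<integral>x. ev v (it 1 x) \<partial>\<mu>)"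
    by (rule Bochner_Integration.integral_cong) (simp_all add: ev_shift)
  also have "\<dots> = (\<integral>x. ev v x \<partial>\<mu>)" by (rule integral_it) measurable
  finally show ?case using shift by simp
next
  case (midpoint v w)
  have "(\<integral>x. ev ((1 / 2) *\<^sub>R (v + w)) x \<partial>\<mu>) = (1 / 2) *\<^sub>R ((\<integral>x. ev v x \<partial>\<mu>) + (\<integral>x. ev w x \<partial>\<mu>))"
    unfolding ev_scale ev_add integral_scaleR_right
    by (subst Bochner_Integration.integral_add) (auto intro: integrable_ev)
  thus ?case using midpoint by (simp add: scaleR_conv_of_real)
qed

text \<open>Elements of nearly minimal norm form a Cauchy family and are nearly invariant, by the
  parallelogram law; their limit is an invariant function, hence constant.\<close>

lemma small_orb:
  assumes zero: "(\<integral>x. F x \<partial>\<mu>) = 0" and \<epsilon>: "\<epsilon> > 0"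
  shows "\<exists>g\<in>orb. nrm g < \<epsilon>"
proof -
  define l where "l = Inf (nrm ` orb)"
  have ne: "nrm ` orb \<noteq> {}" using orb.base by blast
  have bdd: "bdd_below (nrm ` orb)" by (rule bdd_belowI[of _ 0]) auto
  have l_le: "l \<le> nrm v" if "v \<in> orb" for v unfolding l_def using that by (intro cInf_lower bdd) auto
  have l0: "l \<ge> 0" unfolding l_def by (rule cInf_greatest[OF ne]) auto
  define e where "e = (\<lambda>n. 1 / real (Suc n))"
  have e: "e n > 0" "e n \<le> e m" if "m \<le> n" for m n using that by (auto simp: e_def frac_le)
  \<comment> \<open>This is 4 (l + e n)^2 - (2 l)^2, the parallelogram bound for two elements of
    norm at most l + e n whose midpoint has norm at least l.\<close>
  define \<eta> where "\<eta> = (\<lambda>n. 4 * e n * (2 * l + e n))"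
  have \<eta>0: "\<eta> n \<ge> 0" for n using e(1)[of n n] l0 by (simp add: \<eta>_def)
  have \<eta>_lim: "\<eta> \<longlonglongrightarrow> 0" unfolding \<eta>_def e_def by real_asymp
  have close: "(nrm (v - w))\<^sup>2 \<le> \<eta> n" if "v \<in> orb" "w \<in> orb" "nrm v \<le> l + e n" "nrm w \<le> l + e n" for v w n
  proof -
    have "(nrm (v - w))\<^sup>2 + (nrm (v + w))\<^sup>2 = 2 * (nrm v)\<^sup>2 + 2 * (nrm w)\<^sup>2"
      by (simp add: nrm_sq ip_diff ip_diff_right ip_add ip_add_right ip_sym[of w v])
    moreover have "(2 * l)\<^sup>2 \<le> (nrm (v + w))\<^sup>2"
    proof (rule power_mono)
      show "2 * l \<le> nrm (v + w)" using l_le[OF orb.midpoint[OF that(1,2)]] by (simp add: nrm_scale)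
    qed (use l0 in simp)
    moreover have "(nrm v)\<^sup>2 \<le> (l + e n)\<^sup>2" "(nrm w)\<^sup>2 \<le> (l + e n)\<^sup>2" using that by (auto intro: power_mono)
    ultimately have "(nrm (v - w))\<^sup>2 \<le> 4 * (l + e n)\<^sup>2 - (2 * l)\<^sup>2" by linarith
    also have "\<dots> = \<eta> n" by (simp add: \<eta>_def power2_eq_square algebra_simps)
    finally show ?thesis .
  qed
  have "\<exists>g\<in>orb. nrm g \<le> l + e n" for n
  proof -
    have "Inf (nrm ` orb) < l + e n" using e(1)[of n n] by (simp add: l_def)
    from cInf_lessD[OF ne this] show ?thesis by (auto intro: less_imp_le)
  qed
  then obtain g where g: "\<And>n. g n \<in> orb" "\<And>n. nrm (g n) \<le> l + e n" by metis
  have g_close: "(nrm (g m - g n))\<^sup>2 \<le> \<eta> k" if "k \<le> m" "k \<le> n" for k m n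
  proof (rule close[OF g(1) g(1)])
    show "nrm (g m) \<le> l + e k" "nrm (g n) \<le> l + e k"
      using g(2)[of m] g(2)[of n] e(2)[OF that(1)] e(2)[OF that(2)] by linarith+
  qed
  define f where "f = (\<lambda>n. ev (g n))"
  have f_meas [measurable]: "f n \<in> borel_measurable \<mu>" for n by (simp add: f_def)
  have f_int: "integrable \<mu> (f n)" for n by (simp add: f_def integrable_ev)
  have f_diff: "L2_fun \<mu> (\<lambda>x. f m x - f n x)" "(\<integral>x. (cmod (f m x - f n x))\<^sup>2 \<partial>\<mu>) = (nrm (g m - g n))\<^sup>2" for m n
  proof -
    have eq: "(\<lambda>x. f m x - f n x) = ev (g m - g n)" by (rule ext) (simp add: f_def ev_minus)
    show "L2_fun \<mu> (\<lambda>x. f m x - f n x)" unfolding eq by (rule ev_L2)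
    show "(\<integral>x. (cmod (f m x - f n x))\<^sup>2 \<partial>\<mu>) = (nrm (g m - g n))\<^sup>2"
      by (simp add: nrm_sq_eq f_def ev_minus)
  qed
  have cauchy: "\<exists>N. \<forall>i\<ge>N. \<forall>j\<ge>N. LINT x|\<mu>. norm (f i x - f j x) < d" if d: "d > 0" for d
  proof -
    have "\<forall>\<^sub>F n in sequentially. \<eta> n < d * d" using order_tendstoD(2)[OF \<eta>_lim, of "d * d"] d by simp
    then obtain N where N: "\<eta> N < d * d" by (auto simp: eventually_at_top_linorder)
    have "LINT x|\<mu>. norm (f i x - f j x) < d" if "i \<ge> N" "j \<ge> N" for i j
    proof -
      have "LINT x|\<mu>. norm (f i x - f j x) \<le> (d + (nrm (g i - g j))\<^sup>2 / d) / 2"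
        using L2_fun_norm_bound(2)[OF f_diff(1) d, of i j] by (simp add: f_diff(2))
      also have "(nrm (g i - g j))\<^sup>2 / d \<le> \<eta> N / d" using g_close[OF that] d by (intro divide_right_mono) auto
      also have "\<eta> N / d < d" using N d by (simp add: pos_divide_less_eq)
      finally show ?thesis by simp
    qed
    thus ?thesis by blast
  qed
  obtain r where r: "strict_mono r" "AE x in \<mu>. Cauchy (\<lambda>i. f (r i) x)"
    using cauchy_L1_AE_cauchy_subseq[OF f_int cauchy] by blast
  define h where "h = (\<lambda>x. lim (\<lambda>i. f (r i) x))"
  have h_meas [measurable]: "h \<in> borel_measurable \<mu>" unfolding h_def by measurable
  have h_lim: "AE x in \<mu>. (\<lambda>i. f (r i) x) \<longlonglongrightarrow> h x"
    using r(2) unfolding h_def by eventually_elim (simp add: Cauchy_convergent convergent_LIMSEQ_iff[symmetric])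
  define N2 where "N2 = (\<lambda>u :: 'a \<Rightarrow> complex. \<integral>\<^sup>+x. ennreal ((cmod (u x))\<^sup>2) \<partial>\<mu>)"
  \<comment> \<open>Fatou's lemma: h is a pointwise limit only along the subsequence r, but the
    bound for |g m - g (r i)| holds as soon as i \<ge> m.\<close>
  have N2f: "N2 (\<lambda>x. f m x - h x) \<le> ennreal (\<eta> m)" for m
  proof -
    have "N2 (\<lambda>x. f m x - h x) = (\<integral>\<^sup>+x. liminf (\<lambda>i. ennreal ((cmod (f m x - f (r i) x))\<^sup>2)) \<partial>\<mu>)"
      unfolding N2_def
    proof (rule nn_integral_cong_AE, use h_lim in eventually_elim)
      fix x assume "(\<lambda>i. f (r i) x) \<longlonglongrightarrow> h x"
      hence "(\<lambda>i. ennreal ((cmod (f m x - f (r i) x))\<^sup>2)) \<longlonglongrightarrow> ennreal ((cmod (f m x - h x))\<^sup>2)"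
        by (intro tendsto_intros)
      from lim_imp_Liminf[OF sequentially_bot this]
      show "ennreal ((cmod (f m x - h x))\<^sup>2) = liminf (\<lambda>i. ennreal ((cmod (f m x - f (r i) x))\<^sup>2))" ..
    qed
    also have "\<dots> \<le> liminf (\<lambda>i. \<integral>\<^sup>+x. ennreal ((cmod (f m x - f (r i) x))\<^sup>2) \<partial>\<mu>)"
      by (rule nn_integral_liminf) measurable
    also have "\<dots> = liminf (\<lambda>i. ennreal ((nrm (g m - g (r i)))\<^sup>2))"
      by (simp only: f_def ev_minus[symmetric] nn_nrm)
    also have "\<dots> \<le> limsup (\<lambda>i. ennreal ((nrm (g m - g (r i)))\<^sup>2))" by (rule Liminf_le_Limsup) simp
    also have "\<dots> \<le> ennreal (\<eta> m)"
    proof (rule Limsup_bounded, use eventually_ge_at_top[of m] in eventually_elim)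
      fix i assume "m \<le> i"
      hence "m \<le> r i" using seq_suble[OF r(1), of i] by linarith
      thus "ennreal ((nrm (g m - g (r i)))\<^sup>2) \<le> ennreal (\<eta> m)" by (intro ennreal_leI g_close) auto
    qed
    finally show ?thesis .
  qed
  have three: "(cmod (u + v + w))\<^sup>2 \<le> 3 * ((cmod u)\<^sup>2 + (cmod v)\<^sup>2 + (cmod w)\<^sup>2)" for u v w
  proof -
    have "(cmod (u + v + w))\<^sup>2 \<le> (cmod u + cmod v + cmod w)\<^sup>2"
      by (intro power_mono order_trans[OF norm_triangle_ineq] add_mono norm_triangle_ineq) auto
    also have "\<dots> \<le> 3 * ((cmod u)\<^sup>2 + (cmod v)\<^sup>2 + (cmod w)\<^sup>2)"
      using sum_squares_bound[of "cmod u" "cmod v"] sum_squares_bound[of "cmod u" "cmod w"] sum_squares_bound[of "cmod v" "cmod w"]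
      by (simp add: power2_eq_square algebra_simps)
    finally show ?thesis .
  qed
  \<comment> \<open>Insert f m o T and f m between h o T and h. The outer differences are controlled
    by \<open>N2f\<close>; the middle one is small because the shift of g m lies in
    \<open>orb\<close> with the same nearly minimal norm. The factor 3 is from squaring a sum of
    three terms, each with bound \<eta> m.\<close>
  have hT: "N2 (\<lambda>x. h (T x) - h x) \<le> ennreal (9 * \<eta> m)" for m
  proof -
    define u v w where "u = (\<lambda>x. h (it 1 x) - f m (it 1 x))" and "v = (\<lambda>x. f m (it 1 x) - f m x)" and "w = (\<lambda>x. f m x - h x)"
    have [measurable]: "u \<in> borel_measurable \<mu>" "v \<in> borel_measurable \<mu>" "w \<in> borel_measurable \<mu>"
      unfolding u_def v_def w_def by measurable
    have "N2 (\<lambda>x. h (T x) - h x) \<le> (\<integral>\<^sup>+x. 3 * (ennreal ((cmod (u x))\<^sup>2) + ennreal ((cmod (v x))\<^sup>2) + ennreal ((cmod (w x))\<^sup>2)) \<partial>\<mu>)"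
      unfolding N2_def
    proof (rule nn_integral_mono)
      fix x
      have "ennreal ((cmod (h (T x) - h x))\<^sup>2) = ennreal ((cmod (u x + v x + w x))\<^sup>2)" by (simp add: u_def v_def w_def)
      also have "\<dots> \<le> ennreal (3 * ((cmod (u x))\<^sup>2 + (cmod (v x))\<^sup>2 + (cmod (w x))\<^sup>2))" by (intro ennreal_leI three)
      also have "\<dots> = 3 * (ennreal ((cmod (u x))\<^sup>2) + ennreal ((cmod (v x))\<^sup>2) + ennreal ((cmod (w x))\<^sup>2))"
        by (simp add: ennreal_mult' ennreal_plus)
      finally show "ennreal ((cmod (h (T x) - h x))\<^sup>2) \<le> 3 * (ennreal ((cmod (u x))\<^sup>2) + ennreal ((cmod (v x))\<^sup>2) + ennreal ((cmod (w x))\<^sup>2))" .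
    qed
    also have "\<dots> = 3 * (N2 u + N2 v + N2 w)" unfolding N2_def
      by (simp add: nn_integral_cmult nn_integral_add)
    also have "N2 u = N2 (\<lambda>x. f m x - h x)"
    proof -
      have "N2 u = (\<integral>\<^sup>+x. ennreal ((cmod (h (it 1 x) - f m (it 1 x)))\<^sup>2) \<partial>\<mu>)" by (simp add: N2_def u_def)
      also have "\<dots> = (\<integral>\<^sup>+x. ennreal ((cmod (h x - f m x))\<^sup>2) \<partial>\<mu>)"
        by (rule nn_integral_it[where f = "\<lambda>x. ennreal ((cmod (h x - f m x))\<^sup>2)"]) measurable
      finally show ?thesis by (simp add: N2_def norm_minus_commute)
    qed
    also have "N2 v = ennreal ((nrm (shift_coeffs 1 (g m) - g m))\<^sup>2)"
      unfolding nn_nrm[symmetric] N2_def v_def f_def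
      by (rule nn_integral_cong) (simp add: ev_minus ev_shift)
    also have "3 * (N2 (\<lambda>x. f m x - h x) + ennreal ((nrm (shift_coeffs 1 (g m) - g m))\<^sup>2) + N2 w) \<le>
        3 * (ennreal (\<eta> m) + ennreal (\<eta> m) + ennreal (\<eta> m))"
    proof (intro mult_left_mono add_mono N2f)
      show "ennreal ((nrm (shift_coeffs 1 (g m) - g m))\<^sup>2) \<le> ennreal (\<eta> m)"
        using g by (intro ennreal_leI close orb.shift) auto
      show "N2 w \<le> ennreal (\<eta> m)" unfolding w_def by (rule N2f)
    qed simp
    also have "\<dots> = ennreal (9 * \<eta> m)"
    proof -
      have "ennreal (9 * \<eta> m) = ennreal (3 * (\<eta> m + \<eta> m + \<eta> m))" by simp
      also have "\<dots> = 3 * (ennreal (\<eta> m) + ennreal (\<eta> m) + ennreal (\<eta> m))"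
        using \<eta>0[of m] by (simp only: ennreal_mult' ennreal_plus add_nonneg_nonneg) simp
      finally show ?thesis ..
    qed
    finally show ?thesis .
  qed
  have "N2 (\<lambda>x. h (T x) - h x) \<le> 0"
  proof (rule tendsto_lowerbound)
    have "(\<lambda>m. 9 * \<eta> m) \<longlonglongrightarrow> 0" using tendsto_mult_left[OF \<eta>_lim, of 9] by simp
    from tendsto_ennrealI[OF this] show "(\<lambda>m. ennreal (9 * \<eta> m)) \<longlonglongrightarrow> 0" by simp
  qed (auto simp: hT)
  hence "AE x in \<mu>. ennreal ((cmod (h (T x) - h x))\<^sup>2) = 0"
    unfolding N2_def by (subst (asm) le_zero_eq, subst (asm) nn_integral_0_iff_AE) auto
  hence inv: "AE x in \<mu>. h (T x) = h x" by eventually_elim simp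
  have "\<exists>c. AE x in \<mu>. Re (h x) = c" by (rule almost_invariant_const) (use inv in \<open>auto\<close>)
  moreover have "\<exists>c. AE x in \<mu>. Im (h x) = c" by (rule almost_invariant_const) (use inv in \<open>auto\<close>)
  ultimately obtain c1 c2 where "AE x in \<mu>. Re (h x) = c1" "AE x in \<mu>. Im (h x) = c2" by blast
  hence hc: "AE x in \<mu>. h x = Complex c1 c2" by eventually_elim (simp add: complex_eq_iff)
  define c where "c = Complex c1 c2"
  have fc: "L2_fun \<mu> (\<lambda>x. f m x - c)" for m
    unfolding f_def by (intro L2_fun_diff ev_L2 L2_fun_const)
  have fc_le: "(\<integral>x. (cmod (f m x - c))\<^sup>2 \<partial>\<mu>) \<le> \<eta> m" for m
  proof -
    have "ennreal (\<integral>x. (cmod (f m x - c))\<^sup>2 \<partial>\<mu>) = (\<integral>\<^sup>+x. ennreal ((cmod (f m x - c))\<^sup>2) \<partial>\<mu>)"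
      using fc[of m] by (intro nn_integral_eq_integral[symmetric]) (auto simp: L2_fun_def)
    also have "\<dots> = N2 (\<lambda>x. f m x - h x)"
      unfolding N2_def by (rule nn_integral_cong_AE) (use hc in \<open>auto simp: c_def\<close>)
    also have "\<dots> \<le> ennreal (\<eta> m)" by (rule N2f)
    finally show ?thesis using \<eta>0[of m] by (simp add: ennreal_le_iff)
  qed
  \<comment> \<open>All elements of \<open>orb\<close> have the same integral as F, namely 0, so the
    limiting constant c is 0 and with it the minimal norm.\<close>
  have c_le: "cmod c \<le> d" if d: "d > 0" for d
  proof -
    have "\<forall>\<^sub>F n in sequentially. \<eta> n < d * d" using order_tendstoD(2)[OF \<eta>_lim, of "d * d"] d by simp
    then obtain m where m: "\<eta> m < d * d" by (auto simp: eventually_at_top_linorder)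
    have "(\<integral>x. f m x - c \<partial>\<mu>) = (\<integral>x. f m x \<partial>\<mu>) - c"
      using f_int[of m] by (simp add: prob_space)
    also have "(\<integral>x. f m x \<partial>\<mu>) = 0" using integral_orb[OF g(1)[of m]] zero by (simp add: f_def)
    finally have "cmod c = cmod (\<integral>x. f m x - c \<partial>\<mu>)" by simp
    also have "\<dots> \<le> (\<integral>x. cmod (f m x - c) \<partial>\<mu>)" by (rule integral_norm_bound)
    also have "\<dots> \<le> (d + (\<integral>x. (cmod (f m x - c))\<^sup>2 \<partial>\<mu>) / d) / 2" by (rule L2_fun_norm_bound(2)[OF fc d])
    also have "(\<integral>x. (cmod (f m x - c))\<^sup>2 \<partial>\<mu>) / d \<le> \<eta> m / d" using fc_le d by (intro divide_right_mono) auto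
    also have "\<eta> m / d \<le> d" using m d by (simp add: pos_divide_le_eq)
    finally show ?thesis by simp
  qed
  have "cmod c \<le> 0" by (rule field_le_epsilon) (simp add: c_le)
  hence c0: "c = 0" by simp
  have "\<forall>\<^sub>F n in sequentially. \<eta> n < \<epsilon>\<^sup>2" using order_tendstoD(2)[OF \<eta>_lim, of "\<epsilon>\<^sup>2"] \<epsilon> by simp
  then obtain m where m: "\<eta> m < \<epsilon>\<^sup>2" by (auto simp: eventually_at_top_linorder)
  have "(nrm (g m))\<^sup>2 \<le> \<eta> m" using fc_le[of m] by (simp add: nrm_sq_eq c0 f_def)
  hence "(nrm (g m))\<^sup>2 < \<epsilon>\<^sup>2" using m by linarith
  hence "nrm (g m) < \<epsilon>" using \<epsilon> by (simp add: power2_less_imp_less)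
  thus ?thesis using g(1) by blast
qed

text \<open>Carries the convergence of \<open>M\<close> from coefficient families to functions: the
  evaluation \<open>ev\<close> is linear, turns shifts into compositions with powers of T, and
  preserves norms.\<close>

lemma progression_averages_tendsto_0:
  assumes zero: "(\<integral>x. F x \<partial>\<mu>) = 0" and q: "q > 0" and r: "coprime r q"
    and additive: "\<And>m n. m > 0 \<Longrightarrow> n > 0 \<Longrightarrow> a (m * n) = a m + a n"
    and one: "almost_every_prime {p. a p = 1}"
  shows "(\<lambda>N. L2_norm \<mu> (\<lambda>y. (1 / real N) *\<^sub>R (\<Sum>n=1..N. F (it (a (q * n + r)) y)))) \<longlonglongrightarrow> 0"
proof -
  interpret mult_average ip shift_coeffs unit_coeffs a q
  proof
    show "\<exists>X\<ge>1. \<forall>x\<ge>X. (\<Sum>n | n \<in> upto_real x \<and> a n \<noteq> 1. mangoldt n / real n) \<le> e * ln x" if "e > 0" for e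
      by (rule sum_mangoldt_exceptional[OF one that])
  qed (use q additive in auto)
  have sub: "orb \<subseteq> orbit_hull"
  proof
    fix v assume "v \<in> orb"
    thus "v \<in> orbit_hull" by induction (auto intro: orbit_hull.intros)
  qed
  define X where "X = (\<lambda>N. real (q * N + r))"
  define w where "w = (\<lambda>N. (1 / real N) *\<^sub>R (\<Sum>n=1..N. shift_coeffs (a (q * n + r)) unit_coeffs))"
  have M_lim: "(\<lambda>N. nrm (M r (X N))) \<longlonglongrightarrow> 0"
  proof (rule LIMSEQ_I)
    fix e :: real assume e: "e > 0"
    have "\<exists>N. \<forall>x\<ge>N. \<forall>c. coprime c q \<longrightarrow> nrm (M c x) < e"
    proof (rule M_tendsto_0[OF _ e])
      fix d :: real assume "d > 0"
      from small_orb[OF zero this] sub show "\<exists>g\<in>orbit_hull. nrm g < d" by blast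
    qed
    then obtain N where N: "\<And>x. x \<ge> N \<Longrightarrow> nrm (M r x) < e" using r by blast
    have "norm (nrm (M r (X n)) - 0) < e" if n: "n \<ge> nat \<lceil>N\<rceil>" for n
    proof -
      have "N \<le> real n" using n by linarith
      also have "n \<le> q * n + r" using q by (simp add: trans_le_add1)
      hence "real n \<le> X n" unfolding X_def by (rule of_nat_mono)
      finally show ?thesis using N by simp
    qed
    thus "\<exists>no. \<forall>n\<ge>no. norm (nrm (M r (X n)) - 0) < e" by blast
  qed
  \<comment> \<open>The terms q n + r begin at q + r, whereas \<open>S\<close> also counts the
    members of the class up to r. This fixed remainder vanishes after division by N, and the change
    of normalisation from q N + r to N costs at most the factor q + r.\<close>
  have w_le: "nrm (w N) \<le> real (q + r) * nrm (M r (X N)) + nrm (S r (real r)) * (1 / real N)" if N: "N \<ge> 1" for N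
  proof -
    have "real r \<le> X N" unfolding X_def by (rule of_nat_mono) simp
    hence sub: "ap q r (real r) \<subseteq> ap q r (X N)" by (auto simp: ap_def)
    have "(\<Sum>n=1..N. shift_coeffs (a (q * n + r)) unit_coeffs) = (\<Sum>m\<in>ap q r (X N) - ap q r (real r). shift_coeffs (a m) unit_coeffs)"
    proof (rule sum.reindex_bij_witness[of _ "\<lambda>m. (m - r) div q" "\<lambda>n. q * n + r"])
      fix n assume "n \<in> {1..N}"
      thus "q * n + r \<in> ap q r (X N) - ap q r (real r)" using q by (auto simp: ap_def X_def cong_def)
      show "(q * n + r - r) div q = n" using q by simp
    next
      fix m assume "m \<in> ap q r (X N) - ap q r (real r)"
      hence m0: "r < m" "real m \<le> X N" "[m = r] (mod q)" by (auto simp: ap_def)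
      hence m: "r < m" "m \<le> q * N + r" "[m = r] (mod q)" unfolding X_def of_nat_le_iff by blast+
      have "[m - r = r - r] (mod q)" by (rule cong_diff_nat[OF m(3) cong_refl]) (use m in auto)
      hence "q dvd m - r" by (simp add: cong_0_iff)
      then obtain k where k: "m - r = q * k" by blast
      hence mk: "m = q * k + r" using m by linarith
      show "q * ((m - r) div q) + r = m" using mk q by simp
      have "0 < k" using m mk by (intro Nat.gr0I) auto
      moreover have "k \<le> N" using m mk q by simp
      ultimately show "(m - r) div q \<in> {1..N}" using mk q by simp
    qed simp
    also have "\<dots> = S r (X N) - S r (real r)" using sub by (simp add: S_def sum_diff)
    finally have eq: "(\<Sum>n=1..N. shift_coeffs (a (q * n + r)) unit_coeffs) = S r (X N) - S r (real r)" .
    have "w N = (1 / real N) *\<^sub>R S r (X N) + (- 1 / real N) *\<^sub>R S r (real r)"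
      unfolding w_def eq by (simp add: scaleR_diff_right)
    hence "nrm (w N) \<le> nrm ((1 / real N) *\<^sub>R S r (X N)) + nrm ((- 1 / real N) *\<^sub>R S r (real r))"
      by (simp only: nrm_triangle)
    also have "nrm ((- 1 / real N) *\<^sub>R S r (real r)) = nrm (S r (real r)) * (1 / real N)"
      by (simp only: nrm_scale) simp
    also have "nrm ((1 / real N) *\<^sub>R S r (X N)) = X N / real N * nrm (M r (X N))"
    proof -
      have "X N > 0" using N q by (simp add: X_def add_pos_nonneg)
      thus ?thesis by (simp add: nrm_scale M_def)
    qed
    also have "\<dots> \<le> real (q + r) * nrm (M r (X N))"
    proof (rule mult_right_mono)
      have "q * N + r \<le> (q + r) * N" using N by (simp add: distrib_right)
      hence "X N \<le> real (q + r) * real N" unfolding X_def of_nat_mult[symmetric] by (rule of_nat_mono)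
      thus "X N / real N \<le> real (q + r)" using N by (simp add: pos_divide_le_eq)
    qed simp
    finally show ?thesis by simp
  qed
  have "(\<lambda>N. nrm (w N)) \<longlonglongrightarrow> 0"
  proof (rule tendsto_sandwich[of "\<lambda>_. 0"])
    show "\<forall>\<^sub>F N in sequentially. nrm (w N) \<le> real (q + r) * nrm (M r (X N)) + nrm (S r (real r)) * (1 / real N)"
      using eventually_ge_at_top[of 1] by eventually_elim (rule w_le)
    have "(\<lambda>N. real (q + r) * nrm (M r (X N)) + nrm (S r (real r)) * (1 / real N)) \<longlonglongrightarrow> real (q + r) * 0 + nrm (S r (real r)) * 0"
      by (intro tendsto_add tendsto_mult tendsto_const M_lim lim_inverse_n')
    thus "(\<lambda>N. real (q + r) * nrm (M r (X N)) + nrm (S r (real r)) * (1 / real N)) \<longlonglongrightarrow> 0" by simp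
  qed auto
  moreover have "nrm (w N) = L2_norm \<mu> (\<lambda>y. (1 / real N) *\<^sub>R (\<Sum>n=1..N. F (it (a (q * n + r)) y)))" for N
    unfolding nrm_eq L2_norm_def w_def ev_scale ev_sum
    by (intro arg_cong[of _ _ sqrt] Bochner_Integration.integral_cong refl) (simp add: ev_shift ev_unit)
  ultimately show ?thesis by simp
qed

end

section \<open>The theorem\<close>

text \<open>Two reductions: the mean of F is subtracted, and with d = gcd r q additivity gives a (q
  n + r) = a d + a (q' n + r') for coprime r' and q'. The extra power of T preserves the measure and
  so does not change the norm.\<close>

lemma aperiodic_power_action:
  assumes erg: "ergodic_additive_system \<mu> T" and a: "completely_additive a"
    and one: "almost_every_prime {p. a p = 1}"
  shows "aperiodic \<mu> (power_action \<mu> T a)"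
  unfolding aperiodic_def
proof (intro allI impI)
  fix F :: "'a \<Rightarrow> complex" and r q :: nat
  assume L2F: "L2_fun \<mu> F" and r: "r \<ge> 1" and q: "q \<ge> 1"
  interpret ergodic_sys \<mu> T by unfold_locales (rule erg)
  define c where "c = (\<integral>y. F y \<partial>\<mu>)"
  define G where "G = (\<lambda>x. F x - c)"
  have G: "L2_fun \<mu> G" unfolding G_def by (intro L2_fun_diff L2F L2_fun_const)
  interpret ergodic_L2 \<mu> T G by unfold_locales (rule G)
  have additive: "a (m * n) = a m + a n" if "m > 0" "n > 0" for m n
    using a that by (simp add: completely_additive_def)
  have zero: "(\<integral>x. G x \<partial>\<mu>) = 0"
    using L2_fun_norm_bound(1)[OF L2F, of 1] by (simp add: G_def c_def prob_space)
  have [measurable]: "G \<in> borel_measurable \<mu>" using G by (simp add: L2_fun_def)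
  define d where "d = gcd r q"
  have d: "d > 0" using q by (simp add: d_def)
  define r' q' where "r' = r div d" and "q' = q div d"
  have rq: "r = d * r'" "q = d * q'" by (simp_all add: r'_def q'_def d_def)
  have pos: "r' > 0" "q' > 0" using rq r q by (auto intro: Nat.gr0I)
  have cop: "coprime r' q'" unfolding r'_def q'_def d_def using r by (intro div_gcd_coprime) auto
  have avg_eq: "L2_norm \<mu> (\<lambda>x. (\<Sum>n=1..N. F (power_action \<mu> T a (q * n + r) x)) / of_nat N - (\<integral>y. F y \<partial>\<mu>)) =
        L2_norm \<mu> (\<lambda>y. (1 / real N) *\<^sub>R (\<Sum>n=1..N. G (it (a (q' * n + r')) y)))" if N: "N \<ge> 1" for N
  proof -
    define H where "H = (\<lambda>y. (1 / real N) *\<^sub>R (\<Sum>n=1..N. G (it (a (q' * n + r')) y)))"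
    have [measurable]: "H \<in> borel_measurable \<mu>" unfolding H_def by measurable
    have "(\<Sum>n=1..N. F (power_action \<mu> T a (q * n + r) x)) / of_nat N - c = H (it (a d) x)" if x: "x \<in> space \<mu>" for x
    proof -
      have "F (power_action \<mu> T a (q * n + r) x) = G (it (a (q' * n + r')) (it (a d) x)) + c" for n
      proof -
        have "q * n + r = d * (q' * n + r')" by (simp add: rq algebra_simps)
        hence "a (q * n + r) = a (q' * n + r') + a d" using additive[OF d, of "q' * n + r'"] pos by simp
        thus ?thesis by (simp add: power_action_def it_add[OF x] G_def)
      qed
      hence "(\<Sum>n=1..N. F (power_action \<mu> T a (q * n + r) x)) = (\<Sum>n=1..N. G (it (a (q' * n + r')) (it (a d) x))) + of_nat N * c"
        by (simp add: sum.distrib)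
      thus ?thesis using N by (simp add: H_def add_divide_distrib scaleR_conv_of_real)
    qed
    hence "L2_norm \<mu> (\<lambda>x. (\<Sum>n=1..N. F (power_action \<mu> T a (q * n + r) x)) / of_nat N - c) = sqrt (\<integral>x. (cmod (H (it (a d) x)))\<^sup>2 \<partial>\<mu>)"
      unfolding L2_norm_def by (intro arg_cong[of _ _ sqrt] Bochner_Integration.integral_cong refl) simp
    also have "(\<integral>x. (cmod (H (it (a d) x)))\<^sup>2 \<partial>\<mu>) = (\<integral>x. (cmod (H x))\<^sup>2 \<partial>\<mu>)"
      by (rule integral_it[where f = "\<lambda>x. (cmod (H x))\<^sup>2"]) measurable
    finally show ?thesis by (simp add: L2_norm_def H_def c_def)
  qed
  have ev: "\<forall>\<^sub>F N in sequentially. L2_norm \<mu> (\<lambda>y. (1 / real N) *\<^sub>R (\<Sum>n=1..N. G (it (a (q' * n + r')) y))) =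
     L2_norm \<mu> (\<lambda>x. (\<Sum>n=1..N. F (power_action \<mu> T a (q * n + r) x)) / of_nat N - (\<integral>y. F y \<partial>\<mu>))"
    using eventually_ge_at_top[of 1] by (rule eventually_mono) (rule avg_eq[symmetric])
  have "(\<lambda>N. L2_norm \<mu> (\<lambda>y. (1 / real N) *\<^sub>R (\<Sum>n=1..N. G (it (a (q' * n + r')) y)))) \<longlonglongrightarrow> 0"
    by (rule progression_averages_tendsto_0[OF zero pos(2) cop _ one]) (rule additive)
  thus "(\<lambda>N. L2_norm \<mu> (\<lambda>x. (\<Sum>n=1..N. F (power_action \<mu> T a (q * n + r) x)) / of_nat N - (\<integral>y. F y \<partial>\<mu>))) \<longlonglongrightarrow> 0"
    by (rule Lim_transform_eventually[OF _ ev])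
qed

text \<open>T and its inverse move A by the same amount, so every prime with a p \<noteq> 0
  contributes the same \<delta> / p. Convergence against a divergent sum of reciprocals forces
  \<delta> = 0.\<close>

lemma pretentiously_ergodic_power_action:
  assumes erg: "ergodic_additive_system \<mu> T" and a: "\<And>p. prime p \<Longrightarrow> a p \<in> {-1, 0, 1}"
    and many: "many_primes {p. a p \<noteq> 0}"
  shows "pretentiously_ergodic \<mu> (power_action \<mu> T a)"
  unfolding pretentiously_ergodic_def
proof (intro ballI impI)
  interpret ergodic_sys \<mu> T by unfold_locales (rule erg)
  fix A assume A [measurable]: "A \<in> sets \<mu>"
    and sm: "(\<lambda>p. (L2_norm \<mu> (\<lambda>x. indicator A (power_action \<mu> T a p x) - indicator A x))\<^sup>2 / real p) summable_on {p. prime p}"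
  define u where "u = (\<lambda>x. (cmod (indicator A (T x) - indicator A x))\<^sup>2)"
  define \<delta> where "\<delta> = (\<integral>x. u x \<partial>\<mu>)"
  have u0: "u x \<ge> 0" for x by (simp add: u_def)
  have [measurable]: "u \<in> borel_measurable \<mu>" unfolding u_def by measurable
  have u1: "u x \<le> 1" for x by (simp add: u_def indicator_def)
  have u_int: "integrable \<mu> u" by (rule integrable_const_bound[of _ 1]) (use u0 u1 in auto)
  have \<delta>0: "\<delta> \<ge> 0" unfolding \<delta>_def by (intro integral_nonneg_AE) (simp add: u0)
  have norm_eq: "(L2_norm \<mu> (\<lambda>x. indicator A (power_action \<mu> T a p x) - indicator A x))\<^sup>2 = \<delta>"
    if p: "prime p" "a p \<noteq> 0" for p
  proof -
    have "(\<integral>x. (cmod (indicator A (it (a p) x) - indicator A x))\<^sup>2 \<partial>\<mu>) = \<delta>"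
    proof (cases "a p = 1")
      case True
      thus ?thesis by (simp add: \<delta>_def u_def)
    next
      case False
      hence am: "a p = -1" using a[OF p(1)] p(2) by auto
      have "(\<integral>x. (cmod (indicator A (it (-1) x) - indicator A x))\<^sup>2 \<partial>\<mu>) = (\<integral>x. u (it (-1) x) \<partial>\<mu>)"
      proof (rule Bochner_Integration.integral_cong)
        fix x assume x: "x \<in> space \<mu>"
        show "(cmod (indicator A (it (-1) x) - indicator A x))\<^sup>2 = u (it (-1) x)"
          by (simp add: u_def it_minus_1 T_Ti[OF x] norm_minus_commute)
      qed simp
      also have "\<dots> = \<delta>" unfolding \<delta>_def by (rule integral_it) measurable
      finally show ?thesis by (simp add: am)
    qed
    thus ?thesis using \<delta>0 by (simp add: L2_norm_def power_action_def)
  qed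
  have "\<delta> = 0"
  proof (rule ccontr)
    assume "\<delta> \<noteq> 0"
    have "(\<lambda>p. (L2_norm \<mu> (\<lambda>x. indicator A (power_action \<mu> T a p x) - indicator A x))\<^sup>2 / real p) summable_on {p. prime p \<and> p \<in> {p. a p \<noteq> 0}}"
      by (rule summable_on_subset[OF sm]) auto
    hence "(\<lambda>p. \<delta> * (1 / real p)) summable_on {p. prime p \<and> p \<in> {p. a p \<noteq> 0}}"
      by (rule summable_on_cong[THEN iffD1, rotated]) (simp add: norm_eq)
    from summable_on_cmult_right[OF this, of "1 / \<delta>"]
    have "(\<lambda>p. 1 / real p) summable_on {p. prime p \<and> p \<in> {p. a p \<noteq> 0}}"
      using \<open>\<delta> \<noteq> 0\<close> by simp
    thus False using many by (simp add: many_primes_def)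
  qed
  hence "AE x in \<mu>. u x = 0" using u_int u0 by (simp add: \<delta>_def integral_nonneg_eq_0_iff_AE)
  hence "AE x in \<mu>. T x \<in> A \<longleftrightarrow> x \<in> A"
    by eventually_elim (auto simp: u_def indicator_def split: if_splits)
  thus "measure \<mu> A = 0 \<or> measure \<mu> A = 1" by (rule almost_invariant_set[OF A])
qed

section \<open>The swap of two points, a test system for the converse\<close>

definition two_point :: "real measure" where
  "two_point = uniform_count_measure {0, 1}"

lemma space_two_point [simp]: "space two_point = {0, 1}" and sets_two_point [simp]: "sets two_point = Pow {0, 1}"
  by (simp_all add: two_point_def space_uniform_count_measure sets_uniform_count_measure)

lemma measure_two_point: "A \<subseteq> {0, 1} \<Longrightarrow> measure two_point A = real (card A) / 2"
  by (simp add: two_point_def measure_uniform_count_measure)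

lemma ergodic_two_point: "ergodic_additive_system two_point (\<lambda>x. 1 - x)"
proof -
  interpret prob_space two_point unfolding two_point_def by (rule prob_space_uniform_count_measure) auto
  have top: "Metric_space.mtopology {0, 1 :: real} discrete_metric.dd = discrete_topology {0, 1}"
    by (rule discrete_metric.mtopology_discrete_metric)
  have "regular_prob_space two_point"
    unfolding regular_prob_space_def
  proof (intro conjI exI)
    show "prob_space two_point" by unfold_locales
    show "Metric_space (space two_point) discrete_metric.dd" by (simp add: metric_M_dd)
    show "compact_space (Metric_space.mtopology (space two_point) discrete_metric.dd)"
      by (simp add: top compact_space_discrete_topology)
    show "sets two_point = sigma_sets (space two_point) {U. openin (Metric_space.mtopology (space two_point) discrete_metric.dd) U}"
    proof -
      have "{U. openin (discrete_topology {0, 1 :: real}) U} = Pow {0, 1}" by (simp only: openin_discrete_topology Pow_def)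
      moreover have "sigma_sets {0, 1 :: real} (Pow {0, 1}) = Pow {0, 1}"
        by (rule sigma_algebra.sigma_sets_eq[OF sigma_algebra_Pow])
      ultimately show ?thesis by (simp only: top space_two_point sets_two_point)
    qed
  qed
  moreover have bij: "bij_betw (\<lambda>x. 1 - x) (space two_point) (space two_point)"
    by (rule bij_betw_byWitness[of _ "\<lambda>x. 1 - x"]) auto
  moreover have meas: "f \<in> measurable two_point two_point" if "\<And>x. x \<in> {0, 1} \<Longrightarrow> f x \<in> {0, 1}" for f
    using that by (auto simp: measurable_def)
  have 1: "(\<lambda>x. 1 - x) \<in> measurable two_point two_point" by (rule meas) auto
  have 2: "inv_into (space two_point) (\<lambda>x. 1 - x) \<in> measurable two_point two_point"
  proof (rule meas)
    fix x :: real assume "x \<in> {0, 1}"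
    thus "inv_into (space two_point) (\<lambda>x. 1 - x) x \<in> {0, 1}"
      using bspec[OF bij_betwE[OF bij_betw_inv_into[OF bij]], of x] by (simp only: space_two_point)
  qed
  have "distr two_point two_point (\<lambda>x. 1 - x) = two_point"
  proof (rule measure_eqI)
    fix A assume "A \<in> sets (distr two_point two_point (\<lambda>x. 1 - x))"
    hence A: "A \<subseteq> {0, 1}" by simp
    have im: "(\<lambda>x. 1 - x) -` A \<inter> {0, 1} = (\<lambda>x. 1 - x) ` A"
      using A by (force simp: image_iff)
    have card: "card ((\<lambda>x. 1 - x) ` A) = card A" by (rule card_image) (auto simp: inj_on_def)
    have "emeasure (distr two_point two_point (\<lambda>x. 1 - x)) A = emeasure two_point ((\<lambda>x. 1 - x) ` A)"
      using A 1 by (subst emeasure_distr) (auto simp: im)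
    also have "\<dots> = emeasure two_point A"
      using A im unfolding two_point_def by (subst (1 2) emeasure_uniform_count_measure) (auto simp: card)
    finally show "emeasure (distr two_point two_point (\<lambda>x. 1 - x)) A = emeasure two_point A" .
  qed simp
  moreover have "measure two_point A = 0 \<or> measure two_point A = 1"
    if A: "A \<in> sets two_point" and inv: "(\<lambda>x. 1 - x) -` A \<inter> space two_point = A" for A
  proof -
    have iff: "1 - x \<in> A \<longleftrightarrow> x \<in> A" if "x \<in> {0, 1}" for x using inv that by (auto simp: set_eq_iff)
    have "A = {} \<or> A = {0, 1}" using A iff[of 0] by auto
    thus ?thesis by (auto simp: measure_two_point)
  qed
  ultimately show ?thesis
    using 1 2 by (auto simp: ergodic_additive_system_def additive_system_def)
qed

text \<open>In the two-point system the singleton {0} has measure 1 / 2. Its distance has no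
  contribution from primes with a p = 0 and at most 1 / p from the others, hence is finite unless
  the latter are many.\<close>

lemma many_primes_if_pretentiously_ergodic:
  assumes "pretentiously_ergodic two_point (power_action two_point (\<lambda>x. 1 - x) a)"
  shows "many_primes {p. a p \<noteq> 0}"
proof (rule ccontr)
  assume "\<not> many_primes {p. a p \<noteq> 0}"
  hence sm: "(\<lambda>p. 1 / real p) summable_on {p. prime p \<and> a p \<noteq> 0}" by (simp add: many_primes_def)
  interpret ergodic_sys two_point "\<lambda>x. 1 - x" by unfold_locales (rule ergodic_two_point)
  define f where "f = (\<lambda>p. (L2_norm two_point (\<lambda>x. indicator {0} (power_action two_point (\<lambda>x. 1 - x) a p x) - indicator {0} x))\<^sup>2 / real p)"
  have f0: "f p = 0" if "a p = 0" for p
    using that by (simp add: f_def power_action_def L2_norm_def)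
  have f1: "f p \<le> 1 / real p" "f p \<ge> 0" for p
  proof -
    have "(\<integral>x. (cmod (indicator {0} (it (a p) x) - indicator {0} x))\<^sup>2 \<partial>two_point) \<le> (\<integral>x. 1 \<partial>two_point)"
      by (rule integral_mono') (auto simp: indicator_def)
    also have "\<dots> = 1" by (simp add: measure_two_point)
    finally show "f p \<le> 1 / real p" by (simp add: f_def L2_norm_def power_action_def divide_right_mono)
    show "f p \<ge> 0" by (simp add: f_def)
  qed
  have "f summable_on {p. prime p \<and> a p \<noteq> 0}"
    by (rule summable_on_comparison_test[OF sm]) (use f1 in auto)
  hence "f summable_on {p. prime p}"
    by (rule summable_on_cong_neutral[THEN iffD1, rotated -1]) (auto simp: f0)
  moreover have "{0} \<in> sets two_point" by simp
  ultimately have "measure two_point {0} = 0 \<or> measure two_point {0} = 1"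
    using assms unfolding pretentiously_ergodic_def f_def by blast
  thus False by (simp add: measure_two_point)
qed

lemma completely_additive_Omega_in: "completely_additive (\<lambda>n. int (Omega_in P n))"
  by (simp add: completely_additive_def Omega_in_def prime_factorization_mult)

lemma Omega_in_prime: "prime p \<Longrightarrow> Omega_in P p = (if p \<in> P then 1 else 0)"
  by (simp add: Omega_in_def prime_factorization_prime)

lemma Omega_eq: "Omega = Omega_in UNIV"
  by (simp add: fun_eq_iff Omega_def Omega_in_def)

lemma almost_every_prime_Omega_in: "almost_every_prime {p. int (Omega_in P p) = 1} \<longleftrightarrow> almost_every_prime P"
proof -
  have "{p. prime p \<and> p \<notin> {p. int (Omega_in P p) = 1}} = {p. prime p \<and> p \<notin> P}"
    by (auto simp: Omega_in_prime)
  thus ?thesis by (simp only: almost_every_prime_def)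
qed

lemma many_primes_Omega_in: "many_primes {p. int (Omega_in P p) \<noteq> 0} \<longleftrightarrow> many_primes P"
proof -
  have "{p. prime p \<and> p \<in> {p. int (Omega_in P p) \<noteq> 0}} = {p. prime p \<and> p \<in> P}"
    by (auto simp: Omega_in_prime split: if_splits)
  thus ?thesis by (simp only: many_primes_def)
qed

theorem corollary1p26:
  shows
  "(\<forall>a. completely_additive a \<and> (\<forall>p. prime p \<longrightarrow> a p \<in> {-1, 0, 1}) \<longrightarrow>
      ((\<forall>(\<mu> :: real measure) T. ergodic_additive_system \<mu> T \<longrightarrow>
          pretentiously_ergodic \<mu> (power_action \<mu> T a))
        \<longleftrightarrow> many_primes {p. a p \<noteq> 0}) \<and>
      (many_primes {p. a p \<noteq> 0} \<longrightarrow>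
        (\<forall>(\<mu> :: 'a measure) T. ergodic_additive_system \<mu> T \<longrightarrow>
          pretentiously_ergodic \<mu> (power_action \<mu> T a))) \<and>
      (almost_every_prime {p. a p = 1} \<longrightarrow>
        (\<forall>(\<mu> :: 'a measure) T. ergodic_additive_system \<mu> T \<longrightarrow>
          aperiodic \<mu> (power_action \<mu> T a)))) \<and>
   (\<forall>(\<mu> :: 'a measure) T. ergodic_additive_system \<mu> T \<longrightarrow>
      aperiodic \<mu> (power_action \<mu> T (\<lambda>n. int (Omega n))) \<and>
      (\<forall>P \<subseteq> {p. prime p}.
        (many_primes P \<longrightarrow>
          pretentiously_ergodic \<mu> (power_action \<mu> T (\<lambda>n. int (Omega_in P n)))) \<and>
        (almost_every_prime P \<longrightarrow>
          aperiodic \<mu> (power_action \<mu> T (\<lambda>n. int (Omega_in P n))))))"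
proof (intro conjI allI impI)
  fix a assume a: "completely_additive a \<and> (\<forall>p. prime p \<longrightarrow> a p \<in> {-1, 0, 1})"
  show "(\<forall>(\<mu> :: real measure) T. ergodic_additive_system \<mu> T \<longrightarrow>
          pretentiously_ergodic \<mu> (power_action \<mu> T a)) \<longleftrightarrow> many_primes {p. a p \<noteq> 0}"
    using a ergodic_two_point many_primes_if_pretentiously_ergodic pretentiously_ergodic_power_action by metis
  show "pretentiously_ergodic \<mu> (power_action \<mu> T a)"
    if "many_primes {p. a p \<noteq> 0}" "ergodic_additive_system \<mu> T" for \<mu> :: "'a measure" and T
    using pretentiously_ergodic_power_action[OF that(2) _ that(1)] a by blast
  show "aperiodic \<mu> (power_action \<mu> T a)"
    if "almost_every_prime {p. a p = 1}" "ergodic_additive_system \<mu> T" for \<mu> :: "'a measure" and T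
    using aperiodic_power_action[OF that(2) _ that(1)] a by blast
next
  fix \<mu> :: "'a measure" and T assume erg: "ergodic_additive_system \<mu> T"
  have "almost_every_prime UNIV" by (simp add: almost_every_prime_def)
  thus "aperiodic \<mu> (power_action \<mu> T (\<lambda>n. int (Omega n)))"
    unfolding Omega_eq
    by (intro aperiodic_power_action[OF erg completely_additive_Omega_in]) (simp only: almost_every_prime_Omega_in)
  fix P :: "nat set"
  show "pretentiously_ergodic \<mu> (power_action \<mu> T (\<lambda>n. int (Omega_in P n)))" if "many_primes P"
    by (rule pretentiously_ergodic_power_action[OF erg])
       (use that in \<open>simp_all only: many_primes_Omega_in, simp add: Omega_in_prime\<close>)
  show "aperiodic \<mu> (power_action \<mu> T (\<lambda>n. int (Omega_in P n)))" if "almost_every_prime P"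
    using that by (intro aperiodic_power_action[OF erg completely_additive_Omega_in]) (simp only: almost_every_prime_Omega_in)
qed

end
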